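(* Let $n,d\ge1$ and $k\ge 2$ be integers, let $\xi\in\mathbb{C}$ be a primitive $k$-th root of unity, and $S=\mathbb{C}[x_0,\ldots,x_n]$. Let $I_k^{(d)}\subset S$ be the ideal associated to the scheme of fat points of multiplicity $d$ supported on the $k^n$ points $[1:\xi^{g_1}:\cdots:\xi^{g_n}]\in\mathbb{P}^n$, $0\le g_i\le k-1$. Then $I_k^{(d)}$ is generated by the monomials of degree $d$ in the $n$ forms $\mathcal{Q}_i=x_i^k-x_n^k$, $i=0,\ldots,n-1$, and the Hilbert series of the quotient is $$\mathrm{HS}\left(S/I_k^{(d)};t\right)=\frac{1+\sum_{i=1}^n(-1)^i\beta_i\,t^{kd+k(i-1)}}{(1-t)^{n+1}},$$ where the $\beta_i$ are the graded Betti numbers of $S/I_k^{(d)}$, given by $$\beta_i:=\beta_{i,\,kd+k(i-1)}=\binom{d+i-2}{i-1}\binom{d+n-1}{n-i},\qquad i=1,\ldots,n.$$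
   Context: For a point $P\in\mathbb{P}^n$ let $\wp_P\subset S$ be the homogeneous prime ideal generated by all forms vanishing at $P$. The ideal of the scheme of fat points of multiplicity $d$ supported on points $P_1,\ldots,P_g$ is $\wp_{P_1}^d\cap\cdots\cap\wp_{P_g}^d$. Graded Betti numbers are $\beta_{i,j}(S/I)=\dim_{\mathbb{C}}\mathrm{Tor}_i^S(S/I,\mathbb{C})_j$. The Hilbert series of a graded quotient $A$ is $\mathrm{HS}(A;t)=\sum_{m\ge0}\dim_{\mathbb{C}}(A_m)\,t^m$. *)

theory Defs
  imports
    "HOL-Algebra.Ideal_Product"
    "HOL-Computational_Algebra.Formal_Power_Series"
    "HOL-Library.Poly_Mapping"
    "HOL-Library.Function_Algebras"
begin

section \<open>The standard graded polynomial ring\<close>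

text \<open>
  Monomials are exponent vectors of type \<^typ>\<open>nat \<Rightarrow>\<^sub>0 nat\<close>; multiplication of poly-mappings is
  convolution, so \<open>cpoly\<close> is the polynomial ring over the complex numbers in the variables
  \<open>x\<^sub>0, x\<^sub>1, \<dots>\<close>, and \<open>poly_ring n\<close> is its subring \<open>S\<close> in the variables \<open>x\<^sub>0, \<dots>, x\<^sub>n\<close>.
\<close>

type_synonym cpoly = "(nat \<Rightarrow>\<^sub>0 nat) \<Rightarrow>\<^sub>0 complex"

definition polys :: "nat \<Rightarrow> cpoly set" where
  "polys n = {f. \<forall>m\<in>Poly_Mapping.keys f. Poly_Mapping.keys m \<subseteq> {..n}}"

definition poly_ring :: "nat \<Rightarrow> cpoly ring" where
  "poly_ring n = \<lparr>carrier = polys n, monoid.mult = (*), one = 1, zero = 0, add = (+)\<rparr>"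

lemma polys_closed:
  shows "0 \<in> polys n" and "1 \<in> polys n"
    and "f \<in> polys n \<Longrightarrow> g \<in> polys n \<Longrightarrow> f + g \<in> polys n"
    and "f \<in> polys n \<Longrightarrow> g \<in> polys n \<Longrightarrow> f * g \<in> polys n"
    and "f \<in> polys n \<Longrightarrow> - f \<in> polys n"
proof -
  show "0 \<in> polys n" "1 \<in> polys n"
    by (auto simp: polys_def)
  show "f + g \<in> polys n" if "f \<in> polys n" "g \<in> polys n"
    using that Poly_Mapping.keys_add[of f g] by (fastforce simp: polys_def)
  show "f * g \<in> polys n" if "f \<in> polys n" "g \<in> polys n"
    unfolding polys_def
  proof (intro CollectI ballI)
    fix m assume "m \<in> Poly_Mapping.keys (f * g)"
    then obtain a b where "m = a + b" "a \<in> Poly_Mapping.keys f" "b \<in> Poly_Mapping.keys g"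
      using Poly_Mapping.keys_mult[of f g] by blast
    then show "Poly_Mapping.keys m \<subseteq> {..n}"
      using that Poly_Mapping.keys_add[of a b] unfolding polys_def by fastforce
  qed
  show "- f \<in> polys n" if "f \<in> polys n"
    using that by (simp add: polys_def)
qed

lemma cring_poly_ring: "cring (poly_ring n)"
proof (rule cringI)
  show "abelian_group (poly_ring n)"
  proof (rule abelian_groupI, goal_cases)
    case (6 f)
    then show ?case
      by (intro bexI[of _ "- f"]) (auto simp: poly_ring_def polys_closed)
  qed (auto simp: poly_ring_def polys_closed algebra_simps)
  show "comm_monoid (poly_ring n)"
    by (rule comm_monoidI) (auto simp: poly_ring_def polys_closed algebra_simps)
qed (auto simp: poly_ring_def algebra_simps)

definition var :: "nat \<Rightarrow> cpoly" where
  "var i = Poly_Mapping.single (Poly_Mapping.single i 1) 1"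

definition mdeg :: "(nat \<Rightarrow>\<^sub>0 nat) \<Rightarrow> nat" where
  "mdeg m = (\<Sum>i\<in>Poly_Mapping.keys m. Poly_Mapping.lookup m i)"

text \<open>The graded piece \<open>S\<^sub>e\<close>, i.e. the forms of degree \<open>e\<close> together with \<open>0\<close>.\<close>

definition forms :: "nat \<Rightarrow> nat \<Rightarrow> cpoly set" where
  "forms n e = {f \<in> polys n. \<forall>m\<in>Poly_Mapping.keys f. mdeg m = e}"

definition eval :: "(nat \<Rightarrow> complex) \<Rightarrow> cpoly \<Rightarrow> complex" where
  "eval P f = (\<Sum>m\<in>Poly_Mapping.keys f. Poly_Mapping.lookup f m *
     (\<Prod>i\<in>Poly_Mapping.keys m. P i ^ Poly_Mapping.lookup m i))"


section \<open>Ideals of fat points\<close>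

text \<open>
  A point of projective \<open>n\<close>-space is given by a representative \<open>P\<close>, of which only the homogeneous
  coordinates \<open>P 0, \<dots>, P n\<close> matter; whether a form vanishes does not depend on the representative.
\<close>

definition point_ideal :: "nat \<Rightarrow> (nat \<Rightarrow> complex) \<Rightarrow> cpoly set" where
  "point_ideal n P = Idl\<^bsub>poly_ring n\<^esub> {f. (\<exists>e. f \<in> forms n e) \<and> eval P f = 0}"

text \<open>The power is taken with respect to the product of ideals.\<close>

definition fat_points_ideal :: "nat \<Rightarrow> nat \<Rightarrow> (nat \<Rightarrow> complex) set \<Rightarrow> cpoly set" where
  "fat_points_ideal n d X = (\<Inter>P\<in>X. point_ideal n P [^]\<^bsub>ideals_set (poly_ring n)\<^esub> d)"

definition primitive_root_unity :: "nat \<Rightarrow> complex \<Rightarrow> bool" where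
  "primitive_root_unity k \<xi> \<longleftrightarrow> \<xi> ^ k = 1 \<and> (\<forall>j. 0 < j \<and> j < k \<longrightarrow> \<xi> ^ j \<noteq> 1)"

definition root_point :: "nat \<Rightarrow> complex \<Rightarrow> (nat \<Rightarrow> nat) \<Rightarrow> nat \<Rightarrow> complex" where
  "root_point n \<xi> g = (\<lambda>i. if i = 0 then 1 else if i \<le> n then \<xi> ^ g i else 0)"

definition root_points :: "nat \<Rightarrow> nat \<Rightarrow> complex \<Rightarrow> (nat \<Rightarrow> complex) set" where
  "root_points n k \<xi> = root_point n \<xi> ` {g. \<forall>i\<in>{1..n}. g i \<le> k - 1}"


section \<open>Dimension of a quotient space and Hilbert series\<close>

text \<open>
  \<open>quot_basis s V W B\<close>: the classes of the elements of \<open>B\<close> are distinct and form a finite basis of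
  \<open>V / W\<close>, where \<open>W \<subseteq> V\<close> are subspaces with respect to the scalar multiplication \<open>s\<close>.
\<close>

definition quot_basis ::
  "(complex \<Rightarrow> 'v \<Rightarrow> 'v) \<Rightarrow> 'v set \<Rightarrow> 'v set \<Rightarrow> 'v::ab_group_add set \<Rightarrow> bool" where
  "quot_basis s V W B \<longleftrightarrow> finite B \<and> B \<subseteq> V \<and>
     (\<forall>v\<in>V. \<exists>c. v - (\<Sum>b\<in>B. s (c b) b) \<in> W) \<and>
     (\<forall>c. (\<Sum>b\<in>B. s (c b) b) \<in> W \<longrightarrow> (\<forall>b\<in>B. c b = 0))"

definition quot_dim ::
  "(complex \<Rightarrow> 'v \<Rightarrow> 'v) \<Rightarrow> 'v set \<Rightarrow> 'v::ab_group_add set \<Rightarrow> nat" where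
  "quot_dim s V W = card (SOME B. quot_basis s V W B)"

text \<open>For a homogeneous ideal \<open>I\<close> of \<open>S\<close>, the graded piece \<open>(S/I)\<^sub>m\<close> is \<open>S\<^sub>m / (I \<inter> S\<^sub>m)\<close>.\<close>

definition hilbert_fun :: "nat \<Rightarrow> cpoly set \<Rightarrow> nat \<Rightarrow> nat" where
  "hilbert_fun n I m =
     quot_dim (\<lambda>c f. Poly_Mapping.single 0 c * f) (forms n m) (I \<inter> forms n m)"

definition hilbert_series :: "nat \<Rightarrow> cpoly set \<Rightarrow> rat fps" where
  "hilbert_series n I = Abs_fps (\<lambda>m. of_nat (hilbert_fun n I m))"


section \<open>Graded Betti numbers\<close>

text \<open>
  A record of the following type stands for an augmented complex
  \<open>\<dots> \<rightarrow> F\<^sub>2 \<rightarrow> F\<^sub>1 \<rightarrow> F\<^sub>0 \<rightarrow> S/I\<close> of graded free \<open>S\<close>-modules of finite rank, where \<open>F\<^sub>i\<close> is the direct sum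
  of the \<open>S(- shift i a)\<close> for \<open>a < rk i\<close>, the map \<open>F\<^bsub>i+1\<^esub> \<rightarrow> F\<^sub>i\<close> is given by the matrix \<open>bd i\<close> acting on
  column vectors, and \<open>F\<^sub>0 \<rightarrow> S/I\<close> sends the \<open>a\<close>-th basis vector to the class of \<open>aug a\<close>.
  Vectors of length \<open>r\<close> are functions on the natural numbers vanishing from \<open>r\<close> on.
\<close>

record free_complex =
  rk :: "nat \<Rightarrow> nat"
  shift :: "nat \<Rightarrow> nat \<Rightarrow> int"
  bd :: "nat \<Rightarrow> nat \<Rightarrow> nat \<Rightarrow> cpoly"
  aug :: "nat \<Rightarrow> cpoly"

definition mat_app ::
  "nat \<Rightarrow> nat \<Rightarrow> (nat \<Rightarrow> nat \<Rightarrow> 'a) \<Rightarrow> (nat \<Rightarrow> 'a) \<Rightarrow> nat \<Rightarrow> 'a::comm_ring_1" where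
  "mat_app r c A v = (\<lambda>a. if a < r then \<Sum>b<c. A a b * v b else 0)"

definition free_mod :: "nat \<Rightarrow> nat \<Rightarrow> (nat \<Rightarrow> cpoly) set" where
  "free_mod n r = {v. (\<forall>a<r. v a \<in> polys n) \<and> (\<forall>a\<ge>r. v a = 0)}"

text \<open>
  The first two conditions say that all maps are homogeneous of degree \<open>0\<close>, the third one that the
  augmentation is onto \<open>S/I\<close>, and the last two are exactness at \<open>F\<^sub>0\<close> and at \<open>F\<^bsub>i+1\<^esub>\<close>.
\<close>

definition graded_free_resolution :: "nat \<Rightarrow> cpoly set \<Rightarrow> free_complex \<Rightarrow> bool" where
  "graded_free_resolution n I F \<longleftrightarrow>
     (\<forall>a<rk F 0. aug F a \<in> polys n \<and>
        (\<forall>m\<in>Poly_Mapping.keys (aug F a). int (mdeg m) = shift F 0 a)) \<and>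
     (\<forall>i. \<forall>a<rk F i. \<forall>b<rk F (Suc i). bd F i a b \<in> polys n \<and>
        (\<forall>m\<in>Poly_Mapping.keys (bd F i a b). int (mdeg m) = shift F (Suc i) b - shift F i a)) \<and>
     (\<forall>f\<in>polys n. \<exists>v\<in>free_mod n (rk F 0). f - (\<Sum>a<rk F 0. aug F a * v a) \<in> I) \<and>
     {v \<in> free_mod n (rk F 0). (\<Sum>a<rk F 0. aug F a * v a) \<in> I} =
       mat_app (rk F 0) (rk F 1) (bd F 0) ` free_mod n (rk F 1) \<and>
     (\<forall>i. {v \<in> free_mod n (rk F (Suc i)). mat_app (rk F i) (rk F (Suc i)) (bd F i) v = 0} =
       mat_app (rk F (Suc i)) (rk F (Suc (Suc i))) (bd F (Suc i)) ` free_mod n (rk F (Suc (Suc i))))"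

text \<open>
  Applying \<open>- \<otimes>\<^sub>S \<complex>\<close>, where \<open>\<complex> = S/(x\<^sub>0, \<dots>, x\<^sub>n)\<close> sits in degree \<open>0\<close>, turns \<open>S(- e)\<close> into a copy of
  \<open>\<complex>\<close> in degree \<open>e\<close> and replaces every matrix entry by its constant coefficient.
  \<open>tensor_comp F i j\<close> is the degree \<open>j\<close> part of \<open>F\<^sub>i \<otimes>\<^sub>S \<complex>\<close>.
\<close>

definition tensor_comp :: "free_complex \<Rightarrow> nat \<Rightarrow> int \<Rightarrow> (nat \<Rightarrow> complex) set" where
  "tensor_comp F i j = {v. \<forall>a. v a \<noteq> 0 \<longrightarrow> a < rk F i \<and> shift F i a = j}"

definition tensor_bd :: "free_complex \<Rightarrow> nat \<Rightarrow> (nat \<Rightarrow> complex) \<Rightarrow> nat \<Rightarrow> complex" where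
  "tensor_bd F i =
     mat_app (rk F i) (rk F (Suc i)) (\<lambda>a b. Poly_Mapping.lookup (bd F i a b) 0)"

definition tor_cycles :: "free_complex \<Rightarrow> nat \<Rightarrow> int \<Rightarrow> (nat \<Rightarrow> complex) set" where
  "tor_cycles F i j =
     {v \<in> tensor_comp F i j. case i of 0 \<Rightarrow> True | Suc i' \<Rightarrow> tensor_bd F i' v = 0}"

definition tor_boundaries :: "free_complex \<Rightarrow> nat \<Rightarrow> int \<Rightarrow> (nat \<Rightarrow> complex) set" where
  "tor_boundaries F i j = tensor_bd F i ` tensor_comp F (Suc i) j"

text \<open>
  \<open>\<beta>\<^sub>i\<^sub>,\<^sub>j(S/I) = dim Tor\<^sub>i(S/I, \<complex>)\<^sub>j\<close>, with \<open>Tor\<close> computed from a chosen graded free resolution of \<open>S/I\<close>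
  (one of finite ranks exists since \<open>S\<close> is Noetherian, and the result does not depend on the choice).
\<close>

definition graded_betti :: "nat \<Rightarrow> cpoly set \<Rightarrow> nat \<Rightarrow> int \<Rightarrow> nat" where
  "graded_betti n I i j =
     (let F = (SOME F. graded_free_resolution n I F)
      in quot_dim (\<lambda>c v a. c * v a) (tor_cycles F i j) (tor_boundaries F i j))"

end

theory Submission
  imports Defs "HOL-Computational_Algebra.Polynomial"
begin

text \<open>
  Put \<open>Q\<^sub>i = x\<^sub>i\<^sup>k - x\<^sub>n\<^sup>k\<close>.  The products \<open>Q\<^sup>a x\<^sup>b x\<^sub>n\<^sup>e\<close> with all \<open>b\<^sub>i < k\<close> form a \<open>\<complex>\<close>-basis
  of \<open>S\<close>, so replacing every \<open>x\<^sub>i\<^sup>k\<close> in a monomial by \<open>Q\<^sub>i\<close> is a degree-preserving linear bijection.  It turns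
  the powers of \<open>(Q\<^sub>0, \<dots>, Q\<^bsub>r-1\<^esub>)\<close> into spans of monomials, from which colon ideals and Hilbert
  functions can be read off.  If \<open>f\<close> lies in all \<open>\<wp>\<^sub>P\<^sup>d\<close>, then it vanishes to order \<open>d\<close> along every
  curve through every \<open>P\<close>; testing this on curves on which \<open>Q\<^sub>i\<close> vanishes to first order with
  independent derivatives shows that only basis elements with \<open>a\<^sub>0 + \<dots> + a\<^bsub>n-1\<^esub> \<ge> d\<close> occur in \<open>f\<close>.
  Writing \<open>J r d\<close> for the powers, \<open>J (r + 1) (d + 1) = J r (d + 1) + Q\<^sub>r J (r + 1) d\<close>, where \<open>Q\<^sub>r\<close> is a
  nonzerodivisor modulo \<open>J r (d + 1)\<close>.  Iterated mapping cones therefore give a resolution of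
  \<open>S/J r d\<close> whose \<open>i\<close>-th module is generated in the single degree \<open>k d + k (i - 1)\<close>;
  for \<open>d \<ge> 1\<close> it is minimal for degree reasons, and chain homotopies identify Tor computed from any other resolution with it.
\<close>

text \<open>The substitution of \<open>Q i\<close> for \<open>x_i^k\<close> is linear but not
  multiplicative; it is compatible only with multiplication by polynomials in
  \<open>x_0^k, ..., x_{n-1}^k, x_n\<close>. So the image of a monomial ideal is not an ideal for
  free, and only facts about multiplication by a single \<open>Q i\<close> can be transported
  directly. The rest comes from the recursion in \<open>r\<close> and \<open>d\<close>, which is why
  powers are studied for all initial segments of the \<open>Q i\<close> and not only for
  \<open>r = n\<close>.

  The basis fits the points: on the curve \<open>x_i = t z_i (1 + w_i s)\<close> with
  \<open>z_i ^ k = 1\<close>, the lowest term of \<open>Q^a x^b\<close> is a constant times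
  \<open>w^a z^b\<close>. These functions of \<open>(w, z)\<close> are independent because every
  \<open>b_i\<close> is smaller than the number \<open>k\<close> of values of \<open>z_i\<close>.

  The degrees fit the recursion: multiplication by \<open>Q r\<close> raises degrees by
  \<open>k\<close>, which is also the step between neighbouring positions of the resolutions. Hence
  the three pieces of a cone have generators in the same degree, and ranks simply add. The Hilbert
  series is found separately, by counting monomials, and obeys the same recursion.\<close>

abbreviation lookup where "lookup \<equiv> Poly_Mapping.lookup"
abbreviation keys where "keys \<equiv> Poly_Mapping.keys"
abbreviation single where "single \<equiv> Poly_Mapping.single"
abbreviation cst :: "complex \<Rightarrow> cpoly" where "cst c \<equiv> single 0 c"

section \<open>Polynomials\<close>

lemma cst_mult: "cst (a * b) = cst a * cst b"
  by (simp add: mult_single)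

lemma cst_add: "cst (a + b) = cst a + cst b"
  by (rule single_add)

lemma sum_monomials: "(\<Sum>m\<in>keys f. single m (lookup f m)) = f"
proof (rule poly_mapping_eqI)
  fix m
  have "lookup (\<Sum>m\<in>keys f. single m (lookup f m)) m = (\<Sum>q\<in>keys f. if q = m then lookup f m else 0)"
    by (auto simp: lookup_sum lookup_single when_def intro!: sum.cong)
  also have "\<dots> = lookup f m"
    by (auto simp: in_keys_iff)
  finally show "lookup (\<Sum>m\<in>keys f. single m (lookup f m)) m = lookup f m" .
qed

lemma cpoly_induct [case_names zero add]:
  assumes "P 0" and "\<And>m c f. P f \<Longrightarrow> P (single m c + f)"
  shows "P (f :: 'a \<Rightarrow>\<^sub>0 'b::comm_monoid_add)"
proof -
  have "P (\<Sum>m\<in>A. single m (lookup f m))" if "finite A" for A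
    using that by induction (auto intro: assms)
  from this[of "keys f"] show ?thesis by (simp add: sum_monomials)
qed

lemma polys_iff: "f \<in> polys n \<longleftrightarrow> (\<forall>m\<in>keys f. keys m \<subseteq> {..n})"
  by (simp add: polys_def)

lemma polys_single: "keys m \<subseteq> {..n} \<Longrightarrow> single m c \<in> polys n"
  by (simp add: polys_def)

lemma polys_cst [simp]: "cst c \<in> polys n"
  by (simp add: polys_def)

lemma polys_sum: "(\<And>a. a \<in> A \<Longrightarrow> f a \<in> polys n) \<Longrightarrow> sum f A \<in> polys n"
  by (induction A rule: infinite_finite_induct) (auto simp: polys_closed)

lemma polys_prod: "(\<And>a. a \<in> A \<Longrightarrow> f a \<in> polys n) \<Longrightarrow> prod f A \<in> polys n"
  by (induction A rule: infinite_finite_induct) (auto simp: polys_closed)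

lemma polys_power: "f \<in> polys n \<Longrightarrow> f ^ e \<in> polys n"
  by (induction e) (auto simp: polys_closed)

lemma polys_diff: "f \<in> polys n \<Longrightarrow> g \<in> polys n \<Longrightarrow> f - g \<in> polys n"
  by (metis polys_closed(3,5) add_uminus_conv_diff)

lemma polys_induct [consumes 1, case_names zero add]:
  assumes "f \<in> polys n" "P 0"
    and "\<And>m c f. keys m \<subseteq> {..n} \<Longrightarrow> f \<in> polys n \<Longrightarrow> P f \<Longrightarrow> P (single m c + f)"
  shows "P f"
proof -
  have "(\<Sum>m\<in>A. single m (lookup f m)) \<in> polys n \<and> P (\<Sum>m\<in>A. single m (lookup f m))"
    if "finite A" "A \<subseteq> keys f" for A
    using that
  proof induction
    case (insert m A)
    moreover have "keys m \<subseteq> {..n}"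
      using assms(1) insert.prems by (auto simp: polys_iff)
    ultimately show ?case
      by (auto intro!: assms(3) polys_closed(3) polys_single)
  qed (auto intro: assms(2) polys_closed)
  from this[of "keys f"] show ?thesis by (simp add: sum_monomials)
qed

lemma keys_plus_nat: "keys (a + b) = keys a \<union> keys (b :: 'a \<Rightarrow>\<^sub>0 nat)"
  by (auto simp: in_keys_iff lookup_add)

lemma lookup_monomial_mult: "lookup (single a c * f) (a + m) = c * lookup (f :: cpoly) m"
proof (induction f rule: cpoly_induct)
  case (add q e f)
  then show ?case
    by (simp add: distrib_left lookup_add mult_single lookup_single when_def)
qed simp

lemma keys_monomial_mult: "q \<in> keys (single a c * (f :: cpoly)) \<Longrightarrow> \<exists>m\<in>keys f. q = a + m"
  using keys_mult[of "single a c" f] by (auto split: if_splits)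

lemma lookup_cst_mult [simp]: "lookup (cst c * f) m = c * lookup (f :: cpoly) m"
  using lookup_monomial_mult[of 0 c f m] by simp

text \<open>Exponent vectors add up to 0 only if both are 0. This multiplicativity lies behind the
  reduction modulo the variables, hence behind Tor.\<close>

lemma lookup_mult_zero: "lookup (f * g :: cpoly) 0 = lookup f 0 * lookup g 0"
proof (induction f rule: cpoly_induct)
  case (add q e f)
  have "lookup (single q e * g) 0 = lookup (single q e) 0 * lookup g 0"
  proof (cases "q = 0")
    case False
    then have "keys q \<noteq> {}" by simp
    then have "0 \<notin> keys (single q e * g)"
      using keys_monomial_mult[of 0 q e g] by (metis keys_plus_nat keys_zero sup_eq_bot_iff)
    then show ?thesis using False by (simp add: lookup_single in_keys_iff)
  qed simp
  then show ?case using add by (simp add: distrib_right lookup_add)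
qed simp

lemma mdeg_eq_sum: "finite A \<Longrightarrow> keys m \<subseteq> A \<Longrightarrow> mdeg m = (\<Sum>i\<in>A. lookup m i)"
  unfolding mdeg_def by (rule sum.mono_neutral_left) (auto simp: in_keys_iff)

lemma mdeg_add: "mdeg (a + b) = mdeg a + mdeg b"
  by (simp add: mdeg_eq_sum[of "keys a \<union> keys b"] keys_plus_nat lookup_add sum.distrib)

lemma mdeg_zero [simp]: "mdeg 0 = 0"
  by (simp add: mdeg_def)

lemma mdeg_single [simp]: "mdeg (single i e) = e"
  by (simp add: mdeg_def)

lemma var_power: "var i ^ e = single (single i e) 1"
  by (induction e) (auto simp: var_def mult_single simp flip: single_add)

lemma var_polys: "i \<le> n \<Longrightarrow> var i \<in> polys n"
  by (auto simp: var_def intro: polys_single)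

lemma forms_iff: "f \<in> forms n e \<longleftrightarrow> f \<in> polys n \<and> (\<forall>m\<in>keys f. mdeg m = e)"
  by (simp add: forms_def)

lemma forms_add: "f \<in> forms n e \<Longrightarrow> g \<in> forms n e \<Longrightarrow> f + g \<in> forms n e"
  using keys_add[of f g] by (auto simp: forms_iff polys_closed)

lemma forms_zero: "0 \<in> forms n e"
  by (auto simp: forms_iff polys_closed)

lemma forms_mult: "f \<in> forms n a \<Longrightarrow> g \<in> forms n b \<Longrightarrow> f * g \<in> forms n (a + b)"
  using keys_mult[of f g] by (fastforce simp: forms_iff polys_closed mdeg_add)

lemma forms_sum: "(\<And>a. a \<in> A \<Longrightarrow> f a \<in> forms n e) \<Longrightarrow> sum f A \<in> forms n e"
  by (induction A rule: infinite_finite_induct) (auto simp: forms_zero forms_add)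

lemma forms_prod:
  "finite A \<Longrightarrow> (\<And>a. a \<in> A \<Longrightarrow> f a \<in> forms n (e a)) \<Longrightarrow> prod f A \<in> forms n (sum e A)"
  by (induction A rule: finite_induct) (auto simp: forms_iff polys_closed(2) intro!:
      forms_mult[unfolded forms_iff])

lemma forms_cst: "cst c \<in> forms n 0"
  by (auto simp: forms_iff)

lemma forms_power: "f \<in> forms n e \<Longrightarrow> f ^ a \<in> forms n (a * e)"
  using forms_cst[of 1 n] by (induction a) (auto intro: forms_mult)

lemma forms_var: "i \<le> n \<Longrightarrow> var i \<in> forms n 1"
  using var_polys[of i n] by (auto simp: forms_iff var_def)

subsection \<open>Linear extension and substitution\<close>

text \<open>The target ring is left open because three are used: polynomials (substitution), complex
  numbers (evaluation at a point) and \<open>complex poly\<close> (restriction to a parametrised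
  curve).\<close>

locale coeff_hom =
  fixes h :: "complex \<Rightarrow> 'b::comm_ring_1"
  assumes h_zero: "h 0 = 0" and h_one: "h 1 = 1"
    and h_add: "h (a + b) = h a + h b" and h_mult: "h (a * b) = h a * h b"
begin

text \<open>\<open>T\<close> is an arbitrary function on monomials: the map \<open>twist\<close>
  below is extended linearly although it is not multiplicative.\<close>

definition lext :: "((nat \<Rightarrow>\<^sub>0 nat) \<Rightarrow> 'b) \<Rightarrow> cpoly \<Rightarrow> 'b" where
  "lext T f = (\<Sum>m\<in>keys f. h (lookup f m) * T m)"

lemma lext_eq_sum: "finite A \<Longrightarrow> keys f \<subseteq> A \<Longrightarrow> lext T f = (\<Sum>m\<in>A. h (lookup f m) * T m)"
  unfolding lext_def by (rule sum.mono_neutral_left) (auto simp: in_keys_iff h_zero)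

lemma lext_zero [simp]: "lext T 0 = 0"
  by (simp add: lext_def)

lemma lext_single: "lext T (single m c) = h c * T m"
  by (simp add: lext_def h_zero)

lemma lext_add: "lext T (f + g) = lext T f + lext T g"
proof -
  have "lext T e = (\<Sum>m\<in>keys f \<union> keys g. h (lookup e m) * T m)" if "e \<in> {f, g, f + g}" for e
    using that keys_add[of f g] by (intro lext_eq_sum) auto
  then show ?thesis by (simp add: lookup_add h_add distrib_right sum.distrib)
qed

lemma lext_uminus: "lext T (- f) = - lext T f"
  using lext_add[of T f "- f"] by (simp add: minus_unique)

lemma lext_diff: "lext T (f - g) = lext T f - lext T g"
  using lext_add[of T f "- g"] by (simp add: lext_uminus)

lemma lext_sum: "lext T (sum f A) = (\<Sum>a\<in>A. lext T (f a))"
  by (induction A rule: infinite_finite_induct) (auto simp: lext_add)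

lemma lext_monomial_mult:
  assumes "\<And>m. T (a + m) = u * T m"
  shows "lext T (single a c * f) = h c * u * lext T f"
proof (induction f rule: cpoly_induct)
  case (add m e f)
  then show ?case
    by (simp add: distrib_left lext_add mult_single lext_single assms h_mult algebra_simps)
qed simp

lemma lext_cst_mult: "lext T (cst c * f) = h c * lext T f"
  using lext_monomial_mult[of T 0 1 c f] by simp

lemma lext_mult:
  assumes "\<And>a b. T (a + b) = T a * T b"
  shows "lext T (f * g) = lext T f * lext T g"
proof (induction f rule: cpoly_induct)
  case (add m e f)
  then show ?case
    by (simp add: distrib_right lext_add lext_single lext_monomial_mult[where u="T m"] assms)
qed simp

definition mono :: "(nat \<Rightarrow> 'b) \<Rightarrow> (nat \<Rightarrow>\<^sub>0 nat) \<Rightarrow> 'b" where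
  "mono P m = (\<Prod>i\<in>keys m. P i ^ lookup m i)"

definition insertion :: "(nat \<Rightarrow> 'b) \<Rightarrow> cpoly \<Rightarrow> 'b" where
  "insertion P = lext (mono P)"

lemma mono_eq_prod: "finite A \<Longrightarrow> keys m \<subseteq> A \<Longrightarrow> mono P m = (\<Prod>i\<in>A. P i ^ lookup m i)"
  unfolding mono_def by (rule prod.mono_neutral_left) (auto simp: in_keys_iff)

lemma mono_add: "mono P (a + b) = mono P a * mono P b"
  by (simp add: mono_eq_prod[of "keys a \<union> keys b"] keys_plus_nat lookup_add power_add prod.distrib)

lemma insertion_mult: "insertion P (f * g) = insertion P f * insertion P g"
  unfolding insertion_def by (rule lext_mult) (rule mono_add)

lemma insertion_add: "insertion P (f + g) = insertion P f + insertion P g"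
  by (simp add: insertion_def lext_add)

lemma insertion_diff: "insertion P (f - g) = insertion P f - insertion P g"
  by (simp add: insertion_def lext_diff)

lemma insertion_sum: "insertion P (sum f A) = (\<Sum>a\<in>A. insertion P (f a))"
  by (simp add: insertion_def lext_sum)

lemma insertion_var: "insertion P (var i) = P i"
  by (simp add: insertion_def var_def lext_single mono_def h_one)

lemma insertion_cst: "insertion P (cst c) = h c"
  by (simp add: insertion_def lext_single mono_def)

lemma insertion_power: "insertion P (f ^ e) = insertion P f ^ e"
  using insertion_cst[of P 1] h_one by (induction e) (auto simp: insertion_mult)

lemma insertion_prod: "insertion P (prod f A) = (\<Prod>a\<in>A. insertion P (f a))"
  using insertion_cst[of P 1] h_one by (induction A rule: infinite_finite_induct)
      (auto simp: insertion_mult)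

end


section \<open>Powers of the complete intersection\<close>

interpretation cst_ext: coeff_hom cst
  by unfold_locales (auto simp: cst_add cst_mult)

lemma prod_var_power: "(\<Prod>i\<in>A. var i ^ e i) = single (\<Sum>i\<in>A. single i (e i)) 1"
  by (induction A rule: infinite_finite_induct) (auto simp: var_power mult_single)

lemma lookup_sum_single:
  assumes "finite A"
  shows "lookup (\<Sum>i\<in>A. single i (e i)) j = (if j \<in> A then e j else (0 :: 'a::comm_monoid_add))"
proof -
  have "lookup (\<Sum>i\<in>A. single i (e i)) j = (\<Sum>i\<in>A. if i = j then e j else 0)"
    unfolding lookup_sum by (auto simp: lookup_single intro!: sum.cong)
  then show ?thesis using assms by simp
qed

lemma monomial_expansion:
  fixes m :: "nat \<Rightarrow>\<^sub>0 nat"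
  assumes "keys m \<subseteq> {..n}"
  shows "m = (\<Sum>i<n. single i (lookup m i)) + single n (lookup m n)"
proof (rule poly_mapping_eqI)
  fix j
  have "lookup m j = 0" if "j > n"
    using that assms by (metis atMost_iff in_keys_iff not_le subsetD)
  then show "lookup m j = lookup ((\<Sum>i<n. single i (lookup m i)) + single n (lookup m n)) j"
    by (cases j n rule: linorder_cases) (auto simp: lookup_add lookup_sum_single lookup_single)
qed

lemma monomial_expansion':
  assumes "keys m \<subseteq> {..n}"
  shows "(\<Prod>i<n. var i ^ lookup m i) * var n ^ lookup m n = single m 1"
proof -
  have "(\<Prod>i<n. var i ^ lookup m i) * var n ^ lookup m n =
      single ((\<Sum>i<n. single i (lookup m i)) + single n (lookup m n)) 1"
    by (simp add: prod_var_power var_power[of n] mult_single)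
  then show ?thesis by (simp flip: monomial_expansion[OF assms])
qed

definition is_ideal :: "nat \<Rightarrow> cpoly set \<Rightarrow> bool" where
  "is_ideal n A \<longleftrightarrow> A \<subseteq> polys n \<and> 0 \<in> A \<and> (\<forall>f\<in>A. \<forall>g\<in>A. f + g \<in> A) \<and>
     (\<forall>f\<in>A. \<forall>p\<in>polys n. p * f \<in> A)"

locale grid =
  fixes n k :: nat
  assumes k_pos: "k > 0"
begin

section \<open>A degree-preserving linear bijection sending \<open>x_i^k\<close> to
  \<open>Q i\<close>\<close>

definition Q :: "nat \<Rightarrow> cpoly" where
  "Q i = var i ^ k - var n ^ k"

text \<open>The parameter serves both directions: \<open>c = 1\<close> writes \<open>Q i\<close> for
  \<open>x_i^k\<close>, and \<open>c = - 1\<close> is the inverse. Division with remainder is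
  applied to the exponents of \<open>x_0, ..., x_{n-1}\<close> only; that of \<open>x_n\<close> is
  kept.\<close>

definition twist :: "complex \<Rightarrow> (nat \<Rightarrow>\<^sub>0 nat) \<Rightarrow> cpoly" where
  "twist c m = (\<Prod>i<n. (var i ^ k - cst c * var n ^ k) ^ (lookup m i div k)) *
     ((\<Prod>i<n. var i ^ (lookup m i mod k)) * var n ^ lookup m n)"

definition Phi :: "complex \<Rightarrow> cpoly \<Rightarrow> cpoly" where
  "Phi c = cst_ext.lext (twist c)"

lemma Phi_simps: "Phi c (f + g) = Phi c f + Phi c g" "Phi c 0 = 0"
  "Phi c (single m a) = cst a * twist c m" "Phi c (cst a * f) = cst a * Phi c f"
  "Phi c (f - g) = Phi c f - Phi c g" "Phi c (sum h A) = (\<Sum>a\<in>A. Phi c (h a))"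
  unfolding Phi_def by (simp_all add: cst_ext.lext_add cst_ext.lext_single cst_ext.lext_cst_mult
      cst_ext.lext_diff cst_ext.lext_sum)

text \<open>Adding \<open>k\<close> to an exponent raises its quotient by \<open>k\<close> by one
  and keeps the remainder. Together with \<open>Phi_var_n\<close> this makes \<open>Phi c\<close>
  semilinear over the polynomials in \<open>x_0^k, ..., x_{n-1}^k, x_n\<close>.\<close>

lemma Phi_var_k:
  assumes "i < n"
  shows "Phi c (var i ^ k * f) = (var i ^ k - cst c * var n ^ k) * Phi c f"
proof -
  have "twist c (single i k + m) = (var i ^ k - cst c * var n ^ k) * twist c m" for m
  proof -
    have *: "(\<Prod>j<n. u j (lookup (single i k + m) j)) =
        u i (k + lookup m i) * (\<Prod>j\<in>{..<n} - {i}. u j (lookup m j))"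
      "(\<Prod>j<n. u j (lookup m j)) = u i (lookup m i) * (\<Prod>j\<in>{..<n} - {i}. u j (lookup m j))"
      for u :: "nat \<Rightarrow> nat \<Rightarrow> cpoly"
      using assms by (auto simp: prod.remove[of "{..<n}" i] lookup_add lookup_single when_def
          intro!: prod.cong)
    show ?thesis
      unfolding twist_def *[of "\<lambda>j e. (var j ^ k - cst c * var n ^ k) ^ (e div k)"]
        *[of "\<lambda>j e. var j ^ (e mod k)"]
      using assms k_pos by (simp add: lookup_add lookup_single)
  qed
  then show ?thesis
    using cst_ext.lext_monomial_mult[of "twist c" "single i k" _ 1] by
        (simp add: var_power[of i k] Phi_def)
qed

lemma Phi_var_n: "Phi c (var n ^ e * f) = var n ^ e * Phi c f"
proof -
  have "twist c (single n e + m) = var n ^ e * twist c m" for m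
    by (simp add: twist_def lookup_add lookup_single when_def power_add mult_ac)
  then show ?thesis
    using cst_ext.lext_monomial_mult[of "twist c" "single n e" "var n ^ e" 1] by
        (simp add: var_power Phi_def)
qed

lemma Phi_Q:
  assumes "i < n"
  shows "Phi (- c) ((var i ^ k - cst c * var n ^ k) * f) = var i ^ k * Phi (- c) f"
  using assms
  by (simp add: left_diff_distrib distrib_right Phi_simps Phi_var_k mult.assoc Phi_var_n single_uminus)

lemma Phi_inverse:
  assumes "f \<in> polys n"
  shows "Phi (- c) (Phi c f) = f"
  using assms
proof (induction f rule: polys_induct)
  case (add m a f)
  let ?q = "\<lambda>i. var i ^ k - cst c * var n ^ k :: cpoly"
  have power: "Phi (- c) (?q i ^ e * g) = var i ^ (k * e) * Phi (- c) g" if "i < n" for i e g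
    using that by (induction e) (auto simp: Phi_Q mult.assoc power_add)
  have prod: "Phi (- c) ((\<Prod>i\<in>A. ?q i ^ e i) * g) = (\<Prod>i\<in>A. var i ^ (k * e i)) * Phi (- c) g"
    if "finite A" "A \<subseteq> {..<n}" for A e g
    using that by (induction A) (auto simp: power mult.assoc)
  \<comment> \<open>\<open>r\<close> is the monomial left after all \<open>k\<close>-th powers of
    \<open>x_0, ..., x_{n-1}\<close> are removed. Its quotients by \<open>k\<close> vanish, so
    \<open>Phi (- c)\<close> fixes it.\<close>
  define r where "r = (\<Sum>i<n. single i (lookup m i mod k)) + single n (lookup m n)"
  have r_eq: "(\<Prod>i<n. var i ^ (lookup m i mod k)) * var n ^ lookup m n = single r 1"
    by (simp add: prod_var_power var_power[of n] mult_single r_def)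
  have lookup_r: "lookup r j = (if j < n then lookup m j mod k else if j
      = n then lookup m j else 0)" for j
    by (auto simp: r_def lookup_add lookup_sum_single lookup_single when_def)
  have "Phi (- c) (single r 1) = single r 1"
    using k_pos by (simp add: Phi_simps twist_def lookup_r r_eq)
  then have "Phi (- c) (twist c m) = (\<Prod>i<n. var i ^ (k * (lookup m i div k))) * single r 1"
    by (simp add: twist_def prod r_eq)
  also have "\<dots> = (\<Prod>i<n. var i ^ (k * (lookup m i div k)) * var i ^ (lookup m i mod k)) * var n ^
      lookup m n"
    by (simp add: r_eq[symmetric] prod.distrib)
  also have "\<dots> = single m 1"
    using monomial_expansion'[OF add(1)] by (simp flip: power_add)
  finally have "Phi (- c) (twist c m) = single m 1" .
  with add show ?case
    by (simp add: Phi_simps mult_single)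
qed (simp add: Phi_simps)

lemma twist_forms:
  assumes "keys m \<subseteq> {..n}"
  shows "twist c m \<in> forms n (mdeg m)"
proof -
  have q: "var i ^ k - cst c * var n ^ k \<in> forms n k" if "i < n" for i
  proof -
    have "var i ^ k \<in> forms n (k * 1)" "cst (- c) * var n ^ k \<in> forms n (0 + k * 1)"
      using that by (intro forms_power forms_mult forms_cst forms_var; simp)+
    then have "var i ^ k + cst (- c) * var n ^ k \<in> forms n k"
      by (intro forms_add) simp_all
    then show ?thesis by (simp add: single_uminus)
  qed
  have "twist c m \<in> forms n ((\<Sum>i<n. lookup m i div k * k) + ((\<Sum>i<n. lookup m i mod k * 1) + lookup
      m n * 1))"
    unfolding twist_def by (intro forms_mult forms_prod forms_power q forms_var) auto
  moreover have "(\<Sum>i<n. lookup m i div k * k) + ((\<Sum>i<n. lookup m i mod k * 1) + lookup m n * 1)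
      = (\<Sum>i<Suc n. lookup m i)"
    by (simp flip: add.assoc sum.distrib)
  moreover have "\<dots> = mdeg m"
    using assms by (intro mdeg_eq_sum[symmetric]) auto
  ultimately show ?thesis by metis
qed

lemma Phi_polys: "f \<in> polys n \<Longrightarrow> Phi c f \<in> polys n"
  unfolding Phi_def cst_ext.lext_def
  by (intro polys_sum polys_closed(4) polys_cst) (use twist_forms in \<open>auto simp: forms_iff
      polys_iff[of f]\<close>)

lemma Phi_forms: "f \<in> forms n e \<Longrightarrow> Phi c f \<in> forms n e"
  unfolding Phi_def cst_ext.lext_def
proof (intro forms_sum)
  fix m assume "f \<in> forms n e" "m \<in> keys f"
  then have "twist c m \<in> forms n e" using twist_forms[of m c] by (auto simp: polys_iff forms_iff)
  then show "cst (lookup f m) * twist c m \<in> forms n e"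
    using forms_mult[OF forms_cst] by fastforce
qed

abbreviation "Phi1 \<equiv> Phi 1"
abbreviation "Psi \<equiv> Phi (- 1)"

lemma Psi_Phi: "f \<in> polys n \<Longrightarrow> Psi (Phi1 f) = f"
  by (rule Phi_inverse)

lemma Phi_Psi: "f \<in> polys n \<Longrightarrow> Phi1 (Psi f) = f"
  using Phi_inverse[of f "-1"] by simp

lemma Psi_Q: "i < n \<Longrightarrow> Psi (Q i * f) = var i ^ k * Psi f"
  using Phi_Q[of i 1 f] by (simp add: Q_def)

lemma Phi_var: "i < n \<Longrightarrow> Phi1 (var i ^ k * f) = Q i * Phi1 f"
  by (simp add: Phi_var_k Q_def)

lemma Q_forms: "i \<le> n \<Longrightarrow> Q i \<in> forms n k"
proof -
  assume "i \<le> n"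
  then have "var i ^ k \<in> forms n (k * 1)" "cst (- 1) * var n ^ k \<in> forms n (0 + k * 1)"
    by (intro forms_power forms_mult forms_cst forms_var; simp)+
  then have "var i ^ k + cst (- 1) * var n ^ k \<in> forms n k"
    by (intro forms_add) simp_all
  then show ?thesis by (simp add: single_uminus Q_def)
qed

lemma Q_polys: "i \<le> n \<Longrightarrow> Q i \<in> polys n"
  using Q_forms by (simp add: forms_iff)

section \<open>The powers \<open>J r d\<close> as images of monomial ideals\<close>

definition Q_index :: "nat \<Rightarrow> (nat \<Rightarrow>\<^sub>0 nat) \<Rightarrow> nat" where
  "Q_index r m = (\<Sum>i<r. lookup m i div k)"

text \<open>For \<open>r \<le> n\<close> this is the \<open>d\<close>-th power of the monomial ideal
  \<open>(x_0^k, ..., x_{r-1}^k)\<close>: \<open>Q_index r m\<close> is the largest number of these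
  \<open>k\<close>-th powers whose product divides \<open>m\<close>.\<close>

definition K :: "nat \<Rightarrow> nat \<Rightarrow> cpoly set" where
  "K r d = {f \<in> polys n. \<forall>m\<in>keys f. d \<le> Q_index r m}"

text \<open>\<open>J r d\<close> is the \<open>d\<close>-th power of the ideal generated by \<open>Q 0, \<dots>, Q (r - 1)\<close>.\<close>

definition J :: "nat \<Rightarrow> nat \<Rightarrow> cpoly set" where
  "J r d = {f \<in> polys n. Psi f \<in> K r d}"

lemma K_zero: "0 \<in> K r d"
  by (auto simp: K_def polys_closed)

lemma K_add: "f \<in> K r d \<Longrightarrow> g \<in> K r d \<Longrightarrow> f + g \<in> K r d"
  using keys_add[of f g] by (auto simp: K_def polys_closed)

lemma K_sum: "(\<And>a. a \<in> A \<Longrightarrow> f a \<in> K r d) \<Longrightarrow> sum f A \<in> K r d"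
  by (induction A rule: infinite_finite_induct) (auto simp: K_zero K_add)

lemma Q_index_shift:
  assumes "i < r" shows "Q_index r (single i k + m) = Suc (Q_index r m)"
proof -
  have "Q_index r (single i k + m) = (\<Sum>j<r. (if j = i then 1 else 0) + lookup m j div k)"
    unfolding Q_index_def using k_pos
    by (intro sum.cong) (auto simp: lookup_add lookup_single when_def)
  then show ?thesis using assms by (simp add: sum.distrib Q_index_def)
qed

lemma Q_index_shift_ge: "r \<le> i \<Longrightarrow> Q_index r (single i e + m) = Q_index r m"
  unfolding Q_index_def by (intro sum.cong) (auto simp: lookup_add lookup_single when_def)

lemma keys_var_mult: "keys (var i ^ e * f) = (+) (single i e) ` keys f"
proof (intro equalityI subsetI)
  show "q \<in> (+) (single i e) ` keys f" if "q \<in> keys (var i ^ e * f)" for q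
    using that keys_monomial_mult[of q "single i e" 1 f] by (auto simp: var_power)
  show "q \<in> keys (var i ^ e * f)" if "q \<in> (+) (single i e) ` keys f" for q
    using that lookup_monomial_mult[of "single i e" 1 f] by (auto simp: var_power in_keys_iff)
qed

lemma K_var_iff:
  assumes "i \<le> n" "f \<in> polys n"
  shows "i < r \<Longrightarrow> var i ^ k * f \<in> K r (Suc d) \<longleftrightarrow> f \<in> K r d"
    and "r \<le> i \<Longrightarrow> var i ^ k * f \<in> K r d \<longleftrightarrow> f \<in> K r d"
  using assms by (auto simp: K_def keys_var_mult Q_index_shift Q_index_shift_ge polys_closed
      polys_power var_polys)

lemma J_Phi_iff: "f \<in> polys n \<Longrightarrow> Phi1 f \<in> J r d \<longleftrightarrow> f \<in> K r d"
  by (simp add: J_def Psi_Phi Phi_polys)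

text \<open>\<open>Psi\<close> turns multiplication by \<open>Q i\<close> into multiplication by
  \<open>x_i^k\<close>, which raises \<open>Q_index r\<close> by exactly one if \<open>i < r\<close>
  and keeps it otherwise. So the colon ideal of \<open>J r (Suc d)\<close> by \<open>Q i\<close> is
  \<open>J r d\<close> in the first case, and \<open>Q i\<close> is a nonzerodivisor modulo
  \<open>J r d\<close> in the second.\<close>

lemma J_Q_iff:
  assumes "i < n" "f \<in> polys n"
  shows "i < r \<Longrightarrow> Q i * f \<in> J r (Suc d) \<longleftrightarrow> f \<in> J r d"
    and "r \<le> i \<Longrightarrow> Q i * f \<in> J r d \<longleftrightarrow> f \<in> J r d"
  using assms K_var_iff[of i "Psi f"] by (auto simp: J_def Psi_Q Phi_polys polys_closed Q_polys)

lemma J_polys: "J r d \<subseteq> polys n"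
  by (auto simp: J_def)

lemma J_add: "f \<in> J r d \<Longrightarrow> g \<in> J r d \<Longrightarrow> f + g \<in> J r d"
  by (auto simp: J_def Phi_simps K_add polys_closed)

lemma J_zero_mem: "0 \<in> J r d"
  by (auto simp: J_def Phi_simps K_zero polys_closed)

lemma J_degree_0: "J r 0 = polys n"
  by (auto simp: J_def K_def Phi_polys)

lemma J_0: "J 0 (Suc d) = {0}"
proof (intro equalityI subsetI)
  fix f assume f: "f \<in> J 0 (Suc d)"
  then have "keys (Psi f) = {}" by (auto simp: J_def K_def Q_index_def)
  then have "Phi1 (Psi f) = 0" by (simp add: Phi_simps)
  then show "f \<in> {0}" using f Phi_Psi[of f] by (auto simp: J_def)
qed (simp add: J_zero_mem)

lemma J_mono: "J r (Suc d) \<subseteq> J r d"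
  by (auto simp: J_def K_def)

lemma J_mono_vars: "J r d \<subseteq> J (Suc r) d"
  by (fastforce simp: J_def K_def Q_index_def)

text \<open>The monomials are sorted by divisibility by \<open>x_r^k\<close>. A non-divisible one
  gets nothing from \<open>x_r\<close> in its index, so \<open>x_0, ..., x_{r-1}\<close> already
  account for \<open>Suc d\<close>; from the others one factor \<open>x_r^k\<close> is taken
  out.\<close>

lemma K_split:
  assumes "h \<in> K (Suc r) (Suc d)" "r < n"
  shows "\<exists>a\<in>K r (Suc d). \<exists>b\<in>K (Suc r) d. h = a + var r ^ k * b"
proof (intro bexI)
  let ?s = "\<lambda>m. m - single r k"
  have shift: "single r k + ?s m = m" if "k \<le> lookup m r" for m
    using that by (intro poly_mapping_eqI) (auto simp: lookup_add lookup_minus lookup_single when_def)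
  define A where "A = {m \<in> keys h. lookup m r < k}"
  define B where "B = {m \<in> keys h. \<not> lookup m r < k}"
  show "h = (\<Sum>m\<in>A. single m (lookup h m)) + var r ^ k * (\<Sum>m\<in>B. single (?s m) (lookup h m))"
  proof -
    have "h = (\<Sum>m\<in>A \<union> B. single m (lookup h m))"
    proof -
      have "A \<union> B = keys h" by (auto simp: A_def B_def)
      then show ?thesis by (simp add: sum_monomials)
    qed
    also have "\<dots> = (\<Sum>m\<in>A. single m (lookup h m)) + (\<Sum>m\<in>B. single m (lookup h m))"
      by (intro sum.union_disjoint) (auto simp: A_def B_def)
    also have "(\<Sum>m\<in>B. single m (lookup h m)) = var r ^ k * (\<Sum>m\<in>B. single (?s m) (lookup h m))"
      by (auto simp: sum_distrib_left var_power mult_single shift B_def intro!: sum.cong)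
    finally show ?thesis .
  qed
  show "(\<Sum>m\<in>A. single m (lookup h m)) \<in> K r (Suc d)"
  proof (rule K_sum)
    fix m assume "m \<in> A"
    then have "keys m \<subseteq> {..n}" "Suc d \<le> Q_index (Suc r) m" "lookup m r < k"
      using assms by (auto simp: A_def K_def polys_iff)
    then show "single m (lookup h m) \<in> K r (Suc d)"
      by (simp add: K_def Q_index_def polys_single)
  qed
  show "(\<Sum>m\<in>B. single (?s m) (lookup h m)) \<in> K (Suc r) d"
  proof (rule K_sum)
    fix m assume m: "m \<in> B"
    have "Suc d \<le> Q_index (Suc r) (single r k + ?s m)"
      using m assms by (subst shift) (auto simp: B_def K_def)
    moreover have "keys (?s m) \<subseteq> keys m"
      by (auto simp: in_keys_iff lookup_minus)
    ultimately show "single (?s m) (lookup h m) \<in> K (Suc r) d"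
      using m assms by (auto simp: B_def K_def Q_index_shift polys_iff)
  qed
qed

lemma J_split:
  assumes "r < n"
  shows "J (Suc r) (Suc d) = {u + Q r * v | u v. u \<in> J r (Suc d) \<and> v \<in> J (Suc r) d}"
proof (intro equalityI subsetI)
  fix f assume f: "f \<in> J (Suc r) (Suc d)"
  then obtain a b where ab: "a \<in> K r (Suc d)" "b \<in> K (Suc r) d" "Psi f = a + var r ^ k * b"
    using K_split[of "Psi f" r d] assms by (auto simp: J_def)
  have "f = Phi1 a + Q r * Phi1 b"
    using f Phi_Psi[of f] assms by (simp add: ab Phi_simps Phi_var J_def)
  moreover have "a \<in> polys n" "b \<in> polys n" using ab by (auto simp: K_def)
  ultimately show "f \<in> {u + Q r * v | u v. u \<in> J r (Suc d) \<and> v \<in> J (Suc r) d}"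
    using ab J_Phi_iff by blast
next
  fix f assume "f \<in> {u + Q r * v | u v. u \<in> J r (Suc d) \<and> v \<in> J (Suc r) d}"
  then obtain u v where uv: "f = u + Q r * v" "u \<in> J r (Suc d)" "v \<in> J (Suc r) d"
    by blast
  then have "Q r * v \<in> J (Suc r) (Suc d)"
    using assms J_polys by (subst J_Q_iff(1)) auto
  then show "f \<in> J (Suc r) (Suc d)"
    using uv J_mono_vars by (auto intro!: J_add)
qed

text \<open>Closure under multiplication cannot be transported along \<open>Phi1\<close>. It follows
  from \<open>J_split\<close> by induction on \<open>r\<close> and inside it on \<open>d\<close>,
  down to the zero ideal and the whole ring.\<close>

lemma J_ideal:
  assumes "r \<le> n"
  shows "is_ideal n (J r d)"
proof -
  have "p * f \<in> J r d" if "f \<in> J r d" "p \<in> polys n" for f p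
    using assms that(1)
  proof (induction r arbitrary: d f)
    case 0
    then show ?case using that(2) by (cases d) (auto simp: J_degree_0 J_0 polys_closed)
  next
    case (Suc r)
    note hyp = Suc.IH
    from Suc.prems(2) show ?case
    proof (induction d arbitrary: f)
      case 0
      then show ?case using that(2) by (auto simp: J_degree_0 polys_closed)
    next
      case (Suc d)
      from Suc.prems \<open>Suc r \<le> n\<close> obtain u v
        where uv: "f = u + Q r * v" "u \<in> J r (Suc d)" "v \<in> J (Suc r) d"
        by (auto simp: J_split)
      have "p * f = p * u + Q r * (p * v)" by (simp add: uv algebra_simps)
      moreover have "p * u \<in> J r (Suc d)" using uv \<open>Suc r \<le> n\<close> by (intro hyp) auto
      ultimately show ?case
        using Suc.IH[OF uv(3)] \<open>Suc r \<le> n\<close> by (auto simp: J_split)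
    qed
  qed
  then show ?thesis
    by (auto simp: is_ideal_def J_polys[THEN subsetD] J_zero_mem J_add)
qed

lemma Q_power_mult_J:
  assumes "i < r" "r \<le> n" "f \<in> J r d"
  shows "Q i ^ e * f \<in> J r (e + d)"
proof (induction e)
  case (Suc e)
  then have "Q i * (Q i ^ e * f) \<in> J r (Suc (e + d))"
    using assms J_polys by (subst J_Q_iff(1)) auto
  then show ?case by (simp add: mult.assoc)
qed (use assms in simp)

lemma prod_Q_mem_J:
  assumes "r \<le> n" "N \<le> r"
  shows "(\<Prod>i<N. Q i ^ a i) \<in> J r (\<Sum>i<N. a i)"
  using assms(2)
proof (induction N)
  case 0
  then show ?case by (simp add: J_degree_0 polys_closed)
next
  case (Suc N)
  then have "Q N ^ a N * (\<Prod>i<N. Q i ^ a i) \<in> J r (a N + (\<Sum>i<N. a i))"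
    using assms by (intro Q_power_mult_J) auto
  then show ?case by (simp add: mult.commute add.commute)
qed

text \<open>With \<open>prod_Q_mem_J\<close> and \<open>J_ideal\<close> this shows that
  \<open>J r d\<close> is generated by the products of \<open>d\<close> of the forms
  \<open>Q 0, ..., Q (r - 1)\<close>. The ideal \<open>I\<close> stays arbitrary in the induction
  because it gets replaced by a colon ideal.\<close>

lemma J_least:
  assumes "r \<le> n" "is_ideal n I" "\<And>a. (\<Sum>i<r. a i) = d \<Longrightarrow> (\<Prod>i<r. Q i ^ a i) \<in> I"
  shows "J r d \<subseteq> I"
  using assms
proof (induction r arbitrary: d I)
  case 0
  show ?case
  proof (cases "d = 0")
    case True
    with 0(3) have "1 \<in> I" by simp
    with 0(2) show ?thesis using True by (force simp: is_ideal_def J_degree_0)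
  next
    case False
    then show ?thesis using 0(2) by (cases d) (auto simp: J_0 is_ideal_def)
  qed
next
  case (Suc r)
  note hyp = Suc.IH
  from Suc.prems(2,3) show ?case
  proof (induction d arbitrary: I)
    case 0
    from 0(2)[of "\<lambda>_. 0"] have "1 \<in> I" by simp
    with 0(1) show ?case by (force simp: is_ideal_def J_degree_0)
  next
    case (Suc d)
    have "J r (Suc d) \<subseteq> I"
    proof (rule hyp)
      fix a :: "nat \<Rightarrow> nat" assume "(\<Sum>i<r. a i) = Suc d"
      then show "(\<Prod>i<r. Q i ^ a i) \<in> I"
        using Suc.prems(2)[of "a(r := 0)"] by simp
    qed (use Suc.prems \<open>Suc r \<le> n\<close> in auto)
    \<comment> \<open>The inner hypothesis is applied to the colon ideal of \<open>I\<close> by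
      \<open>Q r\<close>; it contains the required products since raising the exponent of
      \<open>Q r\<close> by one leads into \<open>I\<close>.\<close>
    moreover have "J (Suc r) d \<subseteq> {v \<in> polys n. Q r * v \<in> I}"
    proof (rule Suc.IH)
      show "is_ideal n {v \<in> polys n. Q r * v \<in> I}"
        using Suc.prems(1) by (auto simp: is_ideal_def polys_closed distrib_left mult.left_commute)
      fix a :: "nat \<Rightarrow> nat" assume a: "(\<Sum>i<Suc r. a i) = d"
      have "Q r * (\<Prod>i<Suc r. Q i ^ a i) = (\<Prod>i<Suc r. Q i ^ (a(r := Suc (a r))) i)"
        by (simp add: mult_ac)
      also have "\<dots> \<in> I" using a by (intro Suc.prems(2)) simp
      finally show "(\<Prod>i<Suc r. Q i ^ a i) \<in> {v \<in> polys n. Q r * v \<in> I}"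
        using \<open>Suc r \<le> n\<close> by (auto intro!: polys_prod polys_power Q_polys polys_closed)
    qed
    moreover have "r < n" using \<open>Suc r \<le> n\<close> by simp
    ultimately show ?case
      using Suc.prems(1) unfolding J_split[OF \<open>r < n\<close>] is_ideal_def by blast
  qed
qed

end


section \<open>Ideals in the polynomial ring\<close>

lemma ideal_poly_ring_iff: "ideal A (poly_ring n) \<longleftrightarrow> is_ideal n A"
proof
  interpret R: cring "poly_ring n" by (rule cring_poly_ring)
  show "is_ideal n A" if "ideal A (poly_ring n)"
  proof -
    interpret A: ideal A "poly_ring n" by fact
    show ?thesis
      using A.a_subset A.zero_closed A.a_closed A.I_l_closed
      by (auto simp: is_ideal_def poly_ring_def)
  qed
  show "ideal A (poly_ring n)" if A: "is_ideal n A"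
  proof (rule idealI)
    show "ring (poly_ring n)" by (rule R.ring_axioms)
    show "subgroup A (add_monoid (poly_ring n))"
    proof
      fix f assume f: "f \<in> A"
      have "- f \<in> A"
        using A f polys_cst[of "-1" n] by (force simp: is_ideal_def single_uminus)
      moreover have "inv\<^bsub>add_monoid (poly_ring n)\<^esub> f = - f"
        using f A R.minus_equality[of "- f" f]
        by (auto simp: poly_ring_def is_ideal_def polys_closed a_inv_def)
      ultimately show "inv\<^bsub>add_monoid (poly_ring n)\<^esub> f \<in> A" by simp
    qed (use A in \<open>auto simp: is_ideal_def poly_ring_def\<close>)
  qed (use A in \<open>auto simp: is_ideal_def poly_ring_def mult.commute\<close>)
qed

lemma Idl_least: "is_ideal n A \<Longrightarrow> B \<subseteq> A \<Longrightarrow> Idl\<^bsub>poly_ring n\<^esub> B \<subseteq> A"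
  using ring.genideal_minimal[OF cring.axioms(1)[OF cring_poly_ring]] by (metis ideal_poly_ring_iff)

lemma Idl_superset: "B \<subseteq> polys n \<Longrightarrow> B \<subseteq> Idl\<^bsub>poly_ring n\<^esub> B"
  using ring.genideal_self[OF cring.axioms(1)[OF cring_poly_ring]] by (simp add: poly_ring_def)

lemma is_ideal_Idl: "B \<subseteq> polys n \<Longrightarrow> is_ideal n (Idl\<^bsub>poly_ring n\<^esub> B)"
  using ring.genideal_ideal[OF cring.axioms(1)[OF cring_poly_ring]]
  by (simp add: poly_ring_def flip: ideal_poly_ring_iff)

lemma ideal_pow_0: "A [^]\<^bsub>ideals_set (poly_ring n)\<^esub> (0 :: nat) = polys n"
  by (simp add: nat_pow_def ideals_set_def poly_ring_def)

lemma ideal_pow_Suc: "A [^]\<^bsub>ideals_set (poly_ring n)\<^esub> Suc d =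
    ideal_prod (poly_ring n) (A [^]\<^bsub>ideals_set (poly_ring n)\<^esub> d) A"
  by (simp add: nat_pow_def ideals_set_def)

lemma is_ideal_pow:
  assumes "is_ideal n A"
  shows "is_ideal n (A [^]\<^bsub>ideals_set (poly_ring n)\<^esub> (d :: nat))"
proof (induction d)
  case 0
  show ?case unfolding ideal_pow_0 by (auto simp: is_ideal_def polys_closed)
next
  case (Suc d)
  interpret R: cring "poly_ring n" by (rule cring_poly_ring)
  show ?case
    unfolding ideal_pow_Suc
    using R.ideal_prod_is_ideal Suc assms by (simp flip: ideal_poly_ring_iff)
qed

lemma ideal_pow_mult:
  "f \<in> A [^]\<^bsub>ideals_set (poly_ring n)\<^esub> d \<Longrightarrow> g \<in> A \<Longrightarrow>
    f * g \<in> A [^]\<^bsub>ideals_set (poly_ring n)\<^esub> Suc d"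
  unfolding ideal_pow_Suc using ideal_prod.prod[of f _ g A "poly_ring n"] by (simp add: poly_ring_def)

section \<open>Independence of products of one-variable functions\<close>

text \<open>A nonzero polynomial has at most as many roots as its degree. The infinite alternative
  is used for the free parameters of the curves, the finite one for the \<open>k\<close> roots of
  unity, where the exponents are remainders below \<open>k\<close>.\<close>

lemma power_indep:
  fixes c :: "'m \<Rightarrow> complex"
  assumes "finite M" "inj_on e M" "\<And>t. t \<in> D \<Longrightarrow> (\<Sum>m\<in>M. c m * t ^ e m) = 0"
    and "infinite D \<or> (\<forall>m\<in>M. e m < card D)" "m \<in> M"
  shows "c m = 0"
proof -
  define p where "p = (\<Sum>m\<in>M. Polynomial.monom (c m) (e m))"
  have coeff: "coeff p j = (\<Sum>m\<in>M. if e m = j then c m else 0)" for j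
    by (simp add: p_def coeff_sum)
  have roots: "D \<subseteq> {t. poly p t = 0}"
    using assms(3) by (auto simp: p_def poly_sum poly_monom)
  have "p = 0"
  proof (rule ccontr)
    assume p: "p \<noteq> 0"
    then have "finite D" using roots poly_roots_finite[of p] finite_subset by blast
    then have e: "\<forall>m\<in>M. e m < card D" using assms(4) by blast
    have "card D \<le> card {t. poly p t = 0}"
      using p roots by (intro card_mono poly_roots_finite)
    also have "\<dots> \<le> degree p" using p by (rule card_poly_roots_bound)
    finally have "\<forall>m\<in>M. e m \<noteq> degree p" using e by fastforce
    then have "coeff p (degree p) = 0" by (simp add: coeff)
    then show False using p by simp
  qed
  have "coeff p (e m) = (\<Sum>m'\<in>M. if m' = m then c m else 0)"
    unfolding coeff using assms(2,5) by (intro sum.cong) (auto dest: inj_onD)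
  then show ?thesis using assms(1,5) \<open>p = 0\<close> by simp
qed

text \<open>Independence on \<open>D\<close> passes to products of functions of separate variables
  by splitting off the last variable. Coefficients are summed over a fibre of \<open>e\<close>
  because distinct elements of \<open>M\<close> may share their first \<open>n\<close>
  exponents.\<close>

lemma tensor_indep:
  fixes u :: "nat \<Rightarrow> 'p \<Rightarrow> complex" and c :: "'m \<Rightarrow> complex" and e :: "'m \<Rightarrow> nat \<Rightarrow> nat"
  assumes u: "\<And>A c q. finite A \<Longrightarrow> (\<And>p. p \<in> D \<Longrightarrow> (\<Sum>q\<in>A. c q * u q p) = 0) \<Longrightarrow> q \<in> A \<Longrightarrow> c q = 0"
    and "finite M" "m' \<in> M"
    and "\<forall>p. (\<forall>i<n. p i \<in> D) \<longrightarrow> (\<Sum>m\<in>M. c m * (\<Prod>i<n. u (e m i) (p i))) = 0"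
  shows "(\<Sum>m | m \<in> M \<and> (\<forall>i<n. e m i = e m' i). c m) = 0"
  using assms(2-4)
proof (induction n arbitrary: M)
  case 0
  then show ?case by simp
next
  case (Suc n)
  let ?M = "\<lambda>q. {m \<in> M. e m n = q}"
  have "(\<Sum>m\<in>?M (e m' n). c m * (\<Prod>i<n. u (e m i) (p i))) = 0" if p: "\<forall>i<n. p i \<in> D" for p
  proof (rule u[where A="(\<lambda>m. e m n) ` M" and c="\<lambda>q. \<Sum>m\<in>?M q. c m * (\<Prod>i<n. u (e m i) (p i))"])
    fix x assume "x \<in> D"
    then have "\<forall>i<Suc n. (p(n := x)) i \<in> D" using p by (auto simp: less_Suc_eq)
    then have "0 = (\<Sum>m\<in>M. c m * (\<Prod>i<Suc n. u (e m i) ((p(n := x)) i)))"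
      using Suc.prems(3) by metis
    also have "\<dots> = (\<Sum>m\<in>M. c m * (\<Prod>i<n. u (e m i) (p i)) * u (e m n) x)"
      by (simp add: mult.assoc)
    also have "\<dots> = (\<Sum>q\<in>(\<lambda>m. e m n) ` M. \<Sum>m\<in>?M q. c m * (\<Prod>i<n. u (e m i) (p i)) * u (e m n) x)"
      using Suc.prems(1) by (intro sum.group[symmetric]) auto
    also have "\<dots> = (\<Sum>q\<in>(\<lambda>m. e m n) ` M. (\<Sum>m\<in>?M q. c m * (\<Prod>i<n. u (e m i) (p i))) * u q x)"
      by (intro sum.cong) (auto simp: sum_distrib_right)
    finally show "(\<Sum>q\<in>(\<lambda>m. e m n) ` M. (\<Sum>m\<in>?M q. c m * (\<Prod>i<n. u (e m i) (p i))) * u q x) = 0"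
      by simp
  qed (use Suc.prems in auto)
  then have "(\<Sum>m | m \<in> ?M (e m' n) \<and> (\<forall>i<n. e m i = e m' i). c m) = 0"
    using Suc.prems by (intro Suc.IH) auto
  moreover have "{m. m \<in> ?M (e m' n) \<and> (\<forall>i<n. e m i = e m' i)} =
      {m. m \<in> M \<and> (\<forall>i<Suc n. e m i = e m' i)}"
    by (auto simp: less_Suc_eq)
  ultimately show ?case by simp
qed

text \<open>For fixed \<open>z\<close>, the powers of \<open>w\<close> separate the quotients by
  \<open>k\<close>; among indices with the same quotient, the \<open>k\<close> roots of unity
  \<open>z\<close> separate the remainders.\<close>

lemma div_mod_indep:
  fixes c :: "nat \<Rightarrow> complex"
  assumes k: "k > 0" and A: "finite A" "q \<in> A"
    and "\<And>w z. z ^ k = 1 \<Longrightarrow> (\<Sum>q\<in>A. c q * (w ^ (q div k) * z ^ (q mod k))) = 0"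
  shows "c q = 0"
proof (rule power_indep[where D="{z. z ^ k = 1}" and M="{p \<in> A. p div k
    = q div k}" and e="\<lambda>p. p mod k"])
  show "inj_on (\<lambda>p. p mod k) {p \<in> A. p div k = q div k}"
    by (rule inj_onI) (metis (mono_tags, lifting) div_mult_mod_eq mem_Collect_eq)
  show "infinite {z::complex. z ^ k = 1} \<or> (\<forall>p\<in>{p \<in> A. p div k
      = q div k}. p mod k < card {z::complex. z ^ k = 1})"
    using k by (simp add: card_roots_unity_eq)
  show "(\<Sum>p | p \<in> A \<and> p div k = q div k. c p * z ^ (p mod k)) = 0" if z: "z \<in> {z. z ^ k = 1}" for z
  proof (rule power_indep[where D=UNIV and M="(\<lambda>p. p div k) ` A" and e="\<lambda>a. a"
        and c="\<lambda>a. \<Sum>p | p \<in> A \<and> p div k = a. c p * z ^ (p mod k)"])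
    fix w
    have "(\<Sum>a\<in>(\<lambda>p. p div k) ` A. (\<Sum>p | p \<in> A \<and> p div k = a. c p * z ^ (p mod k)) * w ^ a)
      = (\<Sum>a\<in>(\<lambda>p. p div k) ` A. \<Sum>p | p \<in> A \<and> p div k = a. c p * (w ^ (p div k) * z ^ (p mod k)))"
      by (intro sum.cong) (auto simp: sum_distrib_right intro!: sum.cong)
    also have "\<dots> = (\<Sum>p\<in>A. c p * (w ^ (p div k) * z ^ (p mod k)))"
      using A by (intro sum.group) auto
    finally show "(\<Sum>a\<in>(\<lambda>p. p div k) ` A. (\<Sum>p | p \<in> A \<and> p div k = a. c p * z ^ (p mod k)) * w ^ a) = 0"
      using assms(4) z by simp
  qed (use A infinite_UNIV_char_0 in auto)
qed (use A in auto)


section \<open>The ideal of the fat points\<close>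

interpretation ev: coeff_hom "\<lambda>c :: complex. c"
  by unfold_locales auto

interpretation pl: coeff_hom "\<lambda>c :: complex. [:c:]"
  by unfold_locales auto

lemma eval_eq_insertion: "eval P f = ev.insertion P f"
  by (simp add: eval_def ev.insertion_def ev.lext_def ev.mono_def)

lemma poly_pl_insertion: "poly (pl.insertion y f) a = ev.insertion (\<lambda>i. poly (y i) a) f"
  by (simp add: ev.insertion_def ev.lext_def ev.mono_def pl.insertion_def pl.lext_def pl.mono_def
      poly_sum poly_prod)

lemma ev_insertion_forms:
  assumes "f \<in> forms n e" "\<And>i. i \<le> n \<Longrightarrow> y i = t * P i"
  shows "ev.insertion y f = t ^ e * ev.insertion P f"
proof -
  have "ev.mono y m = t ^ e * ev.mono P m" if "m \<in> keys f" for m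
  proof -
    have "keys m \<subseteq> {..n}" "mdeg m = e" using assms(1) that by (auto simp: forms_iff polys_iff)
    then have "ev.mono y m = (\<Prod>i\<in>keys m. t ^ lookup m i * P i ^ lookup m i)"
      unfolding ev.mono_def using assms(2) by (intro prod.cong) (auto simp: power_mult_distrib)
    also have "\<dots> = t ^ e * ev.mono P m"
      by (simp add: prod.distrib ev.mono_def power_sum mdeg_def flip: \<open>mdeg m = e\<close>)
    finally show ?thesis .
  qed
  then show ?thesis
    by (auto simp: ev.insertion_def ev.lext_def sum_distrib_left intro!: sum.cong)
qed

lemma poly_0_eq_0_if_power_dvd:
  assumes "j < d" "[:0, 1:] ^ d dvd [:0, 1:] ^ j * (s :: complex poly)"
  shows "poly s 0 = 0"
proof -
  have "[:0, 1:] ^ Suc j dvd [:0, 1:] ^ j * s"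
    using assms le_imp_power_dvd[of "Suc j" d "[:0, 1:] :: complex poly"] by (auto dest: dvd_trans)
  then have "[:0, 1:] ^ j * [:0, 1:] dvd [:0, 1:] ^ j * s"
    by (simp only: power_Suc2)
  then have "[:0, 1:] dvd s" unfolding dvd_mult_cancel_left by simp
  then show ?thesis using poly_eq_0_iff_dvd[of s 0] by simp
qed

lemma is_ideal_point_ideal: "is_ideal n (point_ideal n P)"
  unfolding point_ideal_def by (rule is_ideal_Idl) (auto simp: forms_iff)

text \<open>The polynomials whose restriction to the curve vanishes at parameter 0 form an ideal, so
  only forms vanishing at \<open>P\<close> need to be checked. For a form, the factor
  \<open>t\<close> between the starting point of the curve and the representative \<open>P\<close>
  is harmless.\<close>

lemma dvd_pl_insertion_point_ideal:
  assumes "f \<in> point_ideal n P" "\<And>i. i \<le> n \<Longrightarrow> poly (y i) 0 = t * P i"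
  shows "[:0, 1:] dvd pl.insertion y f"
proof -
  let ?A = "{f \<in> polys n. [:0, 1:] dvd pl.insertion y f}"
  have "is_ideal n ?A"
    by (auto simp: is_ideal_def polys_closed pl.insertion_add pl.insertion_mult)
      (auto simp: pl.insertion_def)
  moreover have "f \<in> ?A" if "f \<in> forms n e" "eval P f = 0" for f e
  proof -
    have "poly (pl.insertion y f) 0 = 0"
      using ev_insertion_forms[OF that(1) assms(2)] that(2)
      by (simp add: poly_pl_insertion eval_eq_insertion)
    then show ?thesis using that(1) poly_eq_0_iff_dvd[of _ 0] by (auto simp: forms_iff)
  qed
  ultimately have "point_ideal n P \<subseteq> ?A"
    unfolding point_ideal_def by (intro Idl_least) auto
  then show ?thesis using assms(1) by auto
qed

lemma dvd_pl_insertion_pow: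
  assumes "f \<in> point_ideal n P [^]\<^bsub>ideals_set (poly_ring n)\<^esub> d"
    and "\<And>i. i \<le> n \<Longrightarrow> poly (y i) 0 = t * P i"
  shows "[:0, 1:] ^ d dvd pl.insertion y f"
  using assms(1)
proof (induction d arbitrary: f)
  case (Suc d)
  from Suc.prems[unfolded ideal_pow_Suc] show ?case
  proof (induction rule: ideal_prod.induct)
    case (prod a b)
    then have "[:0, 1:] ^ d * [:0, 1:] dvd pl.insertion y a * pl.insertion y b"
      by (intro mult_dvd_mono Suc.IH dvd_pl_insertion_point_ideal[OF _ assms(2)])
    then show ?case by (simp add: poly_ring_def pl.insertion_mult mult.commute)
  qed (auto simp: poly_ring_def pl.insertion_add)
qed simp

section \<open>Testing membership in \<open>J n d\<close> on curves through the points\<close>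

context grid
begin

lemma Q_mem_point_ideal:
  assumes "\<And>i. i \<le> n \<Longrightarrow> P i ^ k = 1" "i < n"
  shows "Q i \<in> point_ideal n P"
proof -
  have "eval P (Q i) = 0"
    using assms
    by (simp add: eval_eq_insertion Q_def ev.insertion_diff ev.insertion_power ev.insertion_var)
  moreover have "Q i \<in> forms n k" using assms by (intro Q_forms) simp
  ultimately show ?thesis
    unfolding point_ideal_def by (intro Idl_superset[THEN subsetD]) (auto simp: forms_iff)
qed

lemma prod_Q_mem_point_ideal_pow:
  assumes "\<And>i. i \<le> n \<Longrightarrow> P i ^ k = 1" "N \<le> n"
  shows "(\<Prod>i<N. Q i ^ a i) \<in> point_ideal n P [^]\<^bsub>ideals_set (poly_ring n)\<^esub> (\<Sum>i<N. a i)"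
  using assms(2)
proof (induction N)
  case (Suc N)
  have "f * Q N ^ e \<in> point_ideal n P [^]\<^bsub>ideals_set (poly_ring n)\<^esub> (j + e)"
    if "f \<in> point_ideal n P [^]\<^bsub>ideals_set (poly_ring n)\<^esub> j" for f e j
    using that
  proof (induction e)
    case (Suc e)
    then have "f * Q N ^ e * Q N \<in> point_ideal n P [^]\<^bsub>ideals_set (poly_ring n)\<^esub> Suc (j + e)"
      using assms(1) \<open>Suc N \<le> n\<close> by (intro ideal_pow_mult Q_mem_point_ideal) auto
    then show ?case by (simp add: mult_ac)
  qed simp
  then show ?case using Suc by simp
next
  case 0
  have "1 \<in> polys n" by (rule polys_closed)
  then show ?case by (simp only: ideal_pow_0 lessThan_0 prod.empty sum.empty)
qed

text \<open>Restricted to the curve, \<open>Q i\<close> is the parameter times a polynomial with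
  value \<open>t ^ k * k * w i\<close> at 0, found by differentiating. Taking these factors out of a
  basis element leaves a value at 0 in which, apart from powers of \<open>t\<close> and
  \<open>k\<close>, the functions of \<open>div_mod_indep\<close> appear.\<close>

lemma insertion_twist:
  fixes w z :: "nat \<Rightarrow> complex" and t :: complex
  assumes z: "\<And>i. i < n \<Longrightarrow> z i ^ k = 1"
    and y: "\<And>i. i < n \<Longrightarrow> y i = smult (t * z i) [:1, w i:]" "y n = [:t:]"
    and m: "keys m \<subseteq> {..n}"
  shows "\<exists>r. pl.insertion y (twist 1 m) = [:0, 1:] ^ Q_index n m * r \<and>
    poly r 0 = t ^ mdeg m * of_nat k ^ Q_index n m *
      (\<Prod>i<n. w i ^ (lookup m i div k) * z i ^ (lookup m i mod k))"
proof -
  have "\<exists>g. y i ^ k - [:t:] ^ k = [:0, 1:] * g \<and> poly g 0 = t ^ k * (of_nat k * w i)" if "i < n" for i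
  proof -
    have "poly ([:1, w i:] ^ k - 1) 0 = 0" by simp
    then obtain g where g: "[:1, w i:] ^ k - 1 = [:0, 1:] * g"
      using poly_eq_0_iff_dvd[of "[:1, w i:] ^ k - 1" 0] by auto
    have "poly (pderiv ([:1, w i:] ^ k - 1)) 0 = of_nat k * w i"
      by (simp add: pderiv_power pderiv_diff pderiv_pCons)
    moreover have "poly (pderiv ([:0, 1:] * g)) 0 = poly g 0"
      by (simp add: pderiv_mult pderiv_pCons)
    ultimately have "poly g 0 = of_nat k * w i" by (simp add: g)
    moreover have "y i ^ k - [:t:] ^ k = smult (t ^ k) ([:1, w i:] ^ k - 1)"
    proof -
      have "y i ^ k = smult (t ^ k) ([:1, w i:] ^ k)"
        unfolding y(1)[OF that] using z[OF that] by (simp only: smult_power power_mult_distrib) simp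
      then show ?thesis by (simp add: smult_diff_right poly_const_pow)
    qed
    ultimately show ?thesis using g by (intro exI[of _ "smult (t ^ k) g"]) simp
  qed
  then obtain g where g: "y i ^ k - [:t:] ^ k = [:0, 1:] * g i" "poly (g i) 0
      = t ^ k * (of_nat k * w i)"
    if "i < n" for i by metis
  let ?r = "(\<Prod>i<n. g i ^ (lookup m i div k)) * ((\<Prod>i<n. y i ^ (lookup m i mod k)) * [:t:] ^ lookup m n)"
  have "pl.insertion y (twist 1 m) = (\<Prod>i<n. ([:0, 1:] * g i) ^ (lookup m i div k)) *
      ((\<Prod>i<n. y i ^ (lookup m i mod k)) * [:t:] ^ lookup m n)"
    by (simp add: twist_def pl.insertion_mult pl.insertion_prod pl.insertion_power pl.insertion_diff
        pl.insertion_var y(2) g(1))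
  also have "\<dots> = [:0, 1:] ^ Q_index n m * ?r"
    by (simp only: power_mult_distrib prod.distrib power_sum Q_index_def mult.assoc)
  finally have 1: "pl.insertion y (twist 1 m) = [:0, 1:] ^ Q_index n m * ?r" .
  have "mdeg m = (\<Sum>i<Suc n. lookup m i)"
    using m by (intro mdeg_eq_sum) auto
  also have "\<dots> = (\<Sum>i<n. k * (lookup m i div k)) + (\<Sum>i<n. lookup m i mod k) + lookup m n"
    by (simp flip: sum.distrib)
  finally have deg: "mdeg m = \<dots>" .
  have "poly ?r 0 = (\<Prod>i<n. (t ^ k * (of_nat k * w i)) ^ (lookup m i div k)) *
      ((\<Prod>i<n. (t * z i) ^ (lookup m i mod k)) * t ^ lookup m n)"
    by (simp add: poly_prod g(2) y(1))
  also have "\<dots> = t ^ mdeg m * of_nat k ^ Q_index n m *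
      (\<Prod>i<n. w i ^ (lookup m i div k) * z i ^ (lookup m i mod k))"
    unfolding deg power_add power_sum Q_index_def power_mult
    by (simp add: power_mult_distrib prod.distrib mult_ac)
  finally show ?thesis using 1 by blast
qed

text \<open>
  Along the curve \<open>x\<^sub>i = t z\<^sub>i (1 + w\<^sub>i s)\<close>, \<open>x\<^sub>n = t\<close> through a point of the grid, \<open>Q i\<close> vanishes to
  first order at \<open>s = 0\<close> with a derivative proportional to \<open>w\<^sub>i\<close>.  Hence the lowest-order coefficient
  of \<open>f\<close> determines the part of \<open>Psi f\<close> of lowest index.
\<close>

lemma mem_J_if_vanishing:
  assumes f: "f \<in> polys n"
    and van: "\<And>w z t y. (\<And>i. i < n \<Longrightarrow> z i ^ k = 1) \<Longrightarrow> t \<noteq> 0 \<Longrightarrow>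
      (\<And>i. i < n \<Longrightarrow> y i = smult (t * z i) [:1, w i:]) \<Longrightarrow> y n = [:t:] \<Longrightarrow>
      [:0, 1:] ^ d dvd pl.insertion y f"
  shows "f \<in> J n d"
proof (rule ccontr)
  assume nJ: "f \<notin> J n d"
  define h where "h = Psi f"
  have h: "h \<in> polys n" using f by (simp add: h_def Phi_polys)
  from nJ f obtain m' where m': "m' \<in> keys h" "Q_index n m' < d"
    by (auto simp: J_def K_def h_def Phi_polys not_le)
  \<comment> \<open>\<open>j\<close> is the lowest index occurring in \<open>Psi f\<close>. Every
    basis element contributes at least the \<open>j\<close>-th power of the parameter, whereas the
    restriction of \<open>f\<close> is divisible by its \<open>d\<close>-th power with
    \<open>d > j\<close>; so the coefficient of order \<open>j\<close> must vanish.\<close>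
  define j where "j = Min (Q_index n ` keys h)"
  have j_le: "j \<le> Q_index n m" if "m \<in> keys h" for m using that by (simp add: j_def)
  have "j < d" using j_le[OF m'(1)] m'(2) by simp
  have "j \<in> Q_index n ` keys h" unfolding j_def using m' by (intro Min_in) auto
  then obtain m0 where m0: "m0 \<in> keys h" "Q_index n m0 = j" by auto
  define M where "M = {m \<in> keys h. Q_index n m = j}"
  have keysM: "keys m \<subseteq> {..n}" if "m \<in> keys h" for m using that h by (auto simp: polys_iff)
  define u where "u q p = fst p ^ (q div k) * snd p ^ (q mod k)" for q and p :: "complex \<times> complex"
  have main: "(\<Sum>m\<in>M. lookup h m * t ^ mdeg m * (\<Prod>i<n. u (lookup m i) (p i))) = 0"
    if t: "t \<noteq> 0" and p: "\<And>i. i < n \<Longrightarrow> p i \<in> UNIV \<times> {z. z ^ k = 1}" for t p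
  proof -
    define y where "y i = (if i < n then smult (t * snd (p i)) [:1, fst (p i):] else [:t:])" for i
    have "\<exists>r. pl.insertion y (twist 1 m) = [:0, 1:] ^ Q_index n m * r \<and>
      poly r 0 = t ^ mdeg m * of_nat k ^ Q_index n m * (\<Prod>i<n. u (lookup m i) (p i))"
          if "m \<in> keys h" for m
      unfolding u_def
    proof (rule insertion_twist)
      show "y i = smult (t * snd (p i)) [:1, fst (p i):]" if "i < n" for i
        using that by (simp add: y_def)
    qed (use p keysM[OF that] in \<open>auto simp: y_def mem_Times_iff\<close>)
    then have "\<forall>m\<in>keys h. \<exists>r. pl.insertion y (twist 1 m) = [:0, 1:] ^ Q_index n m * r \<and>
      poly r 0 = t ^ mdeg m * of_nat k ^ Q_index n m * (\<Prod>i<n. u (lookup m i) (p i))" by blast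
    then obtain r where r: "\<forall>m\<in>keys h. pl.insertion y (twist 1 m) = [:0, 1:] ^ Q_index n m * r m \<and>
      poly (r m) 0 = t ^ mdeg m * of_nat k ^ Q_index n m * (\<Prod>i<n. u (lookup m i) (p i))"
      by (rule bchoice[THEN exE])
    let ?s = "\<Sum>m\<in>keys h. [:lookup h m:] * ([:0, 1:] ^ (Q_index n m - j) * r m)"
    have "f = Phi1 h" using f by (simp add: h_def Phi_Psi)
    then have "pl.insertion y f = (\<Sum>m\<in>keys h. [:lookup h m:] * pl.insertion y (twist 1 m))"
      by (simp add: Phi_def cst_ext.lext_def pl.insertion_sum pl.insertion_mult pl.insertion_cst)
    also have "\<dots> = [:0, 1:] ^ j * ?s"
      unfolding sum_distrib_left
    proof (rule sum.cong)
      fix m assume "m \<in> keys h"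
      then have "[:0, 1:] ^ Q_index n m = [:0, 1:] ^ j * ([:0, 1:] ^ (Q_index n m - j) :: complex poly)"
        using j_le by (simp flip: power_add)
      then show "[:lookup h m:] * pl.insertion y (twist 1 m) =
          [:0, 1:] ^ j * ([:lookup h m:] * ([:0, 1:] ^ (Q_index n m - j) * r m))"
        using bspec[OF r \<open>m \<in> keys h\<close>] by (simp only: mult_ac)
    qed simp
    finally have ins: "pl.insertion y f = [:0, 1:] ^ j * ?s" .
    have "[:0, 1:] ^ d dvd pl.insertion y f"
      using p t by (intro van[of "\<lambda>i. snd (p i)" t y "\<lambda>i. fst (p i)"]) (auto simp: y_def mem_Times_iff)
    then have "poly ?s 0 = 0"
      unfolding ins by (rule poly_0_eq_0_if_power_dvd[OF \<open>j < d\<close>])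
    moreover have "poly ?s 0 = (\<Sum>m\<in>M. lookup h m * (t ^ mdeg m * of_nat k ^ j * (\<Prod>i<n. u (lookup m
        i) (p i))))"
    proof -
      have "poly ?s 0 = (\<Sum>m\<in>keys h. if Q_index n m = j then
          lookup h m * (t ^ mdeg m * of_nat k ^ j * (\<Prod>i<n. u (lookup m i) (p i))) else 0)"
        unfolding poly_sum
      proof (rule sum.cong)
        fix m assume m: "m \<in> keys h"
        then have "0 < Q_index n m - j" if "Q_index n m \<noteq> j" using j_le[OF m] that by simp
        then show "poly ([:lookup h m:] * ([:0, 1:] ^ (Q_index n m - j) * r m)) 0
            = (if Q_index n m = j then
          lookup h m * (t ^ mdeg m * of_nat k ^ j * (\<Prod>i<n. u (lookup m i) (p i))) else 0)"
          using bspec[OF r m] by simp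
      qed simp
      then show ?thesis by (simp add: M_def sum.inter_filter)
    qed
    moreover have "\<dots> = of_nat k ^ j * (\<Sum>m\<in>M. lookup h m * t ^ mdeg m * (\<Prod>i<n. u (lookup m i) (p i)))"
      by (simp add: sum_distrib_left mult_ac)
    ultimately show ?thesis using k_pos by simp
  qed
  \<comment> \<open>The functions of \<open>p\<close> see only the exponents of
    \<open>x_0, ..., x_{n-1}\<close>. Monomials differing in \<open>x_n\<close> are separated
    afterwards by varying \<open>t\<close>, because within \<open>?M0\<close> the total degree
    determines the exponent of \<open>x_n\<close>.\<close>
  let ?M0 = "{m. m \<in> M \<and> (\<forall>i<n. lookup m i = lookup m0 i)}"
  have finM: "finite M" by (simp add: M_def)
  have "(\<Sum>m\<in>?M0. lookup h m * t ^ mdeg m) = 0" if "t \<in> - {0}" for t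
  proof (rule tensor_indep[where u=u and D="UNIV \<times> {z. z ^ k = 1}" and e=lookup and m'=m0
        and c="\<lambda>m. lookup h m * t ^ mdeg m"])
    fix A c q
    assume A: "finite A" "q \<in> A" "\<And>p. p \<in> UNIV \<times> {z. z ^ k = 1} \<Longrightarrow> (\<Sum>q\<in>A. c q * u q p) = 0"
    show "c q = 0"
    proof (rule div_mod_indep[OF k_pos A(1,2)])
      show "(\<Sum>q\<in>A. c q * (w ^ (q div k) * z ^ (q mod k))) = 0" if "z ^ k = 1" for w z
        using A(3)[of "(w, z)"] that by (simp add: u_def)
    qed
  next
    show "\<forall>p. (\<forall>i<n. p i \<in> UNIV \<times> {z. z ^ k = 1}) \<longrightarrow>
        (\<Sum>m\<in>M. lookup h m * t ^ mdeg m * (\<Prod>i<n. u (lookup m i) (p i))) = 0"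
      using main that by blast
  qed (use m0 finM in \<open>auto simp: M_def\<close>)
  moreover have "inj_on mdeg ?M0"
  proof (rule inj_onI)
    fix a b assume ab: "a \<in> ?M0" "b \<in> ?M0" "mdeg a = mdeg b"
    have "mdeg x = (\<Sum>i<n. lookup m0 i) + lookup x n" if "x \<in> ?M0" for x
    proof -
      have "keys x \<subseteq> {..<Suc n}"
        unfolding lessThan_Suc_atMost using that by (intro keysM) (auto simp: M_def)
      then have "mdeg x = (\<Sum>i<Suc n. lookup x i)" by (intro mdeg_eq_sum) auto
      then show ?thesis using that by simp
    qed
    then have n_eq: "lookup a n = lookup b n" using ab by simp
    have expand: "x = (\<Sum>i<n. single i (lookup m0 i)) + single n (lookup x n)" if "x \<in> ?M0" for x
    proof -
      have "x = (\<Sum>i<n. single i (lookup x i)) + single n (lookup x n)"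
        using that by (intro monomial_expansion keysM) (auto simp: M_def)
      moreover have "(\<Sum>i<n. single i (lookup x i)) = (\<Sum>i<n. single i (lookup m0 i))"
        using that by (intro sum.cong) auto
      ultimately show ?thesis by argo
    qed
    show "a = b"
      using expand[OF ab(1)] unfolding n_eq by (rule trans) (rule expand[OF ab(2), symmetric])
  qed
  moreover have "infinite (- {0 :: complex})"
    using infinite_UNIV_char_0 by (simp add: Compl_eq_Diff_UNIV)
  ultimately have "lookup h m0 = 0"
    by (intro power_indep[where M="?M0" and D="- {0}" and e=mdeg and c="lookup h" and m=m0])
      (use finM m0 in \<open>auto simp: M_def\<close>)
  then show False using m0 by (simp add: in_keys_iff)
qed

lemma fat_points_ideal_eq_J:
  assumes xi: "primitive_root_unity k \<xi>" and n: "n \<ge> 1"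
  shows "fat_points_ideal n d (root_points n k \<xi>) = J n d"
proof (intro equalityI)
  have xi_pow: "(\<xi> ^ e) ^ k = 1" for e
    using xi by (metis power_mult mult.commute power_one primitive_root_unity_def)
  have P_k: "P i ^ k = 1" if "P \<in> root_points n k \<xi>" "i \<le> n" for P i
    using that xi_pow by (auto simp: root_points_def root_point_def)
  show "J n d \<subseteq> fat_points_ideal n d (root_points n k \<xi>)"
    unfolding fat_points_ideal_def
  proof (rule INT_greatest)
    fix P assume "P \<in> root_points n k \<xi>"
    then show "J n d \<subseteq> point_ideal n P [^]\<^bsub>ideals_set (poly_ring n)\<^esub> d"
      using prod_Q_mem_point_ideal_pow[of P n] P_k
      by (intro J_least is_ideal_pow is_ideal_point_ideal) auto
  qed
  \<comment> \<open>Primitivity makes the powers \<open>\<xi> ^ j\<close> with \<open>j < k\<close>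
    distinct, so by counting they are all the \<open>k\<close>-th roots of unity.\<close>
  have "inj_on (\<lambda>j. \<xi> ^ j) {..<k}"
  proof (rule linorder_inj_onI)
    fix a b assume "a < b" "b \<in> {..<k}"
    then have "\<xi> ^ (b - a) \<noteq> 1" using xi by (auto simp: primitive_root_unity_def)
    moreover have "\<xi> \<noteq> 0" using xi k_pos by (auto simp: primitive_root_unity_def power_0_left)
    moreover have "\<xi> ^ b = \<xi> ^ a * \<xi> ^ (b - a)" using \<open>a < b\<close> by (simp flip: power_add)
    ultimately show "\<xi> ^ a \<noteq> \<xi> ^ b" by simp
  qed auto
  then have "card ((\<lambda>j. \<xi> ^ j) ` {..<k}) = card {z::complex. z ^ k = 1}"
    using k_pos by (simp add: card_image card_roots_unity_eq)
  moreover have "(\<lambda>j. \<xi> ^ j) ` {..<k} \<subseteq> {z. z ^ k = 1}"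
    using xi_pow by auto
  moreover have "finite {z::complex. z ^ k = 1}"
    using k_pos by (intro finite_roots_unity) auto
  ultimately have roots: "(\<lambda>j. \<xi> ^ j) ` {..<k} = {z. z ^ k = 1}"
    by (intro card_subset_eq)
  show "fat_points_ideal n d (root_points n k \<xi>) \<subseteq> J n d"
  proof
    fix f assume f: "f \<in> fat_points_ideal n d (root_points n k \<xi>)"
    have point: "f \<in> point_ideal n P [^]\<^bsub>ideals_set (poly_ring n)\<^esub> d" if "P \<in> root_points n k \<xi>" for P
      using f that by (auto simp: fat_points_ideal_def)
    show "f \<in> J n d"
    proof (rule mem_J_if_vanishing)
      have "root_point n \<xi> (\<lambda>_. 0) \<in> root_points n k \<xi>" by (auto simp: root_points_def)
      from point[OF this] show "f \<in> polys n"
        using is_ideal_pow[OF is_ideal_point_ideal] unfolding is_ideal_def by blast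
    next
      fix w z y and t :: complex
      assume z: "\<And>i. i < n \<Longrightarrow> z i ^ k = 1" and "t \<noteq> 0"
        and y: "\<And>i. i < n \<Longrightarrow> y i = smult (t * z i) [:1, w i:]" "y n = [:t:]"
      \<comment> \<open>Dividing by \<open>z 0\<close> brings the point
        \<open>[z_0 : ... : z_{n-1} : 1]\<close> to the normal form with first coordinate 1;
        \<open>n \<ge> 1\<close> ensures that coordinate 0 is not coordinate \<open>n\<close>. The
        factor taken out reappears in \<open>t * z 0\<close>.\<close>
      define x where "x i = (if i < n then z i / z 0 else 1 / z 0)" for i
      have z0: "z 0 \<noteq> 0" using z[of 0] n k_pos by (auto simp: power_0_left)
      have "x i ^ k = 1" for i using z[of i] z[of 0] n by (auto simp: x_def power_divide)
      then have "x i \<in> (\<lambda>j. \<xi> ^ j) ` {..<k}" for i unfolding roots by simp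
      then have "\<forall>i. \<exists>j. j < k \<and> \<xi> ^ j = x i" by (metis imageE lessThan_iff)
      then obtain g where g: "\<And>i. g i < k" "\<And>i. \<xi> ^ g i = x i" by metis
      have "g i \<le> k - 1" for i using g(1)[of i] by simp
      then have "root_point n \<xi> g \<in> root_points n k \<xi>" by (auto simp: root_points_def)
      then show "[:0, 1:] ^ d dvd pl.insertion y f"
      proof (intro dvd_pl_insertion_pow[OF point])
        fix i assume "i \<le> n"
        then show "poly (y i) 0 = (t * z 0) * root_point n \<xi> g i"
          using y g(2) z0 n by (cases "i = n"; cases "i = 0") (auto simp: root_point_def x_def)
      qed
    qed
  qed
qed

lemma J_eq_Idl: "J n d = Idl\<^bsub>poly_ring n\<^esub>
    {(\<Prod>i<n. (var i ^ k - var n ^ k) ^ a i) | a :: nat \<Rightarrow> nat. (\<Sum>i<n. a i) = d}"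
    (is "_ = Idl\<^bsub>_\<^esub> ?S")
proof (intro equalityI)
  have "?S \<subseteq> J n d" using prod_Q_mem_J[of n n] by (auto simp: Q_def)
  then show "Idl\<^bsub>poly_ring n\<^esub> ?S \<subseteq> J n d" by (intro Idl_least J_ideal) auto
  have "?S \<subseteq> polys n" using \<open>?S \<subseteq> J n d\<close> J_polys by blast
  then show "J n d \<subseteq> Idl\<^bsub>poly_ring n\<^esub> ?S"
    using Idl_superset[of ?S n] by (intro J_least is_ideal_Idl) (auto simp: Q_def)
qed

end


section \<open>Dimension of quotients\<close>

text \<open>Gaussian elimination: one equation is solved for a pivot unknown \<open>p\<close> and
  substituted into the others, which removes one equation and one unknown.\<close>

lemma underdetermined_system:
  fixes a :: "'b \<Rightarrow> 'c \<Rightarrow> 'f::field"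
  assumes "finite C" "finite B" "card C < card B"
  shows "\<exists>x. (\<exists>b\<in>B. x b \<noteq> 0) \<and> (\<forall>c\<in>C. (\<Sum>b\<in>B. x b * a b c) = 0)"
  using assms
proof (induction C arbitrary: B a rule: finite_induct)
  case empty
  then have "B \<noteq> {}" by auto
  then show ?case by (intro exI[of _ "\<lambda>_. 1"]) auto
next
  case (insert e C)
  show ?case
  proof (cases "\<forall>b\<in>B. a b e = 0")
    case True
    have "\<exists>x. (\<exists>b\<in>B. x b \<noteq> 0) \<and> (\<forall>c\<in>C. (\<Sum>b\<in>B. x b * a b c) = 0)"
      using insert by (intro insert.IH) auto
    then show ?thesis using True by auto
  next
    case False
    then obtain p where p: "p \<in> B" "a p e \<noteq> 0" by blast
    define a' where "a' b c = a b c - a b e / a p e * a p c" for b c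
    have "\<exists>x. (\<exists>b\<in>B - {p}. x b \<noteq> 0) \<and> (\<forall>c\<in>C. (\<Sum>b\<in>B - {p}. x b * a' b c) = 0)"
      using insert p by (intro insert.IH) auto
    then obtain x where x: "\<exists>b\<in>B - {p}. x b \<noteq> 0" "\<forall>c\<in>C. (\<Sum>b\<in>B - {p}. x b * a' b c) = 0"
      by blast
    define y where "y = x(p := - (\<Sum>b\<in>B - {p}. x b * a b e / a p e))"
    have y: "(\<Sum>b\<in>B. y b * a b c) = (\<Sum>b\<in>B - {p}. x b * a' b c)" for c
    proof -
      have "(\<Sum>b\<in>B. y b * a b c) = y p * a p c + (\<Sum>b\<in>B - {p}. y b * a b c)"
        using p insert.prems by (simp add: sum.remove)
      also have "(\<Sum>b\<in>B - {p}. y b * a b c) = (\<Sum>b\<in>B - {p}. x b * a b c)"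
        by (intro sum.cong) (auto simp: y_def)
      finally show ?thesis
        by (simp add: y_def a'_def right_diff_distrib sum_subtractf sum_distrib_right mult.assoc)
    qed
    have "a' b e = 0" for b using p by (simp add: a'_def)
    then have "\<forall>c\<in>insert e C. (\<Sum>b\<in>B. y b * a b c) = 0" using x(2) by (simp add: y)
    moreover have "\<exists>b\<in>B. y b \<noteq> 0" using x(1) by (auto simp: y_def)
    ultimately show ?thesis by blast
  qed
qed

text \<open>If \<open>B'\<close> were smaller, writing the elements of \<open>B\<close> modulo
  \<open>W\<close> in terms of \<open>B'\<close> would produce a nontrivial combination of
  \<open>B\<close> in \<open>W\<close>. So the size of a basis does not depend on the choice hidden
  in \<open>quot_dim\<close>.\<close>

lemma quot_basis_card_le:
  assumes "vector_space s" and W: "module.subspace s W"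
    and B: "quot_basis s V W B" and B': "quot_basis s V W B'"
  shows "card B \<le> card B'"
proof (rule ccontr)
  interpret vector_space s by fact
  assume "\<not> card B \<le> card B'"
  from B B' have fin: "finite B" "finite B'" and BV: "B \<subseteq> V" by (auto simp: quot_basis_def)
  have "\<forall>b\<in>B. \<exists>a. b - (\<Sum>c\<in>B'. s (a c) c) \<in> W"
    using BV B' by (auto simp: quot_basis_def)
  then obtain a where a: "b - (\<Sum>c\<in>B'. s (a b c) c) \<in> W" if "b \<in> B" for b
    using bchoice[of B "\<lambda>b a. b - (\<Sum>c\<in>B'. s (a c) c) \<in> W"] by blast
  obtain x where x: "\<exists>b\<in>B. x b \<noteq> 0" "\<forall>c\<in>B'. (\<Sum>b\<in>B. x b * a b c) = 0"
    using underdetermined_system[of B' B a] fin \<open>\<not> card B \<le> card B'\<close> by auto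
  have "(\<Sum>b\<in>B. s (x b) (\<Sum>c\<in>B'. s (a b c) c)) = (\<Sum>b\<in>B. \<Sum>c\<in>B'. s (x b * a b c) c)"
    by (simp add: scale_sum_right)
  also have "\<dots> = (\<Sum>c\<in>B'. s (\<Sum>b\<in>B. x b * a b c) c)"
    by (subst sum.swap) (simp add: scale_sum_left)
  also have "\<dots> = 0" using x(2) by simp
  finally have "(\<Sum>b\<in>B. s (x b) b) = (\<Sum>b\<in>B. s (x b) (b - (\<Sum>c\<in>B'. s (a b c) c)))"
    by (simp add: scale_right_diff_distrib sum_subtractf)
  also have "\<dots> \<in> W"
    using W a by (intro subspace_sum subspace_scale) auto
  finally show False using B x(1) by (auto simp: quot_basis_def)
qed

lemma quot_dim_eqI:
  assumes "vector_space s" "module.subspace s W" "quot_basis s V W B"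
  shows "quot_dim s V W = card B"
proof -
  have "quot_basis s V W (SOME B. quot_basis s V W B)"
    using assms(3) by (rule someI)
  then show ?thesis
    unfolding quot_dim_def using quot_basis_card_le[OF assms(1,2)] assms(3) by (metis antisym)
qed

section \<open>Graded free modules\<close>

abbreviation "FM \<equiv> free_mod"

definition smul :: "cpoly \<Rightarrow> (nat \<Rightarrow> cpoly) \<Rightarrow> nat \<Rightarrow> cpoly" where
  "smul c v = (\<lambda>a. c * v a)"

definition unit_vec :: "nat \<Rightarrow> nat \<Rightarrow> cpoly" where
  "unit_vec a = (\<lambda>b. if b = a then 1 else 0)"

text \<open>The component of degree \<open>j\<close> of the direct sum of the modules
  \<open>S(- s a)\<close>.\<close>

definition homog :: "nat \<Rightarrow> nat \<Rightarrow> (nat \<Rightarrow> int) \<Rightarrow> int \<Rightarrow> (nat \<Rightarrow> cpoly) set" where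
  "homog n r s j = {v \<in> FM n r. \<forall>a. \<forall>m\<in>keys (v a). int (mdeg m) + s a = j}"

text \<open>Maps are functions on vectors instead of matrices, so that lifts, homotopies and cones
  compose directly; all conditions bind on \<open>FM n p\<close> only.\<close>

definition graded_map :: "nat \<Rightarrow> nat \<Rightarrow> (nat \<Rightarrow> int) \<Rightarrow> nat \<Rightarrow> (nat \<Rightarrow> int) \<Rightarrow>
    ((nat \<Rightarrow> cpoly) \<Rightarrow> nat \<Rightarrow> cpoly) \<Rightarrow> bool" where
  "graded_map n p t r s f \<longleftrightarrow> (\<forall>v\<in>FM n p. f v \<in> FM n r) \<and>
     (\<forall>v\<in>FM n p. \<forall>w\<in>FM n p. f (v + w) = f v + f w) \<and>
     (\<forall>c\<in>polys n. \<forall>v\<in>FM n p. f (smul c v) = smul c (f v)) \<and>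
     (\<forall>j. \<forall>v\<in>homog n p t j. f v \<in> homog n r s j)"

lemma FM_iff: "v \<in> FM n r \<longleftrightarrow> (\<forall>a. v a \<in> polys n) \<and> (\<forall>a\<ge>r. v a = 0)"
  unfolding free_mod_def using polys_closed(1)[of n] by (auto simp: not_less) (metis not_less)

lemma FM_closed:
  "0 \<in> FM n r" "v \<in> FM n r \<Longrightarrow> w \<in> FM n r \<Longrightarrow> v + w \<in> FM n r"
  "v \<in> FM n r \<Longrightarrow> w \<in> FM n r \<Longrightarrow> v - w \<in> FM n r"
  "v \<in> FM n r \<Longrightarrow> - v \<in> FM n r"
  "c \<in> polys n \<Longrightarrow> v \<in> FM n r \<Longrightarrow> smul c v \<in> FM n r"
  by (auto simp: FM_iff smul_def polys_closed polys_diff)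

lemma FM_sum: "(\<And>b. b \<in> B \<Longrightarrow> f b \<in> FM n r) \<Longrightarrow> sum f B \<in> FM n r"
  by (induction B rule: infinite_finite_induct) (auto simp: FM_closed)

lemma FM_unit_vec: "a < r \<Longrightarrow> unit_vec a \<in> FM n r"
  by (auto simp: FM_iff unit_vec_def polys_closed)

lemma homog_FM: "v \<in> homog n r s j \<Longrightarrow> v \<in> FM n r"
  by (simp add: homog_def)

lemma homog_add: "v \<in> homog n r s j \<Longrightarrow> w \<in> homog n r s j \<Longrightarrow> v + w \<in> homog n r s j"
  using keys_add by (fastforce simp: homog_def FM_closed)

lemma homog_diff: "v \<in> homog n r s j \<Longrightarrow> w \<in> homog n r s j \<Longrightarrow> v - w \<in> homog n r s j"
  using keys_diff by (fastforce simp: homog_def FM_closed)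

lemma homog_zero: "0 \<in> homog n r s j"
  by (auto simp: homog_def FM_closed)

lemma homog_sum: "(\<And>b. b \<in> B \<Longrightarrow> f b \<in> homog n r s j) \<Longrightarrow> sum f B \<in> homog n r s j"
  by (induction B rule: infinite_finite_induct) (auto simp: homog_zero homog_add)

lemma homog_smul:
  assumes "c \<in> polys n" "\<And>m. m \<in> keys c \<Longrightarrow> int (mdeg m) = e" "v \<in> homog n r s j"
  shows "smul c v \<in> homog n r s (e + j)"
proof -
  have "int (mdeg m) + s a = e + j" if m: "m \<in> keys (c * v a)" for a m
  proof -
    obtain x y where xy: "m = x + y" "x \<in> keys c" "y \<in> keys (v a)"
      using m keys_mult[of c "v a"] by blast
    then have "int (mdeg y) + s a = j" using assms(3) by (auto simp: homog_def)
    then show ?thesis using assms(2)[OF xy(2)] by (simp add: xy(1) mdeg_add)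
  qed
  then show ?thesis using assms FM_closed(5)[of c n v r] by (auto simp: homog_def smul_def)
qed

lemma homog_unit_vec: "a < r \<Longrightarrow> unit_vec a \<in> homog n r s (s a)"
  by (auto simp: homog_def FM_unit_vec) (auto simp: unit_vec_def split: if_splits)

lemma sum_fun_apply: "(\<Sum>b\<in>B. f b) a = (\<Sum>b\<in>B. f b a)" for f :: "'b \<Rightarrow> 'c \<Rightarrow> 'd::comm_monoid_add"
  by (induction B rule: infinite_finite_induct) auto

lemma FM_expand: "v \<in> FM n p \<Longrightarrow> (\<Sum>b<p. smul (v b) (unit_vec b)) = v"
proof
  fix a assume v: "v \<in> FM n p"
  have "(\<Sum>b<p. smul (v b) (unit_vec b)) a = (\<Sum>b<p. if a = b then v b else 0)"
    unfolding sum_fun_apply by (intro sum.cong) (auto simp: smul_def unit_vec_def)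
  also have "\<dots> = v a" using v by (auto simp: FM_iff)
  finally show "(\<Sum>b<p. smul (v b) (unit_vec b)) a = v a" .
qed

lemma smul_distribs: "smul c (v + w) = smul c v + smul c w" "smul (c + d) v = smul c v + smul d v"
  "smul c (smul d v) = smul (c * d) v" "smul c 0 = 0" "smul 0 v = 0" "smul 1 v = v"
  "smul c (v - w) = smul c v - smul c w" "smul (c - d) v = smul c v - smul d v"
  by (auto simp: smul_def fun_eq_iff algebra_simps)

lemma smul_sum: "smul c (sum f A) = (\<Sum>a\<in>A. smul c (f a))"
  by (rule ext) (simp add: smul_def sum_fun_apply sum_distrib_left)

lemma graded_mapD:
  assumes "graded_map n p t r s f"
  shows "v \<in> FM n p \<Longrightarrow> f v \<in> FM n r"
    and "v \<in> FM n p \<Longrightarrow> w \<in> FM n p \<Longrightarrow> f (v + w) = f v + f w"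
    and "c \<in> polys n \<Longrightarrow> v \<in> FM n p \<Longrightarrow> f (smul c v) = smul c (f v)"
    and "v \<in> homog n p t j \<Longrightarrow> f v \<in> homog n r s j"
  using assms by (auto simp: graded_map_def)

lemma graded_map_zero: "graded_map n p t r s f \<Longrightarrow> f 0 = 0"
  using graded_mapD(2)[of n p t r s f 0 0] by (simp add: FM_closed)

lemma graded_map_diff:
  assumes "graded_map n p t r s f" "v \<in> FM n p" "w \<in> FM n p"
  shows "f (v - w) = f v - f w"
  using graded_mapD(2)[OF assms(1) FM_closed(3)[OF assms(2,3)] assms(3)] by simp

lemma graded_map_sum:
  assumes "graded_map n p t r s f" "\<And>b. b \<in> B \<Longrightarrow> v b \<in> FM n p"
  shows "f (sum v B) = (\<Sum>b\<in>B. f (v b))"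
  using assms(2)
  by (induction B rule: infinite_finite_induct)
    (auto simp: graded_map_zero[OF assms(1)] graded_mapD(2)[OF assms(1)] FM_sum)

lemma graded_map_expand:
  assumes "graded_map n p t r s f" "v \<in> FM n p"
  shows "f v = (\<Sum>b<p. smul (v b) (f (unit_vec b)))"
proof -
  have v: "v b \<in> polys n" for b using assms(2) by (simp add: FM_iff)
  have "f v = f (\<Sum>b<p. smul (v b) (unit_vec b))" by (simp add: FM_expand[OF assms(2)])
  also have "\<dots> = (\<Sum>b<p. f (smul (v b) (unit_vec b)))"
    by (intro graded_map_sum[OF assms(1)] FM_closed FM_unit_vec v) simp
  also have "\<dots> = (\<Sum>b<p. smul (v b) (f (unit_vec b)))"
    by (intro sum.cong refl graded_mapD(3)[OF assms(1)] FM_unit_vec v) simp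
  finally show ?thesis .
qed

lemma graded_map_comp: "graded_map n p t r s f \<Longrightarrow> graded_map n q u p t g
    \<Longrightarrow> graded_map n q u r s (\<lambda>v. f (g v))"
  by (simp add: graded_map_def)

lemma graded_map_id: "graded_map n p t p t (\<lambda>v. v)"
  by (simp add: graded_map_def)

lemma graded_map_sub: "graded_map n p t r s f \<Longrightarrow> graded_map n p t r s g
    \<Longrightarrow> graded_map n p t r s (\<lambda>v. f v - g v)"
  by (auto simp: graded_map_def FM_closed homog_diff smul_distribs algebra_simps)

section \<open>Homogeneous components and homogeneous lifts\<close>

definition hom_part :: "int \<Rightarrow> cpoly \<Rightarrow> cpoly" where
  "hom_part i f = Poly_Mapping.mapp (\<lambda>m c. if int (mdeg m) = i then c else 0) f"

lemma lookup_hom_part: "lookup (hom_part i f) m = (if int (mdeg m) = i then lookup f m else 0)"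
  by (auto simp: hom_part_def lookup_mapp when_def in_keys_iff)

lemma hom_part_add: "hom_part i (f + g) = hom_part i f + hom_part i g"
  by (rule poly_mapping_eqI) (simp add: lookup_hom_part lookup_add)

lemma hom_part_zero: "hom_part i 0 = 0"
  by (rule poly_mapping_eqI) (simp add: lookup_hom_part)

lemma hom_part_sum: "hom_part i (sum f A) = (\<Sum>a\<in>A. hom_part i (f a))"
  by (induction A rule: infinite_finite_induct) (auto simp: hom_part_zero hom_part_add)

lemma hom_part_homogeneous: "(\<And>m. m \<in> keys f \<Longrightarrow> int (mdeg m) = e) \<Longrightarrow> hom_part i f = (if i
    = e then f else 0)"
  by (rule poly_mapping_eqI) (force simp: lookup_hom_part in_keys_iff)

lemma hom_part_mult:
  assumes "\<And>m. m \<in> keys g \<Longrightarrow> int (mdeg m) = e"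
  shows "hom_part i (f * g) = hom_part (i - e) f * g"
proof (induction f rule: cpoly_induct)
  case (add m c f)
  have "hom_part i (single m c * g) = (if i = int (mdeg m) + e then single m c * g else 0)"
    using assms by (intro hom_part_homogeneous) (auto simp: mdeg_add dest!: keys_monomial_mult)
  moreover have "hom_part (i - e) (single m c) = (if i - e = int (mdeg m) then single m c else 0)"
    by (intro hom_part_homogeneous) (auto split: if_splits)
  ultimately show ?case using add by (simp add: distrib_right hom_part_add)
qed (simp add: hom_part_zero)

lemma hom_part_polys: "f \<in> polys n \<Longrightarrow> hom_part i f \<in> polys n"
  by (auto simp: polys_iff in_keys_iff[of _ "hom_part i f"] in_keys_iff[of _ f] lookup_hom_part
      split: if_splits)

definition vec_part :: "(nat \<Rightarrow> int) \<Rightarrow> int \<Rightarrow> (nat \<Rightarrow> cpoly) \<Rightarrow> nat \<Rightarrow> cpoly" where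
  "vec_part s j v = (\<lambda>a. hom_part (j - s a) (v a))"

lemma vec_part_homog: "v \<in> FM n r \<Longrightarrow> vec_part s j v \<in> homog n r s j"
  by (auto simp: homog_def FM_iff vec_part_def hom_part_polys hom_part_zero in_keys_iff
      lookup_hom_part split: if_splits)

lemma vec_part_eq: "v \<in> homog n r s j \<Longrightarrow> vec_part s j v = v"
proof
  fix a assume "v \<in> homog n r s j"
  then have "hom_part (j - s a) (v a) = (if j - s a = j - s a then v a else 0)"
    by (intro hom_part_homogeneous) (force simp: homog_def)
  then show "vec_part s j v a = v a" by (simp add: vec_part_def)
qed

lemma vec_part_diff: "vec_part s j (v - w) = vec_part s j v - vec_part s j w"
proof -
  have "vec_part s j (v - w + w) = vec_part s j (v - w) + vec_part s j w"
    by (rule ext) (simp add: vec_part_def flip: hom_part_add)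
  then show ?thesis by simp
qed

text \<open>Each matrix entry of \<open>f\<close> is homogeneous of degree \<open>t b - s a\<close>,
  so taking components commutes with \<open>f\<close>. Hence a preimage of a homogeneous vector can
  be chosen homogeneous.\<close>

lemma graded_map_vec_part:
  assumes f: "graded_map n p t r s f" and v: "v \<in> FM n p"
  shows "f (vec_part t j v) = vec_part s j (f v)"
proof
  fix a
  have deg: "int (mdeg m) = t b - s a" if "b < p" "m \<in> keys (f (unit_vec b) a)" for b m
  proof -
    have "f (unit_vec b) \<in> homog n r s (t b)" using that graded_mapD(4)[OF f homog_unit_vec] by blast
    then show ?thesis using that by (force simp: homog_def)
  qed
  have "vec_part s j (f v) a = (\<Sum>b<p. hom_part (j - s a) (v b * f (unit_vec b) a))"
    by (simp add: graded_map_expand[OF f v] vec_part_def sum_fun_apply smul_def hom_part_sum)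
  also have "\<dots> = (\<Sum>b<p. hom_part (j - s a - (t b - s a)) (v b) * f (unit_vec b) a)"
    by (intro sum.cong refl hom_part_mult deg) auto
  also have "\<dots> = f (vec_part t j v) a"
    using homog_FM[OF vec_part_homog[OF v]] by
        (simp add: graded_map_expand[OF f] sum_fun_apply smul_def vec_part_def)
  finally show "f (vec_part t j v) a = vec_part s j (f v) a" by simp
qed

lemma graded_map_of_basis:
  assumes w: "\<And>b. b < p \<Longrightarrow> w b \<in> homog n r s (t b)"
  shows "graded_map n p t r s (\<lambda>v. \<Sum>b<p. smul (v b) (w b))"
  unfolding graded_map_def
proof (intro conjI ballI allI)
  fix v assume "v \<in> FM n p"
  then show "(\<Sum>b<p. smul (v b) (w b)) \<in> FM n r"
    using homog_FM[OF w] by (intro FM_sum FM_closed) (auto simp: FM_iff)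
next
  fix j v assume v: "v \<in> homog n p t j"
  show "(\<Sum>b<p. smul (v b) (w b)) \<in> homog n r s j"
  proof (rule homog_sum)
    fix b assume "b \<in> {..<p}"
    then have "smul (v b) (w b) \<in> homog n r s ((j - t b) + t b)"
      using v by (intro homog_smul w) (force simp: homog_def FM_iff)+
    then show "smul (v b) (w b) \<in> homog n r s j" by simp
  qed
qed (auto simp: smul_distribs sum.distrib smul_sum, simp add: smul_def mult.assoc)

text \<open>Projectivity of graded free modules: the images of the basis vectors are lifted one by
  one, and each lift is cut down to its component of degree \<open>t b\<close>.\<close>

lemma graded_free_projective:
  assumes f: "graded_map n p t r s f" and D: "graded_map n q u r s D"
    and im: "\<And>v. v \<in> FM n p \<Longrightarrow> f v \<in> D ` FM n q"
  shows "\<exists>g. graded_map n p t q u g \<and> (\<forall>v\<in>FM n p. D (g v) = f v)"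
proof -
  have "\<forall>b\<in>{..<p}. \<exists>x. x \<in> homog n q u (t b) \<and> D x = f (unit_vec b)"
  proof
    fix b assume "b \<in> {..<p}"
    then have b: "unit_vec b \<in> FM n p" "unit_vec b \<in> homog n p t (t b)" by
        (auto intro: FM_unit_vec homog_unit_vec)
    then obtain x where x: "x \<in> FM n q" "D x = f (unit_vec b)" using im by force
    have "D (vec_part u (t b) x) = f (unit_vec b)"
      using graded_map_vec_part[OF D x(1)] x(2) vec_part_eq[OF graded_mapD(4)[OF f b(2)]] by simp
    then show "\<exists>x. x \<in> homog n q u (t b) \<and> D x = f (unit_vec b)" using vec_part_homog[OF x(1)] by blast
  qed
  then obtain w where w: "\<forall>b\<in>{..<p}. w b \<in> homog n q u (t b) \<and> D (w b) = f (unit_vec b)"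
    by (rule bchoice[THEN exE])
  have g: "graded_map n p t q u (\<lambda>v. \<Sum>b<p. smul (v b) (w b))" using w
      by (intro graded_map_of_basis) auto
  have "D (\<Sum>b<p. smul (v b) (w b)) = f v" if v: "v \<in> FM n p" for v
  proof -
    have vb: "v b \<in> polys n" for b using v by (simp add: FM_iff)
    have wb: "w b \<in> FM n q" if "b < p" for b using w that homog_FM by blast
    have "D (\<Sum>b<p. smul (v b) (w b)) = (\<Sum>b<p. D (smul (v b) (w b)))"
      by (intro graded_map_sum[OF D] FM_closed vb wb) auto
    also have "\<dots> = (\<Sum>b<p. smul (v b) (f (unit_vec b)))"
      using w by (intro sum.cong) (auto simp: graded_mapD(3)[OF D vb wb])
    finally show ?thesis by (simp add: graded_map_expand[OF f v])
  qed
  with g show ?thesis by blast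
qed

section \<open>Resolutions\<close>

text \<open>
  \<open>D i\<close> goes from the free module of rank \<open>r (Suc i)\<close> to that of rank \<open>r i\<close>; nothing is required at
  index \<open>0\<close>, so the complex resolves the cokernel of \<open>D 0\<close>.
\<close>

definition resolution :: "nat \<Rightarrow> (nat \<Rightarrow> nat) \<Rightarrow> (nat \<Rightarrow> nat \<Rightarrow> int) \<Rightarrow>
    (nat \<Rightarrow> (nat \<Rightarrow> cpoly) \<Rightarrow> nat \<Rightarrow> cpoly) \<Rightarrow> bool" where
  "resolution n r s D \<longleftrightarrow> (\<forall>i. graded_map n (r (Suc i)) (s (Suc i)) (r i) (s i) (D i)) \<and>
     (\<forall>i. {v \<in> FM n (r (Suc i)). D i v = 0} = D (Suc i) ` FM n (r (Suc (Suc i))))"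

lemma resolutionD:
  assumes "resolution n r s D"
  shows "graded_map n (r (Suc i)) (s (Suc i)) (r i) (s i) (D i)"
    and "v \<in> FM n (r (Suc (Suc i))) \<Longrightarrow> D i (D (Suc i) v) = 0"
    and "v \<in> FM n (r (Suc i)) \<Longrightarrow> D i v = 0 \<Longrightarrow> v \<in> D (Suc i) ` FM n (r (Suc (Suc i)))"
  using assms unfolding resolution_def by blast+

lemma chain_map_exists:
  assumes F: "resolution n r s D" and G: "resolution n r' s' D'"
    and f0: "graded_map n (r 0) (s 0) (r' 0) (s' 0) f0"
    and im: "\<And>v. v \<in> FM n (r 1) \<Longrightarrow> f0 (D 0 v) \<in> D' 0 ` FM n (r' 1)"
  shows "\<exists>f. f 0 = f0 \<and> (\<forall>i. graded_map n (r i) (s i) (r' i) (s' i) (f i)) \<and>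
    (\<forall>i. \<forall>v\<in>FM n (r (Suc i)). D' i (f (Suc i) v) = f i (D i v))"
proof -
  \<comment> \<open>The invariant of the recursion: the map built last carries the image of
    \<open>D i\<close> into that of \<open>D' i\<close>. For \<open>i > 0\<close> exactness provides
    it; at index 0, where no exactness is available, it is an assumption.\<close>
  let ?P = "\<lambda>i g. graded_map n (r i) (s i) (r' i) (s' i) g \<and> (i = 0 \<longrightarrow> g = f0) \<and>
    (\<forall>v\<in>FM n (r (Suc i)). g (D i v) \<in> D' i ` FM n (r' (Suc i)))"
  let ?Q = "\<lambda>i g g'. \<forall>v\<in>FM n (r (Suc i)). D' i (g' v) = g (D i v)"
  have "\<exists>f. \<forall>i. ?P i (f i) \<and> ?Q i (f i) (f (Suc i))"
  proof (rule dependent_nat_choice)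
    show "\<exists>g. ?P 0 g" using f0 im by auto
    fix i g assume P: "?P i g"
    have "graded_map n (r (Suc i)) (s (Suc i)) (r' i) (s' i) (\<lambda>v. g (D i v))"
      using P resolutionD(1)[OF F] by (blast intro: graded_map_comp)
    from graded_free_projective[OF this resolutionD(1)[OF G]] P obtain g'
      where g': "graded_map n (r (Suc i)) (s (Suc i)) (r' (Suc i)) (s' (Suc i)) g'" "?Q i g g'"
      by blast
    have "g' (D (Suc i) v) \<in> D' (Suc i) ` FM n (r' (Suc (Suc i)))"
      if v: "v \<in> FM n (r (Suc (Suc i)))" for v
    proof (rule resolutionD(3)[OF G])
      have Dv: "D (Suc i) v \<in> FM n (r (Suc i))" using v resolutionD(1)[OF F]
          by (rule graded_mapD(1)[rotated])
      then show "g' (D (Suc i) v) \<in> FM n (r' (Suc i))" using g'(1) by (rule graded_mapD(1)[rotated])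
      show "D' i (g' (D (Suc i) v)) = 0"
        using g'(2) Dv resolutionD(2)[OF F v] P graded_map_zero by auto
    qed
    with g' show "\<exists>g'. ?P (Suc i) g' \<and> ?Q i g g'" by blast
  qed
  then show ?thesis by metis
qed

text \<open>\<open>h\<close> induces zero on the cokernel of \<open>D 0\<close>, so
  \<open>h 0\<close> factors through \<open>D 0\<close>; from there on the error
  \<open>h - \<sigma> D\<close> is a cycle and is lifted by exactness.\<close>

lemma homotopy_exists:
  assumes F: "resolution n r s D" and h: "\<And>i. graded_map n (r i) (s i) (r i) (s i) (h i)"
    and comm: "\<And>i v. v \<in> FM n (r (Suc i)) \<Longrightarrow> D i (h (Suc i) v) = h i (D i v)"
    and im: "\<And>v. v \<in> FM n (r 0) \<Longrightarrow> h 0 v \<in> D 0 ` FM n (r 1)"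
  shows "\<exists>\<sigma>. (\<forall>i. graded_map n (r i) (s i) (r (Suc i)) (s (Suc i)) (\<sigma> i)) \<and>
    (\<forall>i. \<forall>v\<in>FM n (r (Suc i)). D (Suc i) (\<sigma> (Suc i) v) = h (Suc i) v - \<sigma> i (D i v))"
proof -
  let ?P = "\<lambda>i \<sigma>. graded_map n (r i) (s i) (r (Suc i)) (s (Suc i)) \<sigma> \<and>
    (\<forall>v\<in>FM n (r (Suc i)). h (Suc i) v - \<sigma> (D i v) \<in> D (Suc i) ` FM n (r (Suc (Suc i))))"
  let ?Q = "\<lambda>i \<sigma> \<sigma>'. \<forall>v\<in>FM n (r (Suc i)). D (Suc i) (\<sigma>' v) = h (Suc i) v - \<sigma> (D i v)"
  note D = resolutionD(1)[OF F]
  have "\<exists>\<sigma>. \<forall>i. ?P i (\<sigma> i) \<and> ?Q i (\<sigma> i) (\<sigma> (Suc i))"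
  proof (rule dependent_nat_choice)
    obtain \<sigma> where \<sigma>: "graded_map n (r 0) (s 0) (r 1) (s 1) \<sigma>" "\<forall>v\<in>FM n (r 0). D 0 (\<sigma> v) = h 0 v"
      using graded_free_projective[OF h D[of 0]] im unfolding One_nat_def by blast
    have "h 1 v - \<sigma> (D 0 v) \<in> D 1 ` FM n (r 2)" if v: "v \<in> FM n (r 1)" for v
    proof -
      have 1: "h 1 v \<in> FM n (r 1)" "\<sigma> (D 0 v) \<in> FM n (r 1)" "D 0 v \<in> FM n (r 0)"
        using v graded_mapD(1)[OF D[of 0]] graded_mapD(1)[OF h[of 1]] graded_mapD(1)[OF \<sigma>(1)]
            by simp_all
      then have "D 0 (h 1 v - \<sigma> (D 0 v)) = 0"
        using graded_map_diff[OF D[of 0], of "h 1 v" "\<sigma> (D 0 v)"] comm[of v 0] v \<sigma>(2) by simp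
      with resolutionD(3)[OF F, of _ 0] FM_closed(3)[OF 1(1,2)] show ?thesis by
          (simp add: numeral_2_eq_2)
    qed
    with \<sigma>(1) show "\<exists>\<sigma>. ?P 0 \<sigma>" unfolding numeral_2_eq_2 One_nat_def by blast
    fix i \<sigma> assume P: "?P i \<sigma>"
    have "graded_map n (r (Suc i)) (s (Suc i)) (r (Suc i)) (s (Suc i)) (\<lambda>v. h (Suc i) v - \<sigma> (D i v))"
      using P by (intro graded_map_sub h graded_map_comp[OF _ D]) simp
    from graded_free_projective[OF this D[of "Suc i"]] P obtain \<sigma>'
      where \<sigma>': "graded_map n (r (Suc i)) (s (Suc i)) (r (Suc (Suc i))) (s (Suc (Suc i))) \<sigma>'" "?Q
          i \<sigma> \<sigma>'"
      by blast
    have "h (Suc (Suc i)) v - \<sigma>' (D (Suc i) v) \<in> D (Suc (Suc i)) ` FM n (r (Suc (Suc (Suc i))))"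
      if v: "v \<in> FM n (r (Suc (Suc i)))" for v
    proof (rule resolutionD(3)[OF F])
      have Dv: "D (Suc i) v \<in> FM n (r (Suc i))" using v D by (rule graded_mapD(1)[rotated])
      have 1: "h (Suc (Suc i)) v \<in> FM n (r (Suc (Suc i)))" "\<sigma>' (D (Suc i) v) \<in> FM n (r (Suc (Suc i)))"
        using graded_mapD(1)[OF h v] graded_mapD(1)[OF \<sigma>'(1) Dv] by simp_all
      then show "h (Suc (Suc i)) v - \<sigma>' (D (Suc i) v) \<in> FM n (r (Suc (Suc i)))"
        by (rule FM_closed)
      have "\<sigma> (D i (D (Suc i) v)) = 0"
        using resolutionD(2)[OF F v] P graded_map_zero by auto
      then show "D (Suc i) (h (Suc (Suc i)) v - \<sigma>' (D (Suc i) v)) = 0"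
        using graded_map_diff[OF D 1] comm[OF v] \<sigma>'(2) Dv by simp
    qed
    with \<sigma>' show "\<exists>\<sigma>'. ?P (Suc i) \<sigma>' \<and> ?Q i \<sigma> \<sigma>'" by blast
  qed
  then show ?thesis by metis
qed


section \<open>Tor from an arbitrary resolution\<close>

text \<open>\<open>\<gamma>\<close> is an isomorphism from the functions supported on
  \<open>A\<close> onto \<open>Z\<close> modulo \<open>Bd\<close>: \<open>\<phi>\<close> gives
  surjectivity, and \<open>inj\<close> injectivity. The images \<open>c b\<close> of the unit
  vectors then represent a basis.\<close>

lemma quot_dim_eq_card:
  fixes \<gamma> \<phi> :: "(nat \<Rightarrow> complex) \<Rightarrow> nat \<Rightarrow> complex"
  assumes A: "finite A"
    and \<gamma>: "\<And>w. (\<And>a. a \<notin> A \<Longrightarrow> w a = 0) \<Longrightarrow> \<gamma> w \<in> Z"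
    and lin: "\<And>w. (\<And>a. a \<notin> A \<Longrightarrow> w a = 0) \<Longrightarrow> \<gamma> w = (\<lambda>x. \<Sum>b\<in>A. w b * c b x)"
    and \<phi>: "\<And>v. v \<in> Z \<Longrightarrow> (\<forall>a. a \<notin> A \<longrightarrow> \<phi> v a = 0) \<and> v - \<gamma> (\<phi> v) \<in> Bd"
    and inj: "\<And>w. (\<And>a. a \<notin> A \<Longrightarrow> w a = 0) \<Longrightarrow> \<gamma> w \<in> Bd \<Longrightarrow> w = 0"
    and Bd: "0 \<in> Bd" "\<And>v w. v \<in> Bd \<Longrightarrow> w \<in> Bd \<Longrightarrow> v + w \<in> Bd"
      "\<And>z v. v \<in> Bd \<Longrightarrow> (\<lambda>a. z * v a) \<in> Bd"
  shows "quot_dim (\<lambda>c v a. c * v a) Z Bd = card A"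
proof -
  let ?s = "\<lambda>(c::complex) v (a::nat). c * v a"
  have vs: "vector_space ?s"
    by unfold_locales (auto simp: fun_eq_iff algebra_simps)
  interpret vector_space ?s by (rule vs)
  have sub: "subspace Bd" using Bd by (auto simp: subspace_def)
  have c_eq: "\<gamma> (\<lambda>a. if a = b then z else 0) = (\<lambda>x. z * c b x)" if "b \<in> A" for b z
    using that A by (subst lin) (auto simp: fun_eq_iff if_distrib if_distribR cong: if_cong)
  \<comment> \<open>A basis is a set here, so different indices must give different vectors; a
    coincidence would put the difference of two unit vectors into the kernel of
    \<open>\<gamma>\<close>.\<close>
  have inj_c: "inj_on c A"
  proof (rule inj_onI, rule ccontr)
    fix a b assume ab: "a \<in> A" "b \<in> A" "c a = c b" "a \<noteq> b"
    define w :: "nat \<Rightarrow> complex" where "w x = (if x = a then 1 else if x = b then - 1 else 0)" for x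
    have "\<gamma> w = (\<lambda>x. \<Sum>y\<in>A. w y * c y x)" using ab by (intro lin) (auto simp: w_def)
    also have "\<dots> = 0"
    proof
      fix x
      have "(\<Sum>y\<in>A. w y * c y x) = (\<Sum>y\<in>A. (if y = a then c a x else 0) - (if y = b then c b x else 0))"
        using ab by (intro sum.cong) (auto simp: w_def)
      also have "\<dots> = 0" using ab A by (simp add: sum_subtractf)
      finally show "(\<Sum>y\<in>A. w y * c y x) = 0 x" by simp
    qed
    finally have "w = 0" using ab Bd(1) by (intro inj) (auto simp: w_def)
    then have "w a = 0" by simp
    then show False by (simp add: w_def)
  qed
  have comb: "(\<Sum>b\<in>c ` A. ?s (x b) b) = \<gamma> (\<lambda>a. if a \<in> A then x (c a) else 0)" for x
  proof -
    have "\<gamma> (\<lambda>a. if a \<in> A then x (c a) else 0) = (\<lambda>y. \<Sum>b\<in>A. x (c b) * c b y)"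
      by (subst lin) auto
    then show ?thesis
      by (auto simp: sum.reindex[OF inj_c] sum_fun_apply fun_eq_iff)
  qed
  have "quot_basis ?s Z Bd (c ` A)"
    unfolding quot_basis_def
  proof (intro conjI ballI allI impI)
    show "c ` A \<subseteq> Z"
    proof clarify
      fix b assume b: "b \<in> A"
      have "\<gamma> (\<lambda>a. if a = b then 1 else 0) \<in> Z" using b by (intro \<gamma>) auto
      then show "c b \<in> Z" using c_eq[OF b, of 1] by simp
    qed
  next
    fix v assume v: "v \<in> Z"
    have "(\<lambda>a. if a \<in> A then \<phi> v (inv_into A c (c a)) else 0) = \<phi> v"
      using \<phi>[OF v] inj_c by (auto simp: fun_eq_iff)
    then show "\<exists>x. v - (\<Sum>b\<in>c ` A. ?s (x b) b) \<in> Bd"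
      unfolding comb using \<phi>[OF v] by (intro exI[of _ "\<lambda>b. \<phi> v (inv_into A c b)"]) simp
  next
    fix x b assume x: "(\<Sum>b\<in>c ` A. ?s (x b) b) \<in> Bd" and "b \<in> c ` A"
    then obtain a where a: "a \<in> A" "b = c a" by blast
    have "(\<lambda>a. if a \<in> A then x (c a) else 0) = 0"
      using x unfolding comb by (intro inj) auto
    from fun_cong[OF this, of a] show "x b = 0" using a by simp
  qed (use A in simp)
  then have "quot_dim ?s Z Bd = card (c ` A)" by (rule quot_dim_eqI[OF vs sub])
  then show ?thesis by (simp add: card_image inj_c)
qed

section \<open>Reduction modulo the variables\<close>

definition const_part :: "(nat \<Rightarrow> cpoly) \<Rightarrow> nat \<Rightarrow> complex" where
  "const_part v = (\<lambda>a. lookup (v a) 0)"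

definition const_vec :: "(nat \<Rightarrow> complex) \<Rightarrow> nat \<Rightarrow> cpoly" where
  "const_vec w = (\<lambda>a. cst (w a))"

text \<open>\<open>fibre_map f\<close> is the map induced by \<open>f\<close> on the fibres over \<open>S/(x\<^sub>0, \<dots>, x\<^sub>n)\<close>.\<close>

definition fibre_map :: "((nat \<Rightarrow> cpoly) \<Rightarrow> nat \<Rightarrow> cpoly) \<Rightarrow> (nat \<Rightarrow> complex) \<Rightarrow> nat \<Rightarrow> complex" where
  "fibre_map f w = const_part (f (const_vec w))"

lemma const_part_const_vec: "const_part (const_vec w) = w"
  by (simp add: const_part_def const_vec_def)

lemma const_part_diff: "const_part (v - w) = const_part v - const_part w"
  by (simp add: const_part_def fun_eq_iff lookup_minus)

lemma const_vec_FM: "(\<And>a. a \<ge> p \<Longrightarrow> w a = 0) \<Longrightarrow> const_vec w \<in> FM n p"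
  by (auto simp: FM_iff const_vec_def)

lemma const_part_expand:
  assumes "graded_map n p t r s f" "v \<in> FM n p"
  shows "const_part (f v) = (\<lambda>a. \<Sum>b<p. const_part v b * const_part (f (unit_vec b)) a)"
  by (simp add: graded_map_expand[OF assms] const_part_def sum_fun_apply smul_def lookup_sum
      lookup_mult_zero fun_eq_iff)

lemma fibre_map_eq:
  assumes "graded_map n p t r s f" "\<And>a. a \<ge> p \<Longrightarrow> w a = 0"
  shows "fibre_map f w = (\<lambda>a. \<Sum>b<p. w b * const_part (f (unit_vec b)) a)"
  using const_part_expand[OF assms(1) const_vec_FM[OF assms(2)]] by
      (simp add: fibre_map_def const_part_const_vec)

lemma const_part_graded_map:
  assumes "graded_map n p t r s f" "v \<in> FM n p"
  shows "const_part (f v) = fibre_map f (const_part v)"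
proof -
  have "fibre_map f (const_part v) = (\<lambda>a. \<Sum>b<p. const_part v b * const_part (f (unit_vec b)) a)"
    using assms(2) by (intro fibre_map_eq[OF assms(1)]) (simp add: FM_iff const_part_def)
  then show ?thesis by (simp add: const_part_expand[OF assms])
qed

lemma fibre_map_comp:
  assumes f: "graded_map n p t r s f" and g: "graded_map n q u p t g" and w: "\<And>a. a \<ge> q \<Longrightarrow> w a = 0"
  shows "const_part (f (g (const_vec w))) = fibre_map f (fibre_map g w)"
  using const_part_graded_map[OF f graded_mapD(1)[OF g const_vec_FM]] w by (simp add: fibre_map_def)

lemma const_vec_homog:
  assumes "\<And>a. w a \<noteq> 0 \<Longrightarrow> a < p \<and> t a = j"
  shows "const_vec w \<in> homog n p t j"
proof -
  have "w a = 0" if "a \<ge> p" for a using assms[of a] that by auto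
  then have "const_vec w \<in> FM n p" by (rule const_vec_FM)
  then show ?thesis using assms by (auto simp: homog_def const_vec_def)
qed

lemma fibre_map_graded:
  assumes f: "graded_map n p t r s f" and w: "\<And>a. w a \<noteq> 0 \<Longrightarrow> a < p \<and> t a
      = j" and a: "fibre_map f w a \<noteq> 0"
  shows "a < r \<and> s a = j"
proof -
  have *: "f (const_vec w) \<in> homog n r s j" by (rule graded_mapD(4)[OF f const_vec_homog[OF w]])
  have "0 \<in> keys (f (const_vec w) a)" using a by (simp add: fibre_map_def const_part_def in_keys_iff)
  then have "int (mdeg 0) + s a = j" using * unfolding homog_def by blast
  moreover have "f (const_vec w) a \<noteq> 0" using \<open>0 \<in> keys (f (const_vec w) a)\<close> by force
  ultimately show ?thesis using * by (auto simp: homog_def FM_iff not_le[symmetric])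
qed

lemma fibre_map_zero: "graded_map n p t r s f \<Longrightarrow> fibre_map f 0 = 0"
  using graded_map_zero[of n p t r s f] by (simp add: fibre_map_def const_vec_def const_part_def
      fun_eq_iff zero_fun_def)

lemma graded_map_mat_app:
  assumes "\<And>a b. a < r \<Longrightarrow> b < p \<Longrightarrow> A a b \<in> polys n"
    and "\<And>a b m. a < r \<Longrightarrow> b < p \<Longrightarrow> m \<in> keys (A a b) \<Longrightarrow> int (mdeg m) = t b - s a"
  shows "graded_map n p t r s (mat_app r p A)"
proof -
  have "mat_app r p A = (\<lambda>v. \<Sum>b<p. smul (v b) (\<lambda>a. if a < r then A a b else 0))"
    by (auto simp: fun_eq_iff mat_app_def sum_fun_apply smul_def mult.commute)
  moreover have "graded_map n p t r s (\<lambda>v. \<Sum>b<p. smul (v b) (\<lambda>a. if a < r then A a b else 0))"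
    using assms by (intro graded_map_of_basis) (auto simp: homog_def FM_iff polys_closed)
  ultimately show ?thesis by simp
qed

text \<open>Strictly increasing shifts force every matrix entry into positive degree, so no entry
  has a constant term.\<close>

lemma fibre_map_minimal:
  assumes f: "graded_map n p t r s f" and st: "\<And>a b. a < r \<Longrightarrow> b < p \<Longrightarrow> s a < t b"
    and w: "\<And>a. a \<ge> p \<Longrightarrow> w a = 0"
  shows "fibre_map f w = 0"
proof -
  have "const_part (f (unit_vec b)) a = 0" if b: "b < p" for a b
  proof (rule ccontr)
    assume "const_part (f (unit_vec b)) a \<noteq> 0"
    moreover have *: "f (unit_vec b) \<in> homog n r s (t b)"
        by (rule graded_mapD(4)[OF f homog_unit_vec[OF b]])
    ultimately have "int (mdeg 0) + s a = t b" "f (unit_vec b) a \<noteq> 0"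
      by (auto simp: homog_def const_part_def in_keys_iff simp del: mdeg_zero)
    moreover from this * have "a < r" by (auto simp: homog_def FM_iff not_le[symmetric])
    ultimately show False using st[of a b] b by simp
  qed
  then show ?thesis by (simp add: fibre_map_eq[OF f w] fun_eq_iff)
qed

text \<open>The arbitrary resolution \<open>F\<close> is homotopy equivalent to the minimal one. On
  fibres the differentials of the latter vanish, so Tor is the fibre of its free module, and the
  generators of shift \<open>j\<close> give a basis of the degree \<open>j\<close> part.\<close>

lemma tor_dim:
  assumes F: "graded_free_resolution n I F"
    and G: "resolution n r s D" "r 0 = 1" "s 0 = (\<lambda>_. 0)"
    and imG: "D 0 ` FM n (r 1) = {v \<in> FM n 1. v 0 \<in> I}"
    and min: "\<And>i a b. a < r i \<Longrightarrow> b < r (Suc i) \<Longrightarrow> s i a < s (Suc i) b"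
  shows "quot_dim (\<lambda>c v a. c * v a) (tor_cycles F (Suc i) j) (tor_boundaries F (Suc i) j) =
    card {a. a < r (Suc i) \<and> s (Suc i) a = j}"
proof -
  define E where "E i = mat_app (rk F i) (rk F (Suc i)) (bd F i)" for i
  have E: "graded_map n (rk F (Suc i)) (shift F (Suc i)) (rk F i) (shift F i) (E i)" for i
    unfolding E_def using F by (intro graded_map_mat_app) (auto simp: graded_free_resolution_def)
  have resE: "resolution n (rk F) (shift F) E"
    using F E by (simp add: resolution_def graded_free_resolution_def E_def)
  define f0 where "f0 = mat_app 1 (rk F 0) (\<lambda>_. aug F)"
  have f0: "graded_map n (rk F 0) (shift F 0) (r 0) (s 0) f0"
    unfolding f0_def G using F by (intro graded_map_mat_app) (auto simp: graded_free_resolution_def)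
  have f0_FM: "f0 v \<in> FM n 1" if "v \<in> FM n (rk F 0)" for v
    using graded_mapD(1)[OF f0 that] by (simp add: G)
  have f0_iff: "v \<in> E 0 ` FM n (rk F 1) \<longleftrightarrow> f0 v \<in> D 0 ` FM n (r 1)" if v: "v \<in> FM n (rk F 0)" for v
  proof -
    have "f0 v 0 = (\<Sum>a<rk F 0. aug F a * v a)" by (simp add: f0_def mat_app_def)
    moreover have "{v \<in> FM n (rk F 0). (\<Sum>a<rk F 0. aug F a * v a) \<in> I} = E 0 ` FM n (rk F 1)"
      using F by (simp add: graded_free_resolution_def E_def)
    ultimately show ?thesis using v f0_FM[OF v] unfolding imG by auto
  qed
  have D0: "graded_map n (r 1) (s 1) 1 (\<lambda>_. 0) (D 0)" using resolutionD(1)[OF G(1), of 0] by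
      (simp add: G)
  have uvec1: "unit_vec 0 \<in> FM n 1" "unit_vec 0 \<in> homog n 1 (\<lambda>_. 0) 0"
    using FM_unit_vec[of 0 1] homog_unit_vec[of 0 1 n "\<lambda>_. 0"] by simp_all
  \<comment> \<open>\<open>aug F\<close> is onto \<open>S/I\<close> only, so 1 is hit up to an
    element of \<open>I\<close>; the component of degree 0 is taken to make the resulting map from
    \<open>S\<close> to \<open>F_0\<close> graded.\<close>
  obtain u where u: "u \<in> homog n (rk F 0) (shift F 0) 0" "unit_vec 0 - f0 u \<in> D 0 ` FM n (r 1)"
  proof -
    obtain x where x: "x \<in> FM n (rk F 0)" "1 - (\<Sum>a<rk F 0. aug F a * x a) \<in> I"
      using F polys_closed(2)[of n] by (auto simp: graded_free_resolution_def)
    have "unit_vec 0 - f0 x \<in> D 0 ` FM n (r 1)"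
      unfolding imG using FM_closed(3)[OF uvec1(1) f0_FM[OF x(1)]] x(2)
      by (simp add: f0_def mat_app_def unit_vec_def)
    then obtain y where y: "y \<in> FM n (r 1)" "unit_vec 0 - f0 x = D 0 y" by blast
    have "D 0 (vec_part (s 1) 0 y) = unit_vec 0 - f0 (vec_part (shift F 0) 0 x)"
      using graded_map_vec_part[OF D0 y(1), of 0] graded_map_vec_part[OF f0 x(1), of 0]
          vec_part_eq[OF uvec1(2)]
      by (simp add: G vec_part_diff flip: y(2))
    moreover have "vec_part (s 1) 0 y \<in> FM n (r 1)" using homog_FM[OF vec_part_homog[OF y(1)]] .
    ultimately show ?thesis using that vec_part_homog[OF x(1)] by (metis imageI)
  qed
  define g0 where "g0 v = smul (v 0) u" for v :: "nat \<Rightarrow> cpoly"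
  have g0: "graded_map n (r 0) (s 0) (rk F 0) (shift F 0) g0"
  proof -
    have "graded_map n 1 (\<lambda>_. 0) (rk F 0) (shift F 0) (\<lambda>v. \<Sum>b<1. smul (v b) u)"
      using u by (intro graded_map_of_basis)
    then show ?thesis by (simp add: g0_def[abs_def] G)
  qed
  have fg: "x - f0 (g0 x) \<in> D 0 ` FM n (r 1)" if x: "x \<in> FM n 1" for x
  proof -
    have x0: "x 0 \<in> polys n" using x by (simp add: FM_iff)
    obtain y where y: "y \<in> FM n (r 1)" "unit_vec 0 - f0 u = D 0 y" using u(2) by blast
    have "x = smul (x 0) (unit_vec 0)" using x by (auto simp: fun_eq_iff smul_def unit_vec_def FM_iff)
    then have "x - f0 (g0 x) = smul (x 0) (unit_vec 0) - smul (x 0) (f0 u)"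
      using graded_mapD(3)[OF f0 x0 homog_FM[OF u(1)]] by (simp add: g0_def)
    also have "\<dots> = D 0 (smul (x 0) y)"
      by (simp add: smul_distribs(7)[symmetric] y(2) graded_mapD(3)[OF D0 x0 y(1)])
    finally show ?thesis using FM_closed(5)[OF x0 y(1)] by blast
  qed
  obtain f where f: "f 0 = f0" "\<And>i. graded_map n (rk F i) (shift F i) (r i) (s i) (f i)"
    "\<And>i v. v \<in> FM n (rk F (Suc i)) \<Longrightarrow> D i (f (Suc i) v) = f i (E i v)"
  proof -
    have "f0 (E 0 v) \<in> D 0 ` FM n (r 1)" if "v \<in> FM n (rk F 1)" for v
      using that f0_iff[of "E 0 v"] graded_mapD(1)[OF E[of 0]] by simp
    from chain_map_exists[OF resE G(1) f0 this] show ?thesis using that by blast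
  qed
  have D0_sub: "x - y \<in> D 0 ` FM n (r 1)" if xy: "x \<in> D 0 ` FM n (r 1)" "y \<in> D 0 ` FM n (r 1)" for x y
  proof -
    obtain x' y' where "x' \<in> FM n (r 1)" "y' \<in> FM n (r 1)" "x = D 0 x'" "y = D 0 y'"
      using xy by blast
    then show ?thesis using graded_map_diff[OF D0, of x' y'] FM_closed(3)[of x' n "r 1" y']
        by (metis imageI)
  qed
  obtain g where g: "g 0 = g0" "\<And>i. graded_map n (r i) (s i) (rk F i) (shift F i) (g i)"
    "\<And>i v. v \<in> FM n (r (Suc i)) \<Longrightarrow> E i (g (Suc i) v) = g i (D i v)"
  proof -
    \<comment> \<open>\<open>f0\<close> after \<open>g0\<close> is the identity modulo
      \<open>I\<close>, so \<open>f0\<close> maps \<open>g0 (D 0 v)\<close> into \<open>I\<close>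
      again, and exactness at \<open>F_0\<close> applies through \<open>f0_iff\<close>.\<close>
    have "g0 (D 0 v) \<in> E 0 ` FM n (rk F 1)" if v: "v \<in> FM n (r 1)" for v
    proof -
      have Dv: "D 0 v \<in> FM n 1" by (rule graded_mapD(1)[OF D0 v])
      then have "g0 (D 0 v) \<in> FM n (rk F 0)" using graded_mapD(1)[OF g0] by (simp add: G)
      moreover have "D 0 v - (D 0 v - f0 (g0 (D 0 v))) \<in> D 0 ` FM n (r 1)"
        by (rule D0_sub[OF imageI[OF v] fg[OF Dv]])
      ultimately show ?thesis by (subst f0_iff) simp_all
    qed
    from chain_map_exists[OF G(1) resE g0 this] show ?thesis using that by blast
  qed
  obtain \<sigma> where \<sigma>: "\<And>i. graded_map n (rk F i) (shift F i) (rk F (Suc i)) (shift F (Suc i)) (\<sigma> i)"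
    "\<And>i v. v \<in> FM n (rk F (Suc i)) \<Longrightarrow>
      E (Suc i) (\<sigma> (Suc i) v) = (v - g (Suc i) (f (Suc i) v)) - \<sigma> i (E i v)"
  proof -
    have "graded_map n (rk F i) (shift F i) (rk F i) (shift F i) (\<lambda>v. v - g i (f i v))" for i
      by (intro graded_map_sub graded_map_id graded_map_comp[OF g(2) f(2)])
    moreover have "E i (v - g (Suc i) (f (Suc i) v)) = E i v - g i (f i (E i v))"
      if v: "v \<in> FM n (rk F (Suc i))" for i v
    proof -
      have fv: "f (Suc i) v \<in> FM n (r (Suc i))" by (rule graded_mapD(1)[OF f(2) v])
      show ?thesis
        using graded_map_diff[OF E v graded_mapD(1)[OF g(2) fv]] g(3)[OF fv] f(3)[OF v] by simp
    qed
    moreover have "v - g 0 (f 0 v) \<in> E 0 ` FM n (rk F 1)" if v: "v \<in> FM n (rk F 0)" for v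
    proof -
      have f0v: "f0 v \<in> FM n 1" by (rule f0_FM[OF v])
      have gf: "g0 (f0 v) \<in> FM n (rk F 0)" using graded_mapD(1)[OF g0] f0v by (simp add: G)
      have "f0 (v - g0 (f0 v)) = f0 v - f0 (g0 (f0 v))" by (rule graded_map_diff[OF f0 v gf])
      then show ?thesis
        unfolding f(1) g(1) using f0_iff[OF FM_closed(3)[OF v gf]] fg[OF f0v] by simp
    qed
    ultimately have "\<exists>\<sigma>. (\<forall>i. graded_map n (rk F i) (shift F i) (rk F (Suc i)) (shift F (Suc i))
        (\<sigma> i)) \<and>
      (\<forall>i. \<forall>v\<in>FM n (rk F (Suc i)).
        E (Suc i) (\<sigma> (Suc i) v) = (v - g (Suc i) (f (Suc i) v)) - \<sigma> i (E i v))"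
      by (rule homotopy_exists[OF resE])
    then show ?thesis using that by blast
  qed
  obtain \<tau> where \<tau>: "\<And>i. graded_map n (r i) (s i) (r (Suc i)) (s (Suc i)) (\<tau> i)"
    "\<And>i v. v \<in> FM n (r (Suc i)) \<Longrightarrow>
      D (Suc i) (\<tau> (Suc i) v) = (v - f (Suc i) (g (Suc i) v)) - \<tau> i (D i v)"
  proof -
    have "graded_map n (r i) (s i) (r i) (s i) (\<lambda>v. v - f i (g i v))" for i
      by (intro graded_map_sub graded_map_id graded_map_comp[OF f(2) g(2)])
    moreover have "D i (v - f (Suc i) (g (Suc i) v)) = D i v - f i (g i (D i v))"
      if v: "v \<in> FM n (r (Suc i))" for i v
    proof -
      have gv: "g (Suc i) v \<in> FM n (rk F (Suc i))" by (rule graded_mapD(1)[OF g(2) v])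
      show ?thesis
        using graded_map_diff[OF resolutionD(1)[OF G(1)] v graded_mapD(1)[OF f(2) gv]] f(3)[OF gv]
            g(3)[OF v] by simp
    qed
    moreover have "v - f 0 (g 0 v) \<in> D 0 ` FM n (r 1)" if v: "v \<in> FM n (r 0)" for v
      unfolding f(1) g(1) using fg v by (simp add: G)
    ultimately have "\<exists>\<tau>. (\<forall>i. graded_map n (r i) (s i) (r (Suc i)) (s (Suc i)) (\<tau> i)) \<and>
      (\<forall>i. \<forall>v\<in>FM n (r (Suc i)).
        D (Suc i) (\<tau> (Suc i) v) = (v - f (Suc i) (g (Suc i) v)) - \<tau> i (D i v))"
      by (rule homotopy_exists[OF G(1)])
    then show ?thesis using that by blast
  qed
  have bd: "tensor_bd F i w = fibre_map (E i) w" for i w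
    by (simp add: tensor_bd_def mat_app_def fibre_map_def E_def const_part_def const_vec_def
        lookup_sum lookup_mult_zero
        fun_eq_iff)
  let ?A = "{a. a < r (Suc i) \<and> s (Suc i) a = j}"
  have barD: "fibre_map (D i) w = 0" if "\<And>a. a \<ge> r (Suc i) \<Longrightarrow> w a = 0" for i w
    using that by (intro fibre_map_minimal[OF resolutionD(1)[OF G(1)] min])
  show ?thesis
  proof (rule quot_dim_eq_card[where \<gamma>="fibre_map (g (Suc i))" and \<phi>="fibre_map (f (Suc i))"
        and c="\<lambda>b. const_part (g (Suc i) (unit_vec b))"])
    fix w :: "nat \<Rightarrow> complex" assume w: "\<And>a. a \<notin> ?A \<Longrightarrow> w a = 0"
    have w': "w a = 0" if "a \<ge> r (Suc i)" for a using w[of a] that by simp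
    have KKw: "const_vec w \<in> FM n (r (Suc i))" using w' by (rule const_vec_FM)
    show "fibre_map (g (Suc i)) w \<in> tor_cycles F (Suc i) j"
    proof -
      have "fibre_map (E i) (fibre_map (g (Suc i)) w) = const_part (E i (g (Suc i) (const_vec w)))"
        using fibre_map_comp[OF E g(2) w'] by simp
      also have "\<dots> = fibre_map (g i) (fibre_map (D i) w)"
        using fibre_map_comp[OF g(2) resolutionD(1)[OF G(1)] w'] g(3)[OF KKw] by simp
      also have "\<dots> = 0" using barD[OF w'] fibre_map_zero[OF g(2)] by simp
      finally show ?thesis
        using fibre_map_graded[OF g(2), of w "Suc i" j] w
            by (force simp: tor_cycles_def tensor_comp_def bd)
    qed
    have "fibre_map (g (Suc i)) w = (\<lambda>x. \<Sum>b<r (Suc i). w b * const_part (g (Suc i) (unit_vec b)) x)"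
      by (rule fibre_map_eq[OF g(2) w'])
    also have "\<dots> = (\<lambda>x. \<Sum>b\<in>?A. w b * const_part (g (Suc i) (unit_vec b)) x)"
      using w by (intro ext sum.mono_neutral_right) auto
    finally show "fibre_map (g (Suc i)) w = \<dots>" .
    \<comment> \<open>If \<open>g w\<close> is a boundary, \<open>f\<close> moves it to a boundary
      of the minimal complex, which is 0 on fibres; so \<open>f g w = 0\<close>. The homotopy
      \<open>\<tau>\<close> expresses \<open>w - f g w\<close> through differentials of the minimal
      complex, which also vanish, hence \<open>w = 0\<close>.\<close>
    assume "fibre_map (g (Suc i)) w \<in> tor_boundaries F (Suc i) j"
    then obtain x where x: "x \<in> tensor_comp F (Suc (Suc i)) j" "fibre_map (g (Suc i)) w
        = fibre_map (E (Suc i)) x"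
      by (auto simp: tor_boundaries_def bd)
    have x': "x a = 0" if "a \<ge> rk F (Suc (Suc i))" for a
      using x(1) that by (auto simp: tensor_comp_def not_less[symmetric])
    have KKx: "const_vec x \<in> FM n (rk F (Suc (Suc i)))" using x' by (rule const_vec_FM)
    have "fibre_map (f (Suc i)) (fibre_map (g (Suc i)) w)
        = const_part (f (Suc i) (E (Suc i) (const_vec x)))"
      using fibre_map_comp[OF f(2) E x'] x(2) by simp
    also have "\<dots> = const_part (D (Suc i) (f (Suc (Suc i)) (const_vec x)))" by (simp add: f(3)[OF KKx])
    also have "\<dots> = fibre_map (D (Suc i)) (fibre_map (f (Suc (Suc i))) x)"
      by (rule fibre_map_comp[OF resolutionD(1)[OF G(1)] f(2) x'])
    also have "\<dots> = 0"
    proof (rule barD)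
      fix a assume "a \<ge> r (Suc (Suc i))"
      then show "fibre_map (f (Suc (Suc i))) x a = 0"
        using graded_mapD(1)[OF f(2) KKx] by (simp add: fibre_map_def const_part_def FM_iff)
    qed
    finally have 1: "const_part (f (Suc i) (g (Suc i) (const_vec w))) = 0"
      using fibre_map_comp[OF f(2) g(2) w'] by simp
    have "const_part (D (Suc i) (\<tau> (Suc i) (const_vec w)))
        = fibre_map (D (Suc i)) (fibre_map (\<tau> (Suc i)) w)"
      by (rule fibre_map_comp[OF resolutionD(1)[OF G(1)] \<tau>(1) w'])
    also have "\<dots> = 0"
    proof (rule barD)
      fix a assume "a \<ge> r (Suc (Suc i))"
      then show "fibre_map (\<tau> (Suc i)) w a = 0"
        using graded_mapD(1)[OF \<tau>(1) KKw] by (simp add: fibre_map_def const_part_def FM_iff)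
    qed
    finally have 2: "const_part (D (Suc i) (\<tau> (Suc i) (const_vec w))) = 0" .
    have 3: "const_part (\<tau> i (D i (const_vec w))) = 0"
      using fibre_map_comp[OF \<tau>(1) resolutionD(1)[OF G(1)] w'] barD[OF w'] fibre_map_zero[OF \<tau>(1)]
          by simp
    show "w = 0"
      using arg_cong[OF \<tau>(2)[OF KKw], of const_part]
          unfolding const_part_diff 1 2 3 const_part_const_vec by simp
  next
    \<comment> \<open>For a cycle \<open>v\<close> the term \<open>\<sigma> E v\<close> of the
      homotopy vanishes on fibres, so \<open>v - g f v\<close> is the boundary of
      \<open>\<sigma> v\<close>.\<close>
    fix v assume v: "v \<in> tor_cycles F (Suc i) j"
    then have comp: "v \<in> tensor_comp F (Suc i) j" and cyc: "fibre_map (E i) v = 0"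
      by (auto simp: tor_cycles_def bd)
    have v': "v a = 0" if "a \<ge> rk F (Suc i)" for a
      using comp that by (auto simp: tensor_comp_def not_less[symmetric])
    have KKv: "const_vec v \<in> FM n (rk F (Suc i))" using v' by (rule const_vec_FM)
    have homog: "\<And>a. v a \<noteq> 0 \<Longrightarrow> a < rk F (Suc i) \<and> shift F (Suc i) a = j"
      using comp by (auto simp: tensor_comp_def)
    have "const_part (\<sigma> i (E i (const_vec v))) = 0"
      using fibre_map_comp[OF \<sigma>(1) E v'] cyc fibre_map_zero[OF \<sigma>(1)] by simp
    moreover have "const_part (E (Suc i) (\<sigma> (Suc i) (const_vec v)))
        = fibre_map (E (Suc i)) (fibre_map (\<sigma> (Suc i)) v)"
      by (rule fibre_map_comp[OF E \<sigma>(1) v'])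
    moreover have "const_part (g (Suc i) (f (Suc i) (const_vec v)))
        = fibre_map (g (Suc i)) (fibre_map (f (Suc i)) v)"
      by (rule fibre_map_comp[OF g(2) f(2) v'])
    ultimately have "v - fibre_map (g (Suc i)) (fibre_map (f (Suc i)) v)
        = fibre_map (E (Suc i)) (fibre_map (\<sigma> (Suc i)) v)"
      using arg_cong[OF \<sigma>(2)[OF KKv], of const_part]
          unfolding const_part_diff const_part_const_vec by simp
    moreover have "fibre_map (\<sigma> (Suc i)) v \<in> tensor_comp F (Suc (Suc i)) j"
      using fibre_map_graded[OF \<sigma>(1) homog] by (auto simp: tensor_comp_def)
    ultimately show "(\<forall>a. a \<notin> ?A \<longrightarrow> fibre_map (f (Suc i)) v a = 0) \<and>
        v - fibre_map (g (Suc i)) (fibre_map (f (Suc i)) v) \<in> tor_boundaries F (Suc i) j"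
      using fibre_map_graded[OF f(2) homog] by (auto simp: tor_boundaries_def bd)
  next
    show "0 \<in> tor_boundaries F (Suc i) j"
      unfolding tor_boundaries_def bd
      using fibre_map_zero[OF E] by (intro image_eqI[of _ _ 0]) (auto simp: tensor_comp_def)
    fix x y assume "x \<in> tor_boundaries F (Suc i) j" "y \<in> tor_boundaries F (Suc i) j"
    then obtain v w where vw: "v \<in> tensor_comp F (Suc (Suc i)) j" "w \<in> tensor_comp F (Suc (Suc i)) j"
      "x = tensor_bd F (Suc i) v" "y = tensor_bd F (Suc i) w" by (auto simp: tor_boundaries_def)
    have "v + w \<in> tensor_comp F (Suc (Suc i)) j"
      using vw(1,2) by (auto simp: tensor_comp_def) (metis add_0)+
    moreover have "x + y = tensor_bd F (Suc i) (v + w)"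
      by (simp add: vw tensor_bd_def mat_app_def fun_eq_iff distrib_left sum.distrib)
    ultimately show "x + y \<in> tor_boundaries F (Suc i) j" by (simp add: tor_boundaries_def)
  next
    fix z v assume "v \<in> tor_boundaries F (Suc i) j"
    then obtain w where w: "w \<in> tensor_comp F (Suc (Suc i)) j" "v = tensor_bd F (Suc i) w"
      by (auto simp: tor_boundaries_def)
    have "(\<lambda>a. z * w a) \<in> tensor_comp F (Suc (Suc i)) j"
      using w(1) by (auto simp: tensor_comp_def)
    moreover have "(\<lambda>a. z * v a) = tensor_bd F (Suc i) (\<lambda>a. z * w a)"
      by (simp add: w tensor_bd_def mat_app_def fun_eq_iff sum_distrib_left mult_ac)
    ultimately show "(\<lambda>a. z * v a) \<in> tor_boundaries F (Suc i) j" by (simp add: tor_boundaries_def)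
  qed simp
qed


section \<open>A mapping cone\<close>

lemma smul_uminus: "smul c (- v) = - smul c v"
  by (simp add: smul_def fun_eq_iff)

lemma graded_map_add:
  assumes "graded_map n p t r s f" "graded_map n p t r s g"
  shows "graded_map n p t r s (\<lambda>v. f v + g v)"
  using assms by (auto simp: graded_map_def FM_closed homog_add smul_distribs add_ac)

lemma graded_map_zero_map: "graded_map n p t r s (\<lambda>_. 0)"
  by (auto simp: graded_map_def FM_closed homog_zero smul_distribs)

lemma homog_const_shift: "homog n r (\<lambda>_. s) j = homog n r (\<lambda>_. s') (j - s + s')"
  unfolding homog_def by fastforce

lemma graded_map_shift:
  assumes "graded_map n p (\<lambda>_. t) r (\<lambda>_. s) f" "t' - t = s' - s"
  shows "graded_map n p (\<lambda>_. t') r (\<lambda>_. s') f"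
proof -
  have "f v \<in> homog n r (\<lambda>_. s') j" if "v \<in> homog n p (\<lambda>_. t') j" for v j
  proof -
    have "v \<in> homog n p (\<lambda>_. t) (j - t' + t)" using that homog_const_shift by blast
    then have "f v \<in> homog n r (\<lambda>_. s) (j - t' + t)" by (rule graded_mapD(4)[OF assms(1)])
    then have "f v \<in> homog n r (\<lambda>_. s') (j - t' + t - s + s')" using homog_const_shift by blast
    moreover have "j - t' + t - s + s' = j" using assms(2) by simp
    ultimately show ?thesis by metis
  qed
  then show ?thesis using assms(1) by (auto simp: graded_map_def)
qed

lemma graded_map_smul:
  assumes "q \<in> polys n" "\<And>m. m \<in> keys q \<Longrightarrow> int (mdeg m) = e" "t = s + e"
  shows "graded_map n p (\<lambda>_. t) p (\<lambda>_. s) (smul q)"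
proof -
  have "smul q v \<in> homog n p (\<lambda>_. s) j" if "v \<in> homog n p (\<lambda>_. t) j" for v j
  proof -
    have "smul q v \<in> homog n p (\<lambda>_. t) (e + j)" by (rule homog_smul[OF assms(1,2) that])
    then have "smul q v \<in> homog n p (\<lambda>_. s) (e + j - t + s)" using homog_const_shift by blast
    then show ?thesis by (simp add: assms(3))
  qed
  then show ?thesis
    using assms(1) by (auto simp: graded_map_def FM_closed smul_distribs mult.commute)
qed

section \<open>Free modules with three blocks of coordinates\<close>

definition glue :: "nat \<Rightarrow> nat \<Rightarrow> (nat \<Rightarrow> cpoly) \<Rightarrow> (nat \<Rightarrow> cpoly) \<Rightarrow> (nat \<Rightarrow> cpoly) \<Rightarrow> nat \<Rightarrow> cpoly" where
  "glue p q x y z = (\<lambda>a. if a < p then x a else if a < p + q then y (a - p) else z (a - p - q))"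

definition prj1 :: "nat \<Rightarrow> (nat \<Rightarrow> cpoly) \<Rightarrow> nat \<Rightarrow> cpoly" where
  "prj1 p v = (\<lambda>a. if a < p then v a else 0)"

definition prj2 :: "nat \<Rightarrow> nat \<Rightarrow> (nat \<Rightarrow> cpoly) \<Rightarrow> nat \<Rightarrow> cpoly" where
  "prj2 p q v = (\<lambda>a. if a < q then v (p + a) else 0)"

definition prj3 :: "nat \<Rightarrow> nat \<Rightarrow> (nat \<Rightarrow> cpoly) \<Rightarrow> nat \<Rightarrow> cpoly" where
  "prj3 p q v = (\<lambda>a. v (p + q + a))"

lemma glue_FM: "x \<in> FM n p \<Longrightarrow> y \<in> FM n q \<Longrightarrow> z \<in> FM n m \<Longrightarrow> glue p q x y z \<in> FM n (p + q + m)"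
  by (auto simp: FM_iff glue_def)

lemma glue_prj: "glue p q (prj1 p v) (prj2 p q v) (prj3 p q v) = v"
  by (auto simp: fun_eq_iff glue_def prj1_def prj2_def prj3_def)

lemma prj_glue:
  "x \<in> FM n p \<Longrightarrow> prj1 p (glue p q x y z) = x"
  "y \<in> FM n q \<Longrightarrow> prj2 p q (glue p q x y z) = y"
  "prj3 p q (glue p q x y z) = z"
  by (auto simp: fun_eq_iff glue_def prj1_def prj2_def prj3_def FM_iff)

lemma graded_map_prj:
  "graded_map n (p + q + m) (\<lambda>_. t) p (\<lambda>_. t) (prj1 p)"
  "graded_map n (p + q + m) (\<lambda>_. t) q (\<lambda>_. t) (prj2 p q)"
  "graded_map n (p + q + m) (\<lambda>_. t) m (\<lambda>_. t) (prj3 p q)"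
  by (auto simp: graded_map_def FM_iff homog_def prj1_def prj2_def prj3_def smul_def polys_closed
      fun_eq_iff)

lemma graded_map_glue:
  assumes "graded_map n u t p (\<lambda>_. s) f" "graded_map n u t q (\<lambda>_. s) g" "graded_map n u t m (\<lambda>_. s) h"
  shows "graded_map n u t (p + q + m) (\<lambda>_. s) (\<lambda>v. glue p q (f v) (g v) (h v))"
  unfolding graded_map_def
proof (intro conjI ballI allI)
  fix v assume "v \<in> FM n u"
  then show "glue p q (f v) (g v) (h v) \<in> FM n (p + q + m)"
    using assms[THEN graded_mapD(1)] by (intro glue_FM)
next
  fix v w assume "v \<in> FM n u" "w \<in> FM n u"
  then show "glue p q (f (v + w)) (g (v + w)) (h (v + w)) =
      glue p q (f v) (g v) (h v) + glue p q (f w) (g w) (h w)"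
    by (auto simp: assms[THEN graded_mapD(2)] glue_def fun_eq_iff)
next
  fix c v assume "c \<in> polys n" "v \<in> FM n u"
  then show "glue p q (f (smul c v)) (g (smul c v)) (h (smul c v))
      = smul c (glue p q (f v) (g v) (h v))"
    by (simp add: assms[THEN graded_mapD(3)]) (auto simp: glue_def fun_eq_iff smul_def)
next
  fix j v assume v: "v \<in> homog n u t j"
  have "f v \<in> homog n p (\<lambda>_. s) j" "g v \<in> homog n q (\<lambda>_. s) j" "h v \<in> homog n m (\<lambda>_. s) j"
    using v assms[THEN graded_mapD(4)] by blast+
  then show "glue p q (f v) (g v) (h v) \<in> homog n (p + q + m) (\<lambda>_. s) j"
    using glue_FM[of "f v" n p "g v" q "h v" m] by (auto simp: homog_def)
        (auto simp: glue_def split: if_splits)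
qed

text \<open>
  \<open>A\<close> and \<open>B\<close> resolve \<open>S/I\<close> and \<open>S/I'\<close> with \<open>I \<subseteq> I'\<close>.  If \<open>q\<close> is a nonzerodivisor modulo \<open>I\<close>, then
  \<open>0 \<rightarrow> I \<rightarrow> I \<oplus> I' \<rightarrow> I + q I' \<rightarrow> 0\<close>, with maps \<open>u \<mapsto> (q u, - u)\<close> and \<open>(u, w) \<mapsto> u + q w\<close>, is exact, and
  the mapping cone of a lift of the first map resolves \<open>S/(I + q I')\<close>.
\<close>

lemma mapping_cone:
  fixes e k :: int
  assumes A: "resolution n rA sA DA" "rA 0 = 1" "sA 0 = (\<lambda>_. 0)"
      "\<And>j. sA (Suc j) = (\<lambda>_. e + k * (int j + 1))"
    and B: "resolution n rB sB DB" "rB 0 = 1" "sB 0 = (\<lambda>_. 0)" "\<And>j. sB (Suc j) = (\<lambda>_. e + k * int j)"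
    and q: "q \<in> polys n" "\<And>m. m \<in> keys q \<Longrightarrow> int (mdeg m) = k"
    and q0: "q \<noteq> 0"
    and qA: "\<And>v. v \<in> FM n 1 \<Longrightarrow> smul q v \<in> DA 0 ` FM n (rA 1) \<Longrightarrow> v \<in> DA 0 ` FM n (rA 1)"
    and AB: "DA 0 ` FM n (rA 1) \<subseteq> DB 0 ` FM n (rB 1)"
    and T: "rT 0 = 1" "rT 1 = rA 1 + rB 1"
      "\<And>j. rT (Suc (Suc j)) = rA (Suc (Suc j)) + rB (Suc (Suc j)) + rA (Suc j)"
      "sT 0 = (\<lambda>_. 0)" "\<And>j. sT (Suc j) = (\<lambda>_. e + k * (int j + 1))"
  shows "\<exists>D. resolution n rT sT D \<and>
    D 0 ` FM n (rT 1) = {u + smul q w | u w. u \<in> DA 0 ` FM n (rA 1) \<and> w \<in> DB 0 ` FM n (rB 1)}"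
proof -
  note gA = resolutionD(1)[OF A(1)] and gB = resolutionD(1)[OF B(1)]
  have "graded_map n (rA 0) (sA 0) (rB 0) (sB 0) (\<lambda>v. v)"
    by (simp add: A B graded_map_id)
  from chain_map_exists[OF A(1) B(1) this] AB obtain \<phi>
    where \<phi>: "\<phi> 0 = (\<lambda>v. v)" "\<And>i. graded_map n (rA i) (sA i) (rB i) (sB i) (\<phi> i)"
      "\<And>i v. v \<in> FM n (rA (Suc i)) \<Longrightarrow> DB i (\<phi> (Suc i) v) = \<phi> i (DA i v)"
    by (smt (verit, best) image_subset_iff)
  \<comment> \<open>Sizes of the blocks in position \<open>Suc j\<close>: \<open>A\<close>,
    \<open>B\<close> and the shifted copy of \<open>A\<close>. The last is empty for
    \<open>j = 0\<close>, because the cone is formed from resolutions of the ideals, with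
    \<open>S\<close> put back once in position 0.\<close>
  define p1 where "p1 j = rA (Suc j)" for j
  define p2 where "p2 j = rB (Suc j)" for j
  define p3 where "p3 j = (case j of 0 \<Rightarrow> 0 | Suc i \<Rightarrow> rA (Suc i))" for j
  have p3_Suc: "p3 (Suc j) = rA (Suc j)" for j by (simp add: p3_def)
  have rT: "rT (Suc j) = p1 j + p2 j + p3 j" for j
    using T(2,3) by (cases j) (auto simp: p1_def p2_def p3_def)
  define N where "N j z = (case j of 0 \<Rightarrow> 0 | Suc i \<Rightarrow> 0 - DA j z)" for j and z :: "nat \<Rightarrow> cpoly"
  define X where "X j = prj1 (p1 j)" for j
  define Y where "Y j = prj2 (p1 j) (p2 j)" for j
  define Z where "Z j = prj3 (p1 j) (p2 j)" for j
  \<comment> \<open>The cone differential sends \<open>(x, y, z)\<close> to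
    \<open>(DA x + q z, DB y - \<phi> z, - DA z)\<close>; the signs are those of
    \<open>u \<mapsto> (q u, - u)\<close>. At index 0 it is the map to \<open>S\<close> with image
    \<open>I + q I'\<close>.\<close>
  define D where "D i v = (case i of 0 \<Rightarrow> DA 0 (X 0 v) + smul q (DB 0 (Y 0 v)) | Suc j \<Rightarrow>
      glue (p1 j) (p2 j) (DA i (X i v) + smul q (Z i v)) (DB i (Y i v) - \<phi> i (Z i v)) (N j (Z i v)))"
    for i and v :: "nat \<Rightarrow> cpoly"
  let ?s = "\<lambda>j. e + k * (int j + 1)"
  have gX: "graded_map n (rT (Suc j)) (\<lambda>_. t) (rA (Suc j)) (\<lambda>_. t) (X j)"
    and gY: "graded_map n (rT (Suc j)) (\<lambda>_. t) (rB (Suc j)) (\<lambda>_. t) (Y j)"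
    and gZ: "graded_map n (rT (Suc j)) (\<lambda>_. t) (p3 j) (\<lambda>_. t) (Z j)" for j t
    unfolding rT X_def Y_def Z_def by (simp_all add: graded_map_prj flip: p1_def p2_def)
  note FX = graded_mapD(1)[OF gX] and FY = graded_mapD(1)[OF gY] and FZ = graded_mapD(1)[OF gZ]
  have FZ': "Z (Suc j) v \<in> FM n (rA (Suc j))" if "v \<in> FM n (rT (Suc (Suc j)))" for j v
    using FZ[OF that] by (simp add: p3_Suc)
  have gD: "graded_map n (rT (Suc i)) (sT (Suc i)) (rT i) (sT i) (D i)" for i
  proof (cases i)
    case 0
    have "graded_map n (rA 1) (\<lambda>_. e + k) 1 (\<lambda>_. 0) (DA 0)"
      using gA[of 0] by (simp add: A)
    then have 1: "graded_map n (rT 1) (\<lambda>_. e + k) 1 (\<lambda>_. 0) (\<lambda>v. DA 0 (X 0 v))"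
      using gX[of 0] by (auto intro: graded_map_comp)
    have "graded_map n (rB 1) (\<lambda>_. e) 1 (\<lambda>_. 0) (DB 0)"
      using gB[of 0] by (simp add: B)
    \<comment> \<open>Multiplication by \<open>q\<close> raises degrees by \<open>k\<close>, so
      \<open>B\<close> enters with all its shifts raised by \<open>k\<close>; they then agree with
      the shifts of \<open>A\<close>.\<close>
    then have "graded_map n (rB 1) (\<lambda>_. e + k) 1 (\<lambda>_. k) (DB 0)" by (rule graded_map_shift) simp
    then have "graded_map n (rT 1) (\<lambda>_. e + k) 1 (\<lambda>_. k) (\<lambda>v. DB 0 (Y 0 v))"
      using gY[of 0] by (auto intro: graded_map_comp)
    then have 2: "graded_map n (rT 1) (\<lambda>_. e + k) 1 (\<lambda>_. 0) (\<lambda>v. smul q (DB 0 (Y 0 v)))"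
      by (rule graded_map_comp[rotated]) (rule graded_map_smul[OF q]; simp)
    show ?thesis
      using graded_map_add[OF 1 2] by (simp add: 0 T(1,4,5) D_def[abs_def])
  next
    case (Suc j)
    let ?t = "?s i"
    have t: "?t = ?s j + k" by (simp add: Suc algebra_simps)
    have "graded_map n (rA (Suc i)) (\<lambda>_. ?t) (rA i) (\<lambda>_. ?s j) (DA i)"
      using gA[of i] by (simp add: A(4) Suc)
    then have 1: "graded_map n (rT (Suc i)) (\<lambda>_. ?t) (p1 j) (\<lambda>_. ?s j) (\<lambda>v. DA i (X i v))"
      using gX[of i] by (auto intro: graded_map_comp simp: p1_def Suc)
    have "graded_map n (rA i) (\<lambda>_. ?t) (rA i) (\<lambda>_. ?s j) (smul q)"
      by (rule graded_map_smul[OF q t])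
    moreover have gZi: "graded_map n (rT (Suc i)) (\<lambda>_. ?t) (rA i) (\<lambda>_. ?t) (Z i)"
      using gZ[of i] by (simp add: Suc p3_Suc)
    ultimately have 2: "graded_map n (rT (Suc i)) (\<lambda>_. ?t) (p1 j) (\<lambda>_. ?s j) (\<lambda>v. smul q (Z i v))"
      by (auto intro: graded_map_comp simp: p1_def Suc)
    have "graded_map n (rB (Suc i)) (\<lambda>_. e + k * int i) (rB i) (\<lambda>_. e + k * int j) (DB i)"
      using gB[of i] by (simp add: B(4) Suc)
    then have "graded_map n (rB (Suc i)) (\<lambda>_. ?t) (rB i) (\<lambda>_. ?s j) (DB i)"
      by (rule graded_map_shift) (simp add: algebra_simps)
    then have 3: "graded_map n (rT (Suc i)) (\<lambda>_. ?t) (p2 j) (\<lambda>_. ?s j) (\<lambda>v. DB i (Y i v))"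
      using gY[of i] by (auto intro: graded_map_comp simp: p2_def Suc)
    have "graded_map n (rA i) (\<lambda>_. ?s j) (rB i) (\<lambda>_. e + k * int j) (\<phi> i)"
      using \<phi>(2)[of i] by (simp add: Suc A(4) B(4))
    then have "graded_map n (rA i) (\<lambda>_. ?t) (rB i) (\<lambda>_. ?s j) (\<phi> i)"
      by (rule graded_map_shift) (simp add: Suc algebra_simps)
    then have 4: "graded_map n (rT (Suc i)) (\<lambda>_. ?t) (p2 j) (\<lambda>_. ?s j) (\<lambda>v. \<phi> i (Z i v))"
      using gZi by (auto intro: graded_map_comp simp: p2_def Suc)
    have 5: "graded_map n (rT (Suc i)) (\<lambda>_. ?t) (p3 j) (\<lambda>_. ?s j) (\<lambda>v. N j (Z i v))"
    proof (cases j)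
      case 0
      then show ?thesis by (simp add: N_def graded_map_zero_map)
    next
      case (Suc l)
      have "graded_map n (rA (Suc j)) (\<lambda>_. ?s j) (rA j) (\<lambda>_. ?s l) (DA j)"
        using gA[of j] by (simp add: A(4) Suc)
      then have "graded_map n (rA i) (\<lambda>_. ?t) (p3 j) (\<lambda>_. ?s j) (DA j)"
        unfolding Suc p3_Suc \<open>i = Suc j\<close> by (rule graded_map_shift) (simp add: algebra_simps)
      from graded_map_sub[OF graded_map_zero_map graded_map_comp[OF this gZi]] show ?thesis
        by (simp add: N_def Suc)
    qed
    show ?thesis
      using graded_map_glue[OF graded_map_add[OF 1 2] graded_map_sub[OF 3 4] 5]
      unfolding Suc T(5) rT[of j] by (simp add: D_def[abs_def] Suc)
  qed
  have D0: "D 0 v = DA 0 (X 0 v) + smul q (DB 0 (Y 0 v))" for v by (simp add: D_def)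
  have DS: "D (Suc j) v = glue (p1 j) (p2 j) (DA (Suc j) (X (Suc j) v) + smul q (Z (Suc j) v))
      (DB (Suc j) (Y (Suc j) v) - \<phi> (Suc j) (Z (Suc j) v)) (N j (Z (Suc j) v))" for j v
    by (simp add: D_def)
  have mk: "\<exists>v\<in>FM n (rT (Suc j)). X j v = x \<and> Y j v = y \<and> Z j v = z"
    if "x \<in> FM n (rA (Suc j))" "y \<in> FM n (rB (Suc j))" "z \<in> FM n (p3 j)" for j x y z
    using that prj_glue(1,2)[of _ n] prj_glue(3) glue_FM[of x n "p1 j" y "p2 j" z "p3 j"]
    by (intro bexI[of _ "glue (p1 j) (p2 j) x y z"])
      (auto simp: X_def Y_def Z_def rT p1_def p2_def)
  have ext: "v = w" if "X j v = X j w" "Y j v = Y j w" "Z j v = Z j w" for j v w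
    using that glue_prj[of "p1 j" "p2 j"] by (metis X_def Y_def Z_def)
  have comps: "X j (D (Suc j) v) = DA (Suc j) (X (Suc j) v) + smul q (Z (Suc j) v)"
    "Y j (D (Suc j) v) = DB (Suc j) (Y (Suc j) v) - \<phi> (Suc j) (Z (Suc j) v)"
    "Z j (D (Suc j) v) = N j (Z (Suc j) v)" if v: "v \<in> FM n (rT (Suc (Suc j)))" for j v
  proof -
    have "DA (Suc j) (X (Suc j) v) + smul q (Z (Suc j) v) \<in> FM n (p1 j)"
      unfolding p1_def
      by (intro FM_closed graded_mapD(1)[OF gA] FX FZ' v q)
    moreover have "DB (Suc j) (Y (Suc j) v) - \<phi> (Suc j) (Z (Suc j) v) \<in> FM n (p2 j)"
      unfolding p2_def
      by (intro FM_closed graded_mapD(1)[OF gB] graded_mapD(1)[OF \<phi>(2)] FY FZ' v)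
    ultimately show "X j (D (Suc j) v) = DA (Suc j) (X (Suc j) v) + smul q (Z (Suc j) v)"
      "Y j (D (Suc j) v) = DB (Suc j) (Y (Suc j) v) - \<phi> (Suc j) (Z (Suc j) v)"
      "Z j (D (Suc j) v) = N j (Z (Suc j) v)"
      unfolding DS X_def Y_def Z_def by (simp_all add: prj_glue)
  qed
  have smul_q: "DA i (smul q v) = smul q (DA i v)" if "v \<in> FM n (rA (Suc i))" for i v
    by (rule graded_mapD(3)[OF gA q(1) that])
  have zero_iff: "v = 0 \<longleftrightarrow> X j v = 0 \<and> Y j v = 0 \<and> Z j v = 0" for j v
  proof
    assume "v = 0"
    then show "X j v = 0 \<and> Y j v = 0 \<and> Z j v = 0"
      by (simp only: graded_map_zero[OF gX] graded_map_zero[OF gY] graded_map_zero[OF gZ])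
  next
    assume 0: "X j v = 0 \<and> Y j v = 0 \<and> Z j v = 0"
    show "v = 0"
    proof (rule ext)
      show "X j v = X j 0" using 0 graded_map_zero[OF gX] by metis
      show "Y j v = Y j 0" using 0 graded_map_zero[OF gY] by metis
      show "Z j v = Z j 0" using 0 graded_map_zero[OF gZ] by metis
    qed
  qed
  have DD: "D i (D (Suc i) v) = 0" if v: "v \<in> FM n (rT (Suc (Suc i)))" for i v
  proof -
    let ?x = "X (Suc i) v" and ?y = "Y (Suc i) v" and ?z = "Z (Suc i) v"
    have F: "?x \<in> FM n (rA (Suc (Suc i)))" "?y \<in> FM n (rB (Suc (Suc i)))" "?z \<in> FM n (rA (Suc i))"
      using v by (auto intro: FX FY FZ')
    have x: "DA i (X i (D (Suc i) v)) = smul q (DA i ?z)"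
      unfolding comps[OF v]
      using graded_mapD(2)[OF gA graded_mapD(1)[OF gA F(1)] FM_closed(5)[OF q(1) F(3)]]
      by (simp add: smul_q F resolutionD(2)[OF A(1)])
    have y: "DB i (Y i (D (Suc i) v)) = 0 - \<phi> i (DA i ?z)"
      unfolding comps[OF v]
      using graded_map_diff[OF gB graded_mapD(1)[OF gB F(2)] graded_mapD(1)[OF \<phi>(2) F(3)]]
      by (simp add: \<phi>(3) F resolutionD(2)[OF B(1)])
    show ?thesis
    proof (cases i)
      case 0
      then show ?thesis using x y by (simp add: D0 \<phi>(1) smul_uminus)
    next
      case (Suc j)
      have z: "Z i (D (Suc i) v) = 0 - DA i ?z"
        unfolding comps[OF v] by (simp add: N_def Suc)
      have DAz: "DA i ?z \<in> FM n (rA i)" by (rule graded_mapD(1)[OF gA F(3)])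
      have Dv: "D (Suc i) v \<in> FM n (rT (Suc i))" by (rule graded_mapD(1)[OF gD v])
      have \<phi>z: "\<phi> i (0 - DA i ?z) = 0 - \<phi> i (DA i ?z)"
        using graded_map_diff[OF \<phi>(2) FM_closed(1) DAz] graded_map_zero[OF \<phi>(2)] by simp
      have "DA j (0 - DA i ?z) = 0"
        using graded_map_diff[OF gA[of j] FM_closed(1), of "DA i ?z"] graded_map_zero[OF gA[of j]] DAz
          resolutionD(2)[OF A(1), of ?z j] F(3) by (simp add: Suc)
      then have "N j (0 - DA i ?z) = 0" by (cases j) (simp_all add: N_def)
      then have "X j (D i (D (Suc i) v)) = 0 \<and> Y j (D i (D (Suc i) v)) = 0
          \<and> Z j (D i (D (Suc i) v)) = 0"
        using comps[of "D (Suc i) v" j] Dv x y z \<phi>z by (simp add: Suc smul_uminus)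
      then show ?thesis by (rule zero_iff[of _ j, THEN iffD2])
    qed
  qed
  have exact: "v \<in> D (Suc i) ` FM n (rT (Suc (Suc i)))"
    if v: "v \<in> FM n (rT (Suc i))" and Dv: "D i v = 0" for i v
  proof -
    let ?x = "X i v" and ?y = "Y i v" and ?z = "Z i v"
    note F = FX[OF v] FY[OF v] FZ[OF v]
    \<comment> \<open>The preimage will have last block \<open>- z'\<close>. Once this is mapped to
      the last block of \<open>v\<close>, the corrected first two blocks are cycles of
      \<open>A\<close> and \<open>B\<close>, and exactness there supplies the rest.\<close>
    have "\<exists>z'\<in>FM n (rA (Suc i)). ?z = N i (0 - z') \<and>
        DA i (?x + smul q z') = 0 \<and> DB i (?y - \<phi> (Suc i) z') = 0"
    proof (cases i)
      case 0
      have F': "?x \<in> FM n (rA 1)" "?y \<in> FM n (rB 1)" using F 0 by auto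
      have DAx: "DA 0 ?x \<in> DA 0 ` FM n (rA 1)" using F' by simp
      have eq: "DA 0 ?x + smul q (DB 0 ?y) = 0" using Dv by (simp add: 0 D0)
      have "smul q (DB 0 ?y) = DA 0 (0 - ?x)"
      proof -
        have "DA 0 (0 - ?x) = DA 0 0 - DA 0 ?x"
          using F' by (intro graded_map_diff[OF gA[of 0]] FM_closed) simp_all
        then show ?thesis
          using eq graded_map_zero[OF gA[of 0]] by (metis add_diff_cancel_left')
      qed
      moreover have "0 - ?x \<in> FM n (rA 1)" by (intro FM_closed F')
      ultimately have "smul q (DB 0 ?y) \<in> DA 0 ` FM n (rA 1)" by blast
      moreover have "DB 0 ?y \<in> FM n 1" using graded_mapD(1)[OF gB[of 0]] F' by (simp add: B)
      \<comment> \<open>\<open>q\<close> is a nonzerodivisor modulo \<open>I\<close>: as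
        \<open>q * DB 0 ?y\<close> lies in \<open>I\<close>, so does \<open>DB 0 ?y\<close>.\<close>
      ultimately obtain z' where z': "z' \<in> FM n (rA 1)" "DB 0 ?y = DA 0 z'" using qA by blast
      have "DB 0 (?y - \<phi> (Suc 0) z') = 0"
        using graded_map_diff[OF gB[of 0], of ?y "\<phi> 1 z'"] F' graded_mapD(1)[OF \<phi>(2)[of 1] z'(1)]
            \<phi>(3)[of z' 0] z'
        by (simp add: \<phi>(1))
      moreover have "DA 0 (?x + smul q z') = 0"
        using graded_mapD(2)[OF gA[of 0], of ?x "smul q z'"] F' FM_closed(5)[OF q(1) z'(1)]
            smul_q[of z' 0] z' eq
        by simp
      moreover have "?z = 0" using F(3) by (auto simp: 0 p3_def FM_iff fun_eq_iff)
      ultimately show ?thesis using z' by (intro bexI[of _ z']) (auto simp: 0 N_def)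
    next
      case (Suc j)
      have z: "?z \<in> FM n (rA i)" using F(3) by (simp add: Suc p3_Suc)
      have eqs: "DA i ?x + smul q ?z = 0" "DB i ?y - \<phi> i ?z = 0" "N j ?z = 0"
        using comps[of v j] v Dv zero_iff[of "D i v" j] by (simp_all add: Suc)
      have "DA j ?z = 0"
      proof (cases j)
        case 0
        \<comment> \<open>The last block of \<open>D i v\<close> is empty here and does not say that
          \<open>?z\<close> is a cycle. Instead \<open>DA 0\<close> is applied to the first
          equation; this gives \<open>q * DA 0 ?z = 0\<close>, and \<open>q \<noteq> 0\<close>
          cancels in a domain.\<close>
        have e: "DA 1 ?x + smul q ?z = 0" using eqs(1) by (simp add: Suc 0)
        have "DA 0 (DA 1 ?x + smul q ?z) = DA 0 (DA 1 ?x) + DA 0 (smul q ?z)"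
          using graded_mapD(2)[OF gA[of 0]] graded_mapD(1)[OF gA[of 1], of ?x] FM_closed(5)[OF
              q(1) z] F(1)
          by (simp add: Suc 0)
        moreover have "DA 0 (DA 1 ?x) = 0" using resolutionD(2)[OF A(1), of ?x 0] F(1) by
            (simp add: Suc 0)
        moreover have "DA 0 (smul q ?z) = smul q (DA 0 ?z)" using smul_q[of ?z 0] z by (simp add: Suc 0)
        ultimately have "smul q (DA 0 ?z) = 0"
          using e graded_map_zero[OF gA[of 0]] by (metis add_0)
        then have "DA 0 ?z a = 0" for a using fun_cong[of _ _ a] q0 by (fastforce simp: smul_def)
        then show ?thesis by (simp add: 0 fun_eq_iff)
      next
        case (Suc l)
        then show ?thesis using eqs(3) by (simp add: N_def)
      qed
      then obtain z' where z': "z' \<in> FM n (rA (Suc i))" "?z = DA i z'"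
        using resolutionD(3)[OF A(1), of ?z j] z by (auto simp: Suc)
      have "DB i (?y - \<phi> (Suc i) z') = 0"
        using graded_map_diff[OF gB F(2) graded_mapD(1)[OF \<phi>(2) z'(1)]] \<phi>(3)[OF z'(1)] z'(2)
            eqs(2) by simp
      moreover have "DA i (?x + smul q z') = 0"
        using graded_mapD(2)[OF gA F(1) FM_closed(5)[OF q(1) z'(1)]] smul_q[OF z'(1)] z'(2) eqs(1)
            by simp
      moreover have "?z = N i (0 - z')"
        using graded_map_diff[OF gA FM_closed(1) z'(1)] graded_map_zero[OF gA[of i]] z'(2)
        by (simp add: N_def Suc)
      ultimately show ?thesis using z' by blast
    qed
    then obtain z' where z': "z' \<in> FM n (rA (Suc i))" "?z = N i (0 - z')"
      "DA i (?x + smul q z') = 0" "DB i (?y - \<phi> (Suc i) z') = 0" by blast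
    obtain x' where x': "x' \<in> FM n (rA (Suc (Suc i)))" "?x + smul q z' = DA (Suc i) x'"
      using resolutionD(3)[OF A(1) _ z'(3)] FM_closed(2)[OF F(1) FM_closed(5)[OF q(1) z'(1)]] by blast
    obtain y' where y': "y' \<in> FM n (rB (Suc (Suc i)))" "?y - \<phi> (Suc i) z' = DB (Suc i) y'"
      using resolutionD(3)[OF B(1) _ z'(4)] FM_closed(3)[OF F(2) graded_mapD(1)[OF \<phi>(2) z'(1)]] by blast
    have nz: "0 - z' \<in> FM n (rA (Suc i))" by (intro FM_closed z'(1))
    obtain w where w: "w \<in> FM n (rT (Suc (Suc i)))" "X (Suc i) w = x'" "Y (Suc i) w
        = y'" "Z (Suc i) w = 0 - z'"
      using mk[OF x'(1) y'(1), of "0 - z'"] nz by (auto simp: p3_Suc)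
    have "\<phi> (Suc i) (0 - z') = 0 - \<phi> (Suc i) z'"
      using graded_map_diff[OF \<phi>(2) FM_closed(1) z'(1)] graded_map_zero[OF \<phi>(2)] by simp
    then have \<phi>z: "DB (Suc i) y' - \<phi> (Suc i) (0 - z') = Y i v"
      unfolding y'(2)[symmetric] by simp
    have xz: "DA (Suc i) x' + smul q (0 - z') = X i v"
      unfolding x'(2)[symmetric] by (simp add: smul_uminus)
    have "v = D (Suc i) w"
    proof (rule ext)
      show "X i v = X i (D (Suc i) w)" unfolding comps(1)[OF w(1)] w(2-4) xz by (rule refl)
      show "Y i v = Y i (D (Suc i) w)" unfolding comps(2)[OF w(1)] w(2-4) \<phi>z by (rule refl)
      show "Z i v = Z i (D (Suc i) w)" unfolding comps(3)[OF w(1)] w(2-4) by (rule z'(2))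
    qed
    then show ?thesis using w(1) by blast
  qed
  have "resolution n rT sT D"
    unfolding resolution_def
  proof (intro conjI allI equalityI subsetI)
    fix i v assume "v \<in> D (Suc i) ` FM n (rT (Suc (Suc i)))"
    then obtain w where "w \<in> FM n (rT (Suc (Suc i)))" "v = D (Suc i) w" by blast
    then show "v \<in> {v \<in> FM n (rT (Suc i)). D i v = 0}"
      using DD graded_mapD(1)[OF gD[of "Suc i"]] by simp
  qed (use gD exact in auto)
  moreover have "D 0 ` FM n (rT 1) = {u + smul q w | u w. u \<in> DA 0 ` FM n (rA 1)
      \<and> w \<in> DB 0 ` FM n (rB 1)}"
  proof (intro equalityI subsetI)
    fix v assume "v \<in> D 0 ` FM n (rT 1)"
    then obtain w where "w \<in> FM n (rT (Suc 0))" "v = D 0 w" by auto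
    then show "v \<in> {u + smul q w | u w. u \<in> DA 0 ` FM n (rA 1) \<and> w \<in> DB 0 ` FM n (rB 1)}"
      using FX[of w 0] FY[of w 0] unfolding D0 by auto
  next
    fix v assume "v \<in> {u + smul q w | u w. u \<in> DA 0 ` FM n (rA 1) \<and> w \<in> DB 0 ` FM n (rB 1)}"
    then obtain x y where xy: "x \<in> FM n (rA (Suc 0))" "y \<in> FM n (rB (Suc 0))" "v
        = DA 0 x + smul q (DB 0 y)"
      by auto
    obtain w where "w \<in> FM n (rT (Suc 0))" "X 0 w = x" "Y 0 w = y"
      using mk[OF xy(1,2) FM_closed(1)] by blast
    then show "v \<in> D 0 ` FM n (rT 1)" using xy(3) D0[of w] by (intro image_eqI[of _ _ w]) simp_all
  qed
  ultimately show ?thesis by blast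
qed


section \<open>Graded Betti numbers\<close>

text \<open>Makes the choice in \<open>graded_betti\<close> meaningful: a graded free resolution
  exists, and \<open>tor_dim\<close> then applies to whichever one is chosen.\<close>

lemma resolution_imp_graded_free_resolution:
  assumes D: "resolution n r s D" and r: "r 0 = 1" "s 0 = (\<lambda>_. 0)" and I: "0 \<in> I"
    and im: "D 0 ` FM n (r 1) = {v \<in> FM n 1. v 0 \<in> I}"
  shows "graded_free_resolution n I \<lparr>rk = r, shift = s, bd = \<lambda>i a b. D i (unit_vec b) a, aug = \<lambda>_. 1\<rparr>"
proof -
  have mat: "mat_app (r i) (r (Suc i)) (\<lambda>a b. D i (unit_vec b) a) v
      = D i v" if v: "v \<in> FM n (r (Suc i))" for i v
  proof
    fix a
    have "D i v \<in> FM n (r i)" by (rule graded_mapD(1)[OF resolutionD(1)[OF D] v])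
    then have "D i v a = 0" if "\<not> a < r i" using that by (simp add: FM_iff)
    moreover have "D i v a = (\<Sum>b<r (Suc i). v b * D i (unit_vec b) a)"
      by (simp add: graded_map_expand[OF resolutionD(1)[OF D] v] sum_fun_apply smul_def)
    ultimately show "mat_app (r i) (r (Suc i)) (\<lambda>a b. D i (unit_vec b) a) v a = D i v a"
      by (simp add: mat_app_def mult.commute)
  qed
  have Du: "D i (unit_vec b) \<in> homog n (r i) (s i) (s (Suc i) b)" if "b < r (Suc i)" for i b
    using graded_mapD(4)[OF resolutionD(1)[OF D] homog_unit_vec[OF that]] .
  show ?thesis
    unfolding graded_free_resolution_def free_complex.simps
  proof (intro conjI)
    show "\<forall>a<r 0. 1 \<in> polys n \<and> (\<forall>m\<in>keys (1 :: cpoly). int (mdeg m) = s 0 a)"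
      by (simp add: r polys_closed)
    show "\<forall>i. \<forall>a<r i. \<forall>b<r (Suc i). D i (unit_vec b) a \<in> polys n \<and>
        (\<forall>m\<in>keys (D i (unit_vec b) a). int (mdeg m) = s (Suc i) b - s i a)"
      using Du by (fastforce simp: homog_def FM_iff)
    show "\<forall>f\<in>polys n. \<exists>v\<in>FM n (r 0). f - (\<Sum>a<r 0. 1 * v a) \<in> I"
    proof
      fix f assume "f \<in> polys n"
      then have "(\<lambda>a. if a = 0 then f else 0) \<in> FM n (r 0)" by (simp add: FM_iff r polys_closed)
      then show "\<exists>v\<in>FM n (r 0). f - (\<Sum>a<r 0. 1 * v a) \<in> I"
        using I by (intro bexI[of _ "\<lambda>a. if a = 0 then f else 0"]) (simp_all add: r)
    qed
    have "mat_app (r 0) (r 1) (\<lambda>a b. D 0 (unit_vec b) a) ` FM n (r 1) = D 0 ` FM n (r 1)"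
      using mat[of _ 0] by (intro image_cong) simp_all
    then show "{v \<in> FM n (r 0). (\<Sum>a<r 0. 1 * v a) \<in> I} =
        mat_app (r 0) (r 1) (\<lambda>a b. D 0 (unit_vec b) a) ` FM n (r 1)"
      using im by (simp add: r)
    show "\<forall>i. {v \<in> FM n (r (Suc i)). mat_app (r i) (r (Suc i)) (\<lambda>a b. D i (unit_vec b) a) v = 0} =
       mat_app (r (Suc i)) (r (Suc (Suc i))) (\<lambda>a b. D (Suc i) (unit_vec b) a) ` FM n (r (Suc (Suc i)))"
    proof
      fix i
      have "mat_app (r (Suc i)) (r (Suc (Suc i))) (\<lambda>a b. D (Suc i) (unit_vec b) a) ` FM n (r (Suc
          (Suc i))) =
          D (Suc i) ` FM n (r (Suc (Suc i)))"
        using mat[of _ "Suc i"] by (intro image_cong) simp_all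
      moreover have "{v \<in> FM n (r (Suc i)). mat_app (r i) (r (Suc i)) (\<lambda>a b. D i (unit_vec b) a) v
          = 0} =
          {v \<in> FM n (r (Suc i)). D i v = 0}"
        using mat by auto
      ultimately show "{v \<in> FM n (r (Suc i)). mat_app (r i) (r (Suc i)) (\<lambda>a b. D i (unit_vec b) a)
          v = 0} =
          mat_app (r (Suc i)) (r (Suc (Suc i))) (\<lambda>a b. D (Suc i) (unit_vec b) a) ` FM n (r (Suc
              (Suc i)))"
        using D by (simp add: resolution_def)
    qed
  qed
qed

lemma graded_betti_eq_card:
  assumes "resolution n r s D" "r 0 = 1" "s 0 = (\<lambda>_. 0)" "0 \<in> I"
    and "D 0 ` FM n (r 1) = {v \<in> FM n 1. v 0 \<in> I}"
    and "\<And>i a b. a < r i \<Longrightarrow> b < r (Suc i) \<Longrightarrow> s i a < s (Suc i) b"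
  shows "graded_betti n I (Suc i) j = card {a. a < r (Suc i) \<and> s (Suc i) a = j}"
proof -
  have "graded_free_resolution n I (SOME F. graded_free_resolution n I F)"
    using resolution_imp_graded_free_resolution[OF assms(1-5)] by (rule someI)
  then show ?thesis
    unfolding graded_betti_def Let_def by (rule tor_dim) fact+
qed

text \<open>
  \<open>brank i r d\<close> is the rank of the \<open>(i + 1)\<close>-st free module in the resolution of \<open>S/J r d\<close>.  The
  truncated subtractions give the intended values for \<open>d = 0\<close> (unit ideal) and \<open>r = 0\<close> as well.
\<close>

definition brank :: "nat \<Rightarrow> nat \<Rightarrow> nat \<Rightarrow> nat" where
  "brank i r d = (d + i - 1 choose i) * (d + r - 1 choose (d + i))"

text \<open>By Pascal's rule, the products of binomials obey the recursion of the ranks in the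
  mapping cone; the last summand is the shifted copy of the resolution of
  \<open>S/J r (Suc d)\<close>.\<close>

lemma brank_simps:
  "brank i r 0 = (if i = 0 then 1 else 0)"
  "brank i 0 (Suc d) = 0"
  "brank 0 (Suc r) (Suc d) = brank 0 r (Suc d) + brank 0 (Suc r) d"
  "brank (Suc i) (Suc r) (Suc d) = brank (Suc i) r (Suc d) + brank (Suc i) (Suc r) d + brank i r
      (Suc d)"
  by (auto simp: brank_def algebra_simps)

section \<open>Resolution and Betti numbers of \<open>S/J r d\<close>\<close>

context grid
begin

definition ranks :: "nat \<Rightarrow> nat \<Rightarrow> nat \<Rightarrow> nat" where
  "ranks r d i = (case i of 0 \<Rightarrow> 1 | Suc j \<Rightarrow> brank j r d)"

definition shifts :: "nat \<Rightarrow> nat \<Rightarrow> nat \<Rightarrow> int" where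
  "shifts d i = (\<lambda>_. case i of 0 \<Rightarrow> 0 | Suc j \<Rightarrow> int k * int d + int k * int j)"

lemma FM_0: "FM n 0 = {0}"
proof (intro equalityI subsetI)
  fix v assume "v \<in> FM n 0"
  then show "v \<in> {0}" by (simp add: FM_iff fun_eq_iff)
qed (simp add: FM_closed)

text \<open>The zero module \<open>S/S\<close> is resolved by the identity of \<open>S\<close>. This
  is not minimal, but its ranks and shifts follow the general pattern, as the cone construction
  requires of its input.\<close>

lemma resolution_degree_0:
  "\<exists>D. resolution n (ranks r 0) (shifts 0) D \<and> D 0 ` FM n (ranks r 0 1) = {v \<in> FM n 1. v 0 \<in> J r 0}"
proof -
  let ?D = "\<lambda>i v. if i = 0 then v else (0 :: nat \<Rightarrow> cpoly)"
  have rank: "ranks r 0 i = (if i \<le> 1 then 1 else 0)" for i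
    by (cases i) (auto simp: ranks_def brank_simps split: nat.splits)
  have "graded_map n (ranks r 0 (Suc i)) (shifts 0 (Suc i)) (ranks r 0 i) (shifts 0 i) (?D i)" for i
  proof (cases i)
    case 0
    then show ?thesis by (simp add: rank shifts_def graded_map_id)
  qed (simp add: graded_map_zero_map)
  moreover have "{v \<in> FM n (ranks r 0 (Suc i)). ?D i v = 0}
      = ?D (Suc i) ` FM n (ranks r 0 (Suc (Suc i)))" for i
    by (cases i) (simp_all add: rank FM_0 FM_closed Collect_conv_if)
  ultimately have "resolution n (ranks r 0) (shifts 0) ?D" unfolding resolution_def by blast
  moreover have "?D 0 ` FM n (ranks r 0 1) = {v \<in> FM n 1. v 0 \<in> J r 0}"
    by (simp add: rank J_degree_0) (auto simp: FM_iff)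
  ultimately show ?thesis by blast
qed

lemma resolution_no_vars:
  "\<exists>D. resolution n (ranks 0 (Suc d)) (shifts (Suc d)) D \<and>
    D 0 ` FM n (ranks 0 (Suc d) 1) = {v \<in> FM n 1. v 0 \<in> J 0 (Suc d)}"
proof -
  let ?D = "\<lambda>(_ :: nat) (_ :: nat \<Rightarrow> cpoly). 0 :: nat \<Rightarrow> cpoly"
  have rank: "ranks 0 (Suc d) i = (if i = 0 then 1 else 0)" for i
    by (cases i) (auto simp: ranks_def brank_simps)
  have "resolution n (ranks 0 (Suc d)) (shifts (Suc d)) ?D"
    unfolding resolution_def by (simp add: rank FM_0 graded_map_zero_map)
  moreover have "{v \<in> FM n 1. v 0 = 0} = {0}"
  proof (intro equalityI subsetI)
    fix v assume "v \<in> {v \<in> FM n 1. v 0 = 0}"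
    then have "v a = 0" for a by (cases "a = 0") (auto simp: FM_iff)
    then show "v \<in> {0}" by (simp add: fun_eq_iff)
  qed (simp add: FM_closed)
  then have "?D 0 ` FM n (ranks 0 (Suc d) 1) = {v \<in> FM n 1. v 0 \<in> J 0 (Suc d)}"
    by (simp add: rank FM_0 J_0)
  ultimately show ?thesis by blast
qed

lemma resolution_exists:
  assumes "r \<le> n"
  shows "\<exists>D. resolution n (ranks r d) (shifts d) D \<and>
    D 0 ` FM n (ranks r d 1) = {v \<in> FM n 1. v 0 \<in> J r d}"
  using assms
proof (induction r arbitrary: d)
  case 0
  show ?case
  proof (cases d)
    case 0
    show ?thesis unfolding 0 by (rule resolution_degree_0)
  next
    case (Suc d')
    show ?thesis unfolding Suc by (rule resolution_no_vars)
  qed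
next
  case (Suc r)
  then have "r < n" by simp
  note IH = Suc.IH
  show ?case
  proof (induction d)
    case 0
    show ?case by (rule resolution_degree_0)
  next
    case (Suc d)
    obtain DA where A: "resolution n (ranks r (Suc d)) (shifts (Suc d)) DA"
      "DA 0 ` FM n (ranks r (Suc d) 1) = {v \<in> FM n 1. v 0 \<in> J r (Suc d)}"
      using IH[of "Suc d"] \<open>r < n\<close> by auto
    obtain DB where B: "resolution n (ranks (Suc r) d) (shifts d) DB"
      "DB 0 ` FM n (ranks (Suc r) d 1) = {v \<in> FM n 1. v 0 \<in> J (Suc r) d}"
      using Suc.IH by blast
    have "Q r \<noteq> 0"
    proof
      assume "Q r = 0"
      then have "Q r * 1 \<in> J 0 (Suc 0)" by (simp add: J_0)
      then have "(1 :: cpoly) \<in> J 0 (Suc 0)"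
        using J_Q_iff(2)[of r 1 0 "Suc 0"] \<open>r < n\<close> polys_closed(2) by blast
      then show False by (simp add: J_0)
    qed
    have "\<exists>D. resolution n (ranks (Suc r) (Suc d)) (shifts (Suc d)) D \<and>
        D 0 ` FM n (ranks (Suc r) (Suc d) 1) = {u + smul (Q r) w | u w.
          u \<in> DA 0 ` FM n (ranks r (Suc d) 1) \<and> w \<in> DB 0 ` FM n (ranks (Suc r) d 1)}"
    \<comment> \<open>In position \<open>Suc j\<close> the power \<open>d\<close> has shift
      \<open>k d + k j\<close> and the power \<open>Suc d\<close> has
      \<open>k d + k (j + 1)\<close>, which gives \<open>e = k d\<close>.\<close>
    proof (rule mapping_cone[OF A(1) _ _ _ B(1), where e="int k * int d" and k="int k"])
      show "Q r \<in> polys n" "\<And>m. m \<in> keys (Q r) \<Longrightarrow> int (mdeg m) = int k" "Q r \<noteq> 0"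
        using Q_forms[of r] \<open>r < n\<close> \<open>Q r \<noteq> 0\<close> by (auto simp: forms_iff)
      show "v \<in> DA 0 ` FM n (ranks r (Suc d) 1)"
        if "v \<in> FM n 1" "smul (Q r) v \<in> DA 0 ` FM n (ranks r (Suc d) 1)" for v
        using that J_Q_iff(2)[of r "v 0" r "Suc d"] \<open>r < n\<close> unfolding A(2)
        by (auto simp: smul_def FM_iff)
      show "DA 0 ` FM n (ranks r (Suc d) 1) \<subseteq> DB 0 ` FM n (ranks (Suc r) d 1)"
        unfolding A(2) B(2) using J_mono[of r d] J_mono_vars[of r d] by auto
    qed (simp_all add: ranks_def shifts_def brank_simps algebra_simps)
    then obtain D where D: "resolution n (ranks (Suc r) (Suc d)) (shifts (Suc d)) D"
      "D 0 ` FM n (ranks (Suc r) (Suc d) 1) = {u + smul (Q r) w | u w.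
          u \<in> {v \<in> FM n 1. v 0 \<in> J r (Suc d)} \<and> w \<in> {v \<in> FM n 1. v 0 \<in> J (Suc r) d}}"
      unfolding A(2) B(2) by blast
    have "{u + smul (Q r) w | u w. u \<in> {v \<in> FM n 1. v 0 \<in> J r (Suc d)} \<and>
        w \<in> {v \<in> FM n 1. v 0 \<in> J (Suc r) d}} = {v \<in> FM n 1. v 0 \<in> J (Suc r) (Suc d)}"
    proof (intro equalityI subsetI)
      fix v assume "v \<in> {u + smul (Q r) w | u w. u \<in> {v \<in> FM n 1. v 0 \<in> J r (Suc d)} \<and>
        w \<in> {v \<in> FM n 1. v 0 \<in> J (Suc r) d}}"
      then obtain u w where uw: "v = u + smul (Q r) w" "u \<in> FM n 1" "w \<in> FM n 1"
        "u 0 \<in> J r (Suc d)" "w 0 \<in> J (Suc r) d" by blast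
      then have "v \<in> FM n 1" using Q_polys[of r] \<open>r < n\<close> by (auto intro: FM_closed)
      moreover have "v 0 \<in> J (Suc r) (Suc d)"
        unfolding J_split[OF \<open>r < n\<close>] using uw by (auto simp: smul_def)
      ultimately show "v \<in> {v \<in> FM n 1. v 0 \<in> J (Suc r) (Suc d)}" by simp
    next
      fix v assume v: "v \<in> {v \<in> FM n 1. v 0 \<in> J (Suc r) (Suc d)}"
      then obtain x y where xy: "v 0 = x + Q r * y" "x \<in> J r (Suc d)" "y \<in> J (Suc r) d"
        unfolding J_split[OF \<open>r < n\<close>] by blast
      let ?e = "\<lambda>f (a::nat). if a = 0 then f else (0 :: cpoly)"
      have "?e x \<in> FM n 1" "?e y \<in> FM n 1"
        using xy J_polys by (auto simp: FM_iff polys_closed)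
      moreover have "v = ?e x + smul (Q r) (?e y)"
        using v xy(1) by (auto simp: fun_eq_iff smul_def FM_iff)
      ultimately show "v \<in> {u + smul (Q r) w | u w. u \<in> {v \<in> FM n 1. v 0 \<in> J r (Suc d)} \<and>
        w \<in> {v \<in> FM n 1. v 0 \<in> J (Suc r) d}}" using xy(2,3) by fastforce
    qed
    with D show ?case by metis
  qed
qed

lemma graded_betti_J:
  assumes "d \<ge> 1"
  shows "graded_betti n (J n d) (Suc i) (int (k * d + k * i)) = brank i n d"
proof -
  obtain D where D: "resolution n (ranks n d) (shifts d) D"
    "D 0 ` FM n (ranks n d 1) = {v \<in> FM n 1. v 0 \<in> J n d}"
    using resolution_exists by blast
  have "graded_betti n (J n d) (Suc i) (int (k * d + k * i)) =
      card {a. a < ranks n d (Suc i) \<and> shifts d (Suc i) a = int (k * d + k * i)}"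
  proof (rule graded_betti_eq_card[OF D(1) _ _ J_zero_mem D(2)])
    \<comment> \<open>At \<open>i = 0\<close> the claim is \<open>0 < k d\<close>, which is where
      \<open>d \<ge> 1\<close> enters; afterwards the shifts grow by \<open>k\<close>.\<close>
    show "shifts d i a < shifts d (Suc i) b" for i a b
      using k_pos assms by (cases i) (auto simp: shifts_def algebra_simps)
  qed (simp_all add: ranks_def shifts_def)
  also have "\<dots> = brank i n d" by (simp add: ranks_def shifts_def)
  finally show ?thesis .
qed

end


section \<open>The Hilbert series\<close>

lemma finite_monomials: "finite {m. keys m \<subseteq> {..n::nat} \<and> mdeg m = M}"
proof (rule finite_imageD)
  let ?f = "\<lambda>m. restrict (lookup m) {..n}"
  have "lookup m i \<le> mdeg m" for m i
    by (cases "i \<in> keys m") (auto simp: mdeg_def in_keys_iff intro!: member_le_sum)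
  then have "?f ` {m. keys m \<subseteq> {..n} \<and> mdeg m = M} \<subseteq> {..n} \<rightarrow>\<^sub>E {..M}"
    by (intro image_subsetI PiE_I) auto
  then show "finite (?f ` {m. keys m \<subseteq> {..n} \<and> mdeg m = M})"
    by (rule finite_subset) (auto intro!: finite_PiE)
  show "inj_on ?f {m. keys m \<subseteq> {..n} \<and> mdeg m = M}"
  proof (intro inj_onI poly_mapping_eqI)
    fix a b :: "nat \<Rightarrow>\<^sub>0 nat" and i
    assume ab: "a \<in> {m. keys m \<subseteq> {..n} \<and> mdeg m = M}" "b \<in> {m. keys m \<subseteq> {..n} \<and> mdeg m = M}"
      "?f a = ?f b"
    show "lookup a i = lookup b i"
    proof (cases "i \<le> n")
      case True
      then show ?thesis using fun_cong[OF ab(3), of i] by simp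
    next
      case False
      then have "i \<notin> keys a" "i \<notin> keys b" using ab(1,2) by auto
      then show ?thesis by (simp add: in_keys_iff)
    qed
  qed
qed

section \<open>Counting the basis elements outside \<open>J n d\<close>\<close>

context grid
begin

text \<open>For \<open>r = n\<close> these monomials index a basis of the degree \<open>M\<close>
  part of \<open>S/J n d\<close>. For \<open>r < n\<close> the variables
  \<open>x_r, ..., x_{n-1}\<close> are absent, so that a recursion can add them one at a
  time.\<close>

definition standard :: "nat \<Rightarrow> nat \<Rightarrow> nat \<Rightarrow> (nat \<Rightarrow>\<^sub>0 nat) set" where
  "standard r d M = {m. keys m \<subseteq> {..<r} \<union> {n} \<and> mdeg m = M \<and> Q_index r m < d}"

lemma finite_standard:
  assumes "r \<le> n"
  shows "finite (standard r d M)"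
  by (rule finite_subset[OF _ finite_monomials[of n M]]) (use assms in \<open>auto simp: standard_def\<close>)

text \<open>\<open>Phi1\<close> preserves degrees and maps the monomials of \<open>K n d\<close> to
  a spanning set of \<open>J n d\<close>; so the images of the remaining monomials represent a basis
  of the quotient.\<close>

lemma hilbert_fun_J: "hilbert_fun n (J n d) M = card (standard n d M)"
proof -
  let ?s = "\<lambda>c f. cst c * f :: cpoly"
  let ?W = "J n d \<inter> forms n M"
  define e where "e m = Phi1 (single m 1)" for m
  have vs: "vector_space ?s"
    by unfold_locales (auto simp: algebra_simps cst_add cst_mult)
  have scale: "cst c * f \<in> forms n M" if "f \<in> forms n M" for c f
    using forms_mult[OF forms_cst that] by simp
  have sub: "module.subspace ?s ?W"
  proof -
    interpret vector_space ?s by (rule vs)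
    have "cst c * x \<in> J n d" if "x \<in> J n d" for c x
      using J_ideal[of n d] that polys_cst unfolding is_ideal_def by blast
    then show ?thesis
      unfolding subspace_def using J_zero_mem forms_zero J_add forms_add scale by blast
  qed
  have keys_std: "keys m \<subseteq> {..n}" "mdeg m = M" "Q_index n m < d" if "m \<in> standard n d M" for m
    using that by (auto simp: standard_def)
  have single_forms: "single m c \<in> forms n M" if "m \<in> standard n d M" for m c
    using keys_std(1,2)[OF that] by (simp add: forms_iff polys_single)
  have inj: "inj_on e (standard n d M)"
  proof (rule inj_onI)
    fix a b assume ab: "a \<in> standard n d M" "b \<in> standard n d M" "e a = e b"
    have "single a 1 = Psi (e a)"
      unfolding e_def by (rule Psi_Phi[OF polys_single[OF keys_std(1)[OF ab(1)]], symmetric])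
    also have "\<dots> = Psi (e b)" using ab(3) by (rule arg_cong)
    also have "\<dots> = single b 1"
      unfolding e_def by (rule Psi_Phi[OF polys_single[OF keys_std(1)[OF ab(2)]]])
    finally show "a = b" by (metis lookup_single_eq lookup_single_not_eq zero_neq_one)
  qed
  have comb: "(\<Sum>b\<in>e ` standard n d M. ?s (c b) b) = Phi1 (\<Sum>m\<in>standard n d M. single m (c (e m)))" for c
  proof -
    have "(\<Sum>b\<in>e ` standard n d M. ?s (c b) b) = (\<Sum>m\<in>standard n d M. cst (c (e m)) * e m)"
      by (simp add: sum.reindex[OF inj])
    also have "\<dots> = Phi1 (\<Sum>m\<in>standard n d M. single m (c (e m)))"
      by (simp add: Phi_simps e_def)
    finally show ?thesis .
  qed
  have lookup_comb: "lookup (\<Sum>m\<in>standard n d M. single m (c m)) q =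
      (if q \<in> standard n d M then c q else 0)" for c :: "(nat \<Rightarrow>\<^sub>0 nat) \<Rightarrow> complex" and q
  proof -
    have "lookup (\<Sum>m\<in>standard n d M. single m (c m)) q = (\<Sum>m\<in>standard n d M. if m = q then c q else 0)"
      unfolding lookup_sum by (intro sum.cong) (auto simp: lookup_single)
    then show ?thesis using finite_standard[of n] by simp
  qed
  have comb_forms: "(\<Sum>m\<in>standard n d M. single m (c m)) \<in> forms n M" for c
    by (intro forms_sum single_forms)
  have "quot_basis ?s (forms n M) ?W (e ` standard n d M)"
    unfolding quot_basis_def
  proof (intro conjI ballI allI impI)
    show "finite (e ` standard n d M)" using finite_standard[of n] by simp
    show "e ` standard n d M \<subseteq> forms n M" using single_forms Phi_forms by (auto simp: e_def)
  next
    fix v assume v: "v \<in> forms n M"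
    define h where "h = Psi v"
    have h: "h \<in> forms n M" using v by (simp add: h_def Phi_forms)
    define h' where "h' = h - (\<Sum>m\<in>standard n d M. single m (lookup h m))"
    have vP: "v = Phi1 h" using v by (simp add: h_def Phi_Psi forms_iff)
    have h': "h' \<in> forms n M"
      using h comb_forms[of "lookup h"] keys_diff[of h "\<Sum>m\<in>standard n d M. single m (lookup h m)"]
      by (auto simp: h'_def forms_iff polys_diff)
    have "h' \<in> K n d"
    proof -
      have "d \<le> Q_index n q" if q: "q \<in> keys h'" for q
      proof (rule ccontr)
        assume "\<not> d \<le> Q_index n q"
        moreover have "q \<notin> standard n d M"
          using q by (auto simp: h'_def in_keys_iff lookup_minus lookup_comb split: if_splits)
        ultimately have "\<not> (keys q \<subseteq> {..n} \<and> mdeg q = M)"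
          by (auto simp: standard_def)
        then show False using h' q by (auto simp: forms_iff polys_iff)
      qed
      then show ?thesis using h' by (auto simp: K_def forms_iff)
    qed
    moreover have "h' \<in> polys n" using h' by (simp add: forms_iff)
    ultimately have "Phi1 h' \<in> ?W" using J_Phi_iff Phi_forms[OF h'] by blast
    moreover have "Phi1 h' = v - (\<Sum>b\<in>e ` standard n d M. ?s (lookup h (inv_into (standard n d M) e
        b)) b)"
    proof -
      have "(\<Sum>m\<in>standard n d M. single m (lookup h (inv_into (standard n d M) e (e m)))) =
          (\<Sum>m\<in>standard n d M. single m (lookup h m))"
        using inj by (intro sum.cong) auto
      then show ?thesis unfolding comb by (simp add: h'_def Phi_simps vP)
    qed
    ultimately show "\<exists>c. v - (\<Sum>b\<in>e ` standard n d M. ?s (c b) b) \<in> ?W"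
      by (intro exI[of _ "\<lambda>b. lookup h (inv_into (standard n d M) e b)"]) simp
  next
    fix c b assume c: "(\<Sum>b\<in>e ` standard n d M. ?s (c b) b) \<in> ?W" and "b \<in> e ` standard n d M"
    then obtain m where m: "m \<in> standard n d M" "b = e m" by blast
    let ?h = "\<Sum>m\<in>standard n d M. single m (c (e m))"
    have "?h \<in> K n d"
      using c J_Phi_iff[of ?h] comb_forms[of "\<lambda>m. c (e m)"] unfolding comb by (auto simp: forms_iff)
    then have "m \<notin> keys ?h" using keys_std(3)[OF m(1)] by (auto simp: K_def)
    then show "c b = 0" using m by (simp add: in_keys_iff lookup_comb)
  qed
  then have "hilbert_fun n (J n d) M = card (e ` standard n d M)"
    unfolding hilbert_fun_def by (rule quot_dim_eqI[OF vs sub])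
  then show ?thesis by (simp add: card_image inj)
qed

text \<open>If the exponent of \<open>x_r\<close> is at least \<open>k\<close>, a factor
  \<open>x_r^k\<close> can be removed, which lowers the index by one; an exponent
  \<open>b < k\<close> does not count in the index, and removing \<open>x_r^b\<close> leaves a
  monomial without \<open>x_r\<close>.\<close>

lemma card_standard_Suc:
  assumes r: "r < n"
  shows "card (standard (Suc r) (Suc d) M) = (if k \<le> M then card (standard (Suc r) d (M - k)) else 0) +
    (\<Sum>b<k. if b \<le> M then card (standard r (Suc d) (M - b)) else 0)"
proof -
  have inj: "inj_on ((+) (single r e)) A" for e and A :: "(nat \<Rightarrow>\<^sub>0 nat) set" by (rule inj_onI) simp
  have minus: "m = single r e + (m - single r e)" if "e \<le> lookup m r"
    for m :: "nat \<Rightarrow>\<^sub>0 nat" and e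
    using that by (intro poly_mapping_eqI) (auto simp: lookup_add lookup_minus lookup_single when_def)
  let ?hi = "{m \<in> standard (Suc r) (Suc d) M. k \<le> lookup m r}"
  let ?lo = "\<lambda>b. {m \<in> standard (Suc r) (Suc d) M. lookup m r = b}"
  have hi: "?hi = (if k \<le> M then (+) (single r k) ` standard (Suc r) d (M - k) else {})"
  proof (intro equalityI subsetI)
    fix m assume m: "m \<in> ?hi"
    let ?m = "m - single r k"
    have eq: "m = single r k + ?m" using m by (intro minus) simp
    then have "mdeg m = k + mdeg ?m" "Q_index (Suc r) m = Suc (Q_index (Suc r) ?m)"
      by (metis mdeg_add mdeg_single, metis Q_index_shift lessI)
    moreover have "keys ?m \<subseteq> keys m" by (auto simp: in_keys_iff lookup_minus)
    ultimately have "k \<le> M" "?m \<in> standard (Suc r) d (M - k)"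
      using m by (auto simp: standard_def)
    then show "m \<in> (if k \<le> M then (+) (single r k) ` standard (Suc r) d (M - k) else {})"
      using eq by auto
  next
    fix m assume "m \<in> (if k \<le> M then (+) (single r k) ` standard (Suc r) d (M - k) else {})"
    then obtain m' where m': "k \<le> M" "m = single r k + m'" "m' \<in> standard (Suc r) d (M - k)"
      by (auto split: if_splits)
    then show "m \<in> ?hi"
      by (auto simp: standard_def Q_index_shift mdeg_add keys_plus_nat lookup_add split: if_splits)
  qed
  have lo: "?lo b = (if b \<le> M then (+) (single r b) ` standard r (Suc d) (M - b) else {})" if b:
      "b < k" for b
  proof (intro equalityI subsetI)
    fix m assume m: "m \<in> ?lo b"
    let ?m = "m - single r b"
    have eq: "m = single r b + ?m" using m by (intro minus) simp
    then have "mdeg m = b + mdeg ?m" "Q_index r m = Q_index r ?m"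
      by (metis mdeg_add mdeg_single, metis Q_index_shift_ge order_refl)
    moreover have "Q_index (Suc r) m = Q_index r m" using m b by (simp add: Q_index_def)
    moreover have "keys ?m \<subseteq> keys m - {r}" using m by (auto simp: in_keys_iff lookup_minus)
    moreover have "keys m \<subseteq> insert r ({..<r} \<union> {n})"
      using m by (simp add: standard_def lessThan_Suc insert_commute)
    moreover have "mdeg m = M" "Q_index (Suc r) m < Suc d" using m by (simp_all add: standard_def)
    ultimately have "keys ?m \<subseteq> {..<r} \<union> {n}" "mdeg ?m = M - b" "b \<le> M" "Q_index r ?m < Suc d"
      by (blast, linarith+)
    then have "b \<le> M" "?m \<in> standard r (Suc d) (M - b)" by (simp_all add: standard_def)
    then show "m \<in> (if b \<le> M then (+) (single r b) ` standard r (Suc d) (M - b) else {})"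
      using eq by auto
  next
    fix m assume "m \<in> (if b \<le> M then (+) (single r b) ` standard r (Suc d) (M - b) else {})"
    then obtain m' where m': "b \<le> M" "m = single r b + m'" "m' \<in> standard r (Suc d) (M - b)"
      by (auto split: if_splits)
    have "r \<notin> keys m'" using m'(3) r by (auto simp: standard_def)
    then have "lookup m r = b" using m'(2) by (simp add: lookup_add in_keys_iff)
    moreover have "Q_index (Suc r) m = Q_index r m'"
      using \<open>lookup m r = b\<close> b m'(2) Q_index_shift_ge[of r r b m'] by (simp add: Q_index_def)
    ultimately show "m \<in> ?lo b"
      using m' by (auto simp: standard_def mdeg_add keys_plus_nat split: if_splits)
  qed
  have fin: "finite (standard (Suc r) (Suc d) M)" using r by (intro finite_standard) simp
  have "standard (Suc r) (Suc d) M = ?hi \<union> (\<Union>b\<in>{..<k}. ?lo b)"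
    by auto
  then have "card (standard (Suc r) (Suc d) M) = card (?hi \<union> (\<Union>b\<in>{..<k}. ?lo b))"
    by simp
  also have "\<dots> = card ?hi + card (\<Union>b\<in>{..<k}. ?lo b)"
    using fin by (intro card_Un_disjoint) auto
  also have "card (\<Union>b\<in>{..<k}. ?lo b) = (\<Sum>b<k. card (?lo b))"
    using fin by (intro card_UN_disjoint) auto
  also have "card ?hi = (if k \<le> M then card (standard (Suc r) d (M - k)) else 0)"
    unfolding hi by (simp add: card_image inj)
  also have "(\<Sum>b<k. card (?lo b)) = (\<Sum>b<k. if b \<le> M then card (standard r (Suc d) (M - b)) else 0)"
    using lo by (intro sum.cong) (auto simp: card_image inj)
  finally show ?thesis .
qed

definition HS :: "nat \<Rightarrow> nat \<Rightarrow> rat fps" where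
  "HS r d = Abs_fps (\<lambda>M. of_nat (card (standard r d M)))"

lemma HS_simps:
  "HS r 0 = 0"
  "HS 0 (Suc d) = Abs_fps (\<lambda>_. 1)"
  "r < n \<Longrightarrow> HS (Suc r) (Suc d) = fps_X ^ k * HS (Suc r) d + (\<Sum>b<k. fps_X ^ b) * HS r (Suc d)"
proof -
  show "HS r 0 = 0" by (simp add: HS_def standard_def fps_zero_def)
  have "standard 0 (Suc d) M = {single n M}" for M
  proof (intro equalityI subsetI)
    fix m assume "m \<in> standard 0 (Suc d) M"
    then have m: "keys m \<subseteq> {n}" "mdeg m = M" by (auto simp: standard_def)
    then have "lookup m n = M" using mdeg_eq_sum[of "{n}" m] by simp
    moreover have "lookup m i = 0" if "i \<noteq> n" for i
      using that m(1) by (auto simp: in_keys_iff)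
    ultimately have "lookup m i = lookup (single n M) i" for i
      by (cases "i = n") (simp_all add: lookup_single)
    then show "m \<in> {single n M}" by (simp add: poly_mapping_eqI)
  qed (auto simp: standard_def Q_index_def)
  then show "HS 0 (Suc d) = Abs_fps (\<lambda>_. 1)" by (simp add: HS_def)
  assume r: "r < n"
  show "HS (Suc r) (Suc d) = fps_X ^ k * HS (Suc r) d + (\<Sum>b<k. fps_X ^ b) * HS r (Suc d)"
  proof (rule fps_ext)
    fix M
    have "fps_nth (HS (Suc r) (Suc d)) M = (if k \<le> M then of_nat (card (standard (Suc r) d (M -
        k))) else 0) +
        (\<Sum>b<k. if b \<le> M then of_nat (card (standard r (Suc d) (M - b))) else 0)"
      by (simp add: HS_def card_standard_Suc[OF r] if_distrib[of of_nat] cong: if_cong)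
    also have "\<dots> = fps_nth (fps_X ^ k * HS (Suc r) d + (\<Sum>b<k. fps_X ^ b) * HS r (Suc d)) M"
      by (auto simp: sum_distrib_right fps_sum_nth fps_X_power_mult_nth HS_def not_le
          intro!: arg_cong2[of _ _ _ _ "(+)"] sum.cong)
    finally show "fps_nth (HS (Suc r) (Suc d)) M =
        fps_nth (fps_X ^ k * HS (Suc r) d + (\<Sum>b<k. fps_X ^ b) * HS r (Suc d)) M" .
  qed
qed

lemma brank_eq_0: "r \<le> i \<Longrightarrow> brank i r (Suc d) = 0"
  by (simp add: brank_def)

text \<open>One more factor \<open>1 - X\<close> turns the geometric sum in the recursion of
  \<open>HS\<close> into \<open>1 - X^k\<close>, and its term \<open>- X^k\<close> yields the
  shifted summand in the recursion of the ranks. The number \<open>Suc L\<close> of summands does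
  not depend on \<open>r\<close>, so that all sums have the same range; surplus terms
  vanish.\<close>

lemma HS_numerator:
  assumes "r \<le> n" "r \<le> Suc L"
  shows "HS r d * (1 - fps_X) ^ (r + 1) =
    1 + (\<Sum>i<Suc L. (- 1) ^ Suc i * of_nat (brank i r d) * fps_X ^ (k * d + k * i))"
  using assms
proof (induction r arbitrary: d)
  case 0
  show ?case
  proof (cases d)
    case 0
    have "(\<Sum>i<Suc L. (- 1) ^ Suc i * of_nat (brank i 0 0) * fps_X ^ (k * 0 + k * i)) =
        (\<Sum>i<Suc L. if i = 0 then - 1 else (0 :: rat fps))"
      by (intro sum.cong) (auto simp: brank_simps)
    then show ?thesis by (simp add: 0 HS_simps)
  next
    case (Suc d')
    have "Abs_fps (\<lambda>_. 1) * (1 - fps_X) = (1 :: rat fps)"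
      by (auto simp: fps_eq_iff right_diff_distrib)
    then show ?thesis by (simp add: Suc HS_simps brank_simps)
  qed
next
  case (Suc r)
  then have r: "r < n" "r \<le> L" by auto
  note IH = Suc.IH
  let ?X = "fps_X :: rat fps"
  let ?t = "\<lambda>b d i. (- 1) ^ Suc i * of_nat (b i) * ?X ^ (k * d + k * i)"
  show ?case
  proof (induction d)
    case 0
    have "(\<Sum>i<Suc L. ?t (\<lambda>i. brank i (Suc r) 0) 0 i) = (\<Sum>i<Suc L. if i = 0 then - 1 else 0)"
      by (intro sum.cong) (auto simp: brank_simps)
    then show ?case by (simp add: HS_simps)
  next
    case (Suc d)
    let ?u = "\<lambda>i. brank i (Suc r) d" and ?v = "\<lambda>i. brank i r (Suc d)"
    have geom: "(\<Sum>b<k. ?X ^ b) * (1 - ?X) = 1 - ?X ^ k"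
      by (simp add: one_diff_power_eq mult.commute)
    have "HS (Suc r) (Suc d) * (1 - ?X) ^ (Suc r + 1) =
        ?X ^ k * (HS (Suc r) d * (1 - ?X) ^ (Suc r + 1)) +
        ((\<Sum>b<k. ?X ^ b) * (1 - ?X)) * (HS r (Suc d) * (1 - ?X) ^ (r + 1))"
      unfolding HS_simps(3)[OF r(1)] by (simp add: algebra_simps)
    also have "\<dots> = ?X ^ k * (1 + (\<Sum>i<Suc L. ?t ?u d i)) +
        (1 - ?X ^ k) * (1 + (\<Sum>i<Suc L. ?t ?v (Suc d) i))"
      unfolding Suc.IH geom using IH[of "Suc d"] r by simp
    also have "\<dots> = 1 + ((\<Sum>i<Suc L. ?X ^ k * ?t ?u d i) + (\<Sum>i<Suc L. ?t ?v (Suc d) i)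
        - (\<Sum>i<Suc L. ?X ^ k * ?t ?v (Suc d) i))"
      by (simp only: sum_distrib_left[symmetric]) (simp add: algebra_simps)
    also have "(\<Sum>i<Suc L. ?X ^ k * ?t ?u d i) = (\<Sum>i<Suc L. ?t ?u (Suc d) i)"
      by (intro sum.cong) (simp_all add: power_add mult_ac)
    \<comment> \<open>The last term is 0 as \<open>r \<le> L\<close>. Dropping it makes room for the
      index shift that follows, where \<open>X^k\<close> moves a term one position on and the sign
      changes.\<close>
    also have "(\<Sum>i<Suc L. ?X ^ k * ?t ?v (Suc d) i) = (\<Sum>i<L. ?X ^ k * ?t ?v (Suc d) i)"
      using brank_eq_0[OF r(2)] by simp
    also have "\<dots> = (\<Sum>i<L. - ?t (\<lambda>i. brank (i - 1) r (Suc d)) (Suc d) (Suc i))"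
      by (intro sum.cong) (simp_all add: power_add mult_ac)
    also have "(\<Sum>i<Suc L. ?t ?u (Suc d) i) + (\<Sum>i<Suc L. ?t ?v (Suc d) i) - \<dots> =
        (?t ?u (Suc d) 0 + ?t ?v (Suc d) 0) +
        (\<Sum>i<L. ?t ?u (Suc d) (Suc i) + ?t ?v (Suc d) (Suc i) +
          ?t (\<lambda>i. brank (i - 1) r (Suc d)) (Suc d) (Suc i))"
      by (simp only: sum.lessThan_Suc_shift sum_negf sum.distrib) simp
    also have "\<dots> = (\<Sum>i<Suc L. ?t (\<lambda>i. brank i (Suc r) (Suc d)) (Suc d) i)"
      unfolding sum.lessThan_Suc_shift
      by (intro arg_cong2[of _ _ _ _ "(+)"] sum.cong) (simp_all add: brank_simps algebra_simps)
    finally show ?case .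
  qed
qed

lemma hilbert_series_J:
  assumes "n \<ge> 1"
  shows "hilbert_series n (J n d) = (1 + (\<Sum>i<n. (- 1) ^ Suc i * of_nat (brank i n d) *
    fps_X ^ (k * d + k * i))) / (1 - fps_X) ^ (n + 1)"
proof -
  obtain L where L: "n = Suc L" using assms by (cases n) auto
  have "fps_nth (1 - fps_X) 0 = (1 :: rat)" by simp
  then have "(1 - fps_X) ^ (n + 1) \<noteq> (0 :: rat fps)" by (metis fps_zero_nth power_eq_0_iff zero_neq_one)
  moreover have "hilbert_series n (J n d) = HS n d"
    by (simp add: hilbert_series_def HS_def hilbert_fun_J)
  moreover have "HS n d * (1 - fps_X) ^ (n + 1) =
      1 + (\<Sum>i<n. (- 1) ^ Suc i * of_nat (brank i n d) * fps_X ^ (k * d + k * i))"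
    using HS_numerator[of n L d] unfolding L by blast
  ultimately show ?thesis
    using nonzero_mult_div_cancel_right[of "(1 - fps_X) ^ (n + 1)" "HS n d"] by argo
qed

end

theorem theorem4p9:
  fixes n d k :: nat and \<xi> :: complex
    and I :: "cpoly set" and \<beta> :: "nat \<Rightarrow> nat"
  assumes "n \<ge> 1" and "d \<ge> 1" and "k \<ge> 2"
    and "primitive_root_unity k \<xi>"
    and "I = fat_points_ideal n d (root_points n k \<xi>)"
    and "\<And>i. \<beta> i = graded_betti n I i (int (k * d + k * (i - 1)))"
  shows "(I = Idl\<^bsub>poly_ring n\<^esub>
           {(\<Prod>i<n. (var i ^ k - var n ^ k) ^ a i) | a :: nat \<Rightarrow> nat. (\<Sum>i<n. a i) = d}) \<and>
         hilbert_series n I =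
           (1 + (\<Sum>i=1..n. (-1) ^ i * of_nat (\<beta> i) * fps_X ^ (k * d + k * (i - 1))))
             / (1 - fps_X) ^ (n + 1) \<and>
         (\<forall>i\<in>{1..n}. \<beta> i = ((d + i - 2) choose (i - 1)) * ((d + n - 1) choose (n - i)))"
proof -
  interpret grid n k using assms(3) by unfold_locales simp
  have I: "I = J n d" using fat_points_ideal_eq_J assms by simp
  have \<beta>: "\<beta> (Suc i) = brank i n d" for i
    using graded_betti_J[OF assms(2)] by (simp add: assms(6) I)
  have "(\<Sum>i=1..n. (-1) ^ i * of_nat (\<beta> i) * fps_X ^ (k * d + k * (i - 1))) =
      (\<Sum>i<n. (-1) ^ Suc i * of_nat (brank i n d) * (fps_X :: rat fps) ^ (k * d + k * i))"
    by (simp add: sum.atLeast1_atMost_eq \<beta>)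
  then have "hilbert_series n I =
      (1 + (\<Sum>i=1..n. (-1) ^ i * of_nat (\<beta> i) * fps_X ^ (k * d + k * (i - 1)))) / (1 - fps_X) ^ (n + 1)"
    using hilbert_series_J[OF assms(1)] by (simp add: I)
  moreover have "\<beta> i = ((d + i - 2) choose (i - 1)) * ((d + n - 1) choose (n - i))"
    if i: "i \<in> {1..n}" for i
  proof -
    obtain j where j: "i = Suc j" using i by (cases i) auto
    \<comment> \<open>Symmetry of the binomial coefficient:
      \<open>(d + n - 1) - (d + j) = n - Suc j\<close>.\<close>
    have "(d + n - 1) choose (d + j) = (d + n - 1) choose (n - Suc j)"
      using i j by (subst binomial_symmetric) (simp_all add: diff_diff_eq2 add.commute)
    then show ?thesis by (simp add: j \<beta> brank_def)
  qed
  ultimately show ?thesis using J_eq_Idl[of d] by (simp add: I)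
qed

end
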